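(* Let $L>0$, let $\sigma\in(0,1)$, and let $\{k_n\}$ be a sequence of integers with $0\le k_n\le Ln^2$ and $\lim_{n\to+\infty}\frac{k_n}{Ln^2}=\sigma$. Then the sequence of functionals $\{F_n^{L,k_n}\}$ $\Gamma$-converges, with respect to the weak-$*$ convergence in $L^\infty(0,L)$, as $n\to+\infty$, to the functional $F^{L,\sigma}\colon L^\infty(0,L)\to[0,+\infty]$ given by $$F^{L,\sigma}(u)=\begin{cases}2\,\mathcal H^1(\{x\in(0,L):0<u(x)<1\})+|Du|(0,L) & \text{if } u\in BV(0,L),\ 0\le u\le1,\ \displaystyle\int_0^Lu\,dx=L\sigma,\\ +\infty&\text{otherwise.}\end{cases}$$
   Context: Let $\mathbb N=\{1,2,\dots\}$ and $L_n=\frac{\lfloor Ln^2\rfloor}{n^2}$. Let $\mathcal A_n(L,k_n)$ be the set of functions $u\colon(0,L_n]\to\{0,1\}$ that are constant on each interval $(\frac{i-1}{n^2},\frac i{n^2}]$, $i=1,\dots,\lfloor Ln^2\rfloor$, and such that $$\#\{i\in\{1,\dots,\lfloor Ln^2\rfloor\}:u_i=1\}=k_n,\qquad\text{where } u_i=u\big(\tfrac{i}{n^2}\big).$$ Each such function is extended by $0$ outside $(0,L_n]$, so that it is regarded as an element of $L^\infty(0,L)$. Let $$\mathcal E_n(L)=\big\{\{i,j\}:\ i,j\in\mathbb N\cap(0,Ln^2]\ \text{and}\ |i-j|=1\ \text{or}\ |i-j|=n\big\}$$ (a set of unordered pairs). For $u\in\mathcal A_n(L,k_n)$ define $$F_n^{L,k_n}(u)=\frac1n\sum_{\{i,j\}\in\mathcal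 E_n(L)}(u_i-u_j)^2,$$ and set $F_n^{L,k_n}(u)=+\infty$ for all other $u\in L^\infty(0,L)$. $\mathcal H^1$ is the one-dimensional Hausdorff (here Lebesgue) measure, $BV(0,L)$ is the space of functions of bounded variation on $(0,L)$, and $|Du|$ is the total variation measure of the distributional derivative $Du$. $\Gamma$-convergence of functionals $G_n$ to $G$ with respect to the weak-$*$ convergence in $L^\infty(0,L)$ means: (i) for every $u\in L^\infty(0,L)$ and every sequence $u_n$ converging weakly-$*$ to $u$ in $L^\infty(0,L)$, $G(u)\le\liminf_{n\to+\infty}G_n(u_n)$; (ii) for every $u\in L^\infty(0,L)$ there is a sequence $u_n$ converging weakly-$*$ to $u$ in $L^\infty(0,L)$ with $\limsup_{n\to+\infty}G_n(u_n)\le G(u)$. *)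

theory Defs
  imports "HOL-Analysis.Analysis"
begin

text \<open>
  Elements of \<open>L\<^sup>\<infinity>(0,L)\<close> are represented by functions on the whole real line, of which only the
  restriction to \<open>(0,L)\<close>, up to Lebesgue-null sets, matters.
\<close>

abbreviation leb_on_ivl :: "real \<Rightarrow> real measure" where
  "leb_on_ivl L \<equiv> lebesgue_on {0<..<L}"

definition Linf :: "real \<Rightarrow> (real \<Rightarrow> real) set" where
  "Linf L = {u \<in> borel_measurable (leb_on_ivl L). \<exists>C. AE x in leb_on_ivl L. \<bar>u x\<bar> \<le> C}"

text \<open>Weak-* convergence, \<open>L\<^sup>\<infinity>(0,L)\<close> being the dual of \<open>L\<^sup>1(0,L)\<close>.\<close>

definition weak_star_conv :: "real \<Rightarrow> (nat \<Rightarrow> real \<Rightarrow> real) \<Rightarrow> (real \<Rightarrow> real) \<Rightarrow> bool" where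
  "weak_star_conv L un u \<longleftrightarrow>
     (\<forall>n. un n \<in> Linf L) \<and> u \<in> Linf L \<and>
     (\<forall>g. integrable (leb_on_ivl L) g \<longrightarrow>
        (\<lambda>n. \<integral>x. un n x * g x \<partial>leb_on_ivl L) \<longlonglongrightarrow> (\<integral>x. u x * g x \<partial>leb_on_ivl L))"

definition Gamma_conv ::
    "real \<Rightarrow> (nat \<Rightarrow> (real \<Rightarrow> real) \<Rightarrow> ennreal) \<Rightarrow> ((real \<Rightarrow> real) \<Rightarrow> ennreal) \<Rightarrow> bool" where
  "Gamma_conv L Gn G \<longleftrightarrow>
     (\<forall>u\<in>Linf L. \<forall>un. weak_star_conv L un u \<longrightarrow> G u \<le> liminf (\<lambda>n. Gn n (un n))) \<and>
     (\<forall>u\<in>Linf L. \<exists>un. weak_star_conv L un u \<and> limsup (\<lambda>n. Gn n (un n)) \<le> G u)"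

definition sites :: "real \<Rightarrow> nat \<Rightarrow> nat set" where
  "sites L n = {i. 0 < i \<and> real i \<le> L * (real n)\<^sup>2}"

definition discrete_length :: "real \<Rightarrow> nat \<Rightarrow> real" where
  "discrete_length L n = of_int \<lfloor>L * (real n)\<^sup>2\<rfloor> / (real n)\<^sup>2"

definition site_value :: "nat \<Rightarrow> (real \<Rightarrow> real) \<Rightarrow> nat \<Rightarrow> real" where
  "site_value n v i = v (real i / (real n)\<^sup>2)"

definition admissible :: "real \<Rightarrow> nat \<Rightarrow> nat \<Rightarrow> (real \<Rightarrow> real) set" where
  "admissible L n k = {v.
     (\<forall>x\<in>{0<..discrete_length L n}. v x \<in> {0, 1}) \<and>
     (\<forall>x. x \<notin> {0<..discrete_length L n} \<longrightarrow> v x = 0) \<and>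
     (\<forall>i\<in>sites L n. v constant_on {(real i - 1) / (real n)\<^sup>2 <.. real i / (real n)\<^sup>2}) \<and>
     card {i \<in> sites L n. site_value n v i = 1} = k}"

definition edges :: "real \<Rightarrow> nat \<Rightarrow> nat set set" where
  "edges L n = {{i, j} | i j. i \<in> sites L n \<and> j \<in> sites L n \<and>
     (\<bar>int i - int j\<bar> = 1 \<or> \<bar>int i - int j\<bar> = int n)}"

text \<open>The end points of an unordered pair \<open>e\<close> are \<open>Max e\<close> and \<open>Min e\<close>.\<close>

definition lattice_energy :: "real \<Rightarrow> nat \<Rightarrow> (real \<Rightarrow> real) \<Rightarrow> real" where
  "lattice_energy L n v =
     1 / real n * (\<Sum>e\<in>edges L n. (site_value n v (Max e) - site_value n v (Min e))\<^sup>2)"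

text \<open>
  An element of \<open>L\<^sup>\<infinity>(0,L)\<close> is a class of functions modulo null sets, so the functional is the energy
  of the admissible representative \<open>v\<close> of \<open>u\<close>. For \<open>n \<ge> 1\<close> there is at most one such \<open>v\<close>; if there is
  none, the infimum is that of the empty set, which is \<open>\<infinity>\<close>.
\<close>

definition F_discrete :: "real \<Rightarrow> nat \<Rightarrow> nat \<Rightarrow> (real \<Rightarrow> real) \<Rightarrow> ennreal" where
  "F_discrete L k n u =
     (INF v \<in> {v \<in> admissible L n k. AE x in leb_on_ivl L. u x = v x}. ennreal (lattice_energy L n v))"

text \<open>\<open>C\<^sub>c\<^sup>\<infinity>(0,L)\<close>, the functions being extended by \<open>0\<close> to the real line.\<close>

definition test_functions :: "real \<Rightarrow> (real \<Rightarrow> real) set" where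
  "test_functions L = {\<phi>.
     (\<forall>k x. (deriv ^^ k) \<phi> differentiable (at x)) \<and>
     compact (closure {x. \<phi> x \<noteq> 0}) \<and> closure {x. \<phi> x \<noteq> 0} \<subseteq> {0<..<L}}"

abbreviation borel_ivl :: "real \<Rightarrow> real measure" where
  "borel_ivl L \<equiv> restrict_space borel {0<..<L}"

text \<open>
  \<open>m\<close> is a finite signed Borel measure on \<open>(0,L)\<close>, given as a difference \<open>\<mu> - \<nu>\<close> of finite
  (positive) measures, and is the distributional derivative of \<open>u\<close>. The values of \<open>m\<close> outside
  the Borel subsets of \<open>(0,L)\<close> are irrelevant.
\<close>

definition is_distr_deriv :: "real \<Rightarrow> (real \<Rightarrow> real) \<Rightarrow> (real set \<Rightarrow> real) \<Rightarrow> bool" where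
  "is_distr_deriv L u m \<longleftrightarrow>
     (\<exists>\<mu> \<nu>. finite_measure \<mu> \<and> finite_measure \<nu> \<and>
        sets \<mu> = sets (borel_ivl L) \<and> sets \<nu> = sets (borel_ivl L) \<and>
        (\<forall>A\<in>sets (borel_ivl L). m A = measure \<mu> A - measure \<nu> A) \<and>
        (\<forall>\<phi>\<in>test_functions L.
           (\<integral>x. u x * deriv \<phi> x \<partial>leb_on_ivl L) = - ((\<integral>x. \<phi> x \<partial>\<mu>) - (\<integral>x. \<phi> x \<partial>\<nu>))))"

definition BV :: "real \<Rightarrow> (real \<Rightarrow> real) set" where
  "BV L = {u. integrable (leb_on_ivl L) u \<and> (\<exists>m. is_distr_deriv L u m)}"

text \<open>For \<open>u\<close> in \<open>BV L\<close> the derivative is determined on all Borel subsets of \<open>(0,L)\<close>.\<close>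

definition distr_deriv :: "real \<Rightarrow> (real \<Rightarrow> real) \<Rightarrow> real set \<Rightarrow> real" where
  "distr_deriv L u = (SOME m. is_distr_deriv L u m)"

definition total_variation :: "real measure \<Rightarrow> (real set \<Rightarrow> real) \<Rightarrow> real set \<Rightarrow> ennreal" where
  "total_variation M m A =
     (SUP B \<in> {B :: nat \<Rightarrow> real set. range B \<subseteq> sets M \<and> disjoint_family B \<and> (\<Union>i. B i) = A}.
        \<Sum>i. ennreal \<bar>m (B i)\<bar>)"

definition F_limit :: "real \<Rightarrow> real \<Rightarrow> (real \<Rightarrow> real) \<Rightarrow> ennreal" where
  "F_limit L \<sigma> u =
     (if u \<in> BV L \<and> (AE x in leb_on_ivl L. 0 \<le> u x \<and> u x \<le> 1) \<and>
         (\<integral>x. u x \<partial>leb_on_ivl L) = L * \<sigma>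
      then 2 * emeasure lebesgue {x \<in> {0<..<L}. 0 < u x \<and> u x < 1} +
           total_variation (borel_ivl L) (distr_deriv L u) {0<..<L}
      else \<infinity>)"

end

theory Submission
  imports Defs "HOL-Probability.Helly_Selection" "HOL-Real_Asymp.Real_Asymp"
begin

text \<open>
  Cut the sites \<open>1, \<dots>, M\<close> into consecutive rows of \<open>n\<close> sites and stack the rows: the chain becomes
  a helix, whose bonds of length \<open>1\<close> run along the rows and whose bonds of length \<open>n\<close> join
  neighbouring rows. There are about \<open>L n\<close> rows, and a point \<open>x\<close> of \<open>(0, L)\<close> corresponds to row
  number \<open>n x\<close>; the weak limit \<open>u\<close> records the proportion of ones in the rows. Bonds of length \<open>n\<close>
  measure how this proportion varies, which gives the total variation of \<open>u\<close>. Bonds of length \<open>1\<close>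
  count jumps along the helix: a row that contains both values costs two jumps, which gives twice
  the length of the set where \<open>0 < u < 1\<close>.

  \<^emph>\<open>Lower bound\<close> (\<open>energy_lower_bound\<close>). The mean of \<open>n\<close> consecutive values changes by
  \<open>(a (i + n) - a i) / n\<close> when the window is shifted by one site, so the variation of the window
  means is exactly the energy of the long bonds. Helly's selection theorem makes the window means
  converge almost everywhere along a subsequence, to a difference of two increasing functions whose
  total increment is at most the limit of that energy. The weak limit \<open>u\<close> must coincide with it, so
  \<open>u\<close> has bounded variation and its total variation is controlled. For the short bonds, a window
  whose mean is neither \<open>0\<close> nor \<open>1\<close> contains both values; if moreover its two ends carry the same
  value, then the sequence has to leave this value and to come back, hence jumps twice inside the
  window. Averaging over all windows counts every short bond at most \<open>n\<close> times
  (\<open>mixed_windows_le_near_sum\<close>), and dominated convergence relates the proportion of mixed windows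
  to the set where \<open>0 < u < 1\<close>. The two estimates use different bonds, so they add up.

  \<^emph>\<open>Upper bound\<close> (\<open>recovery_sequence\<close>). Let \<open>U\<close> be the right-continuous representative of \<open>u\<close>. If
  it takes a value strictly between \<open>0\<close> and \<open>1\<close>, fill each row with ones from the left up to a
  height close to \<open>n U\<close> (\<open>recovery_mixed\<close>). Two precautions keep the energy low. The profile is
  sampled only once per block of rows, so that rounding to integers costs a bounded amount per block
  and not per row. It is also passed through a piecewise linear map that sends values close to \<open>0\<close>
  and \<open>1\<close> to \<open>0\<close> and \<open>1\<close>, so that only few rows outside the set where \<open>0 < U < 1\<close> are mixed. The
  number of ones is then corrected by changing all rows of an interval where \<open>U\<close> stays away from \<open>0\<close>
  and \<open>1\<close> by the same small amount, up to one cell. If \<open>U\<close> only takes the values \<open>0\<close> and \<open>1\<close>, sampling it along the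
  sites is enough, and the number of ones is corrected by moving one jump (\<open>recovery_pure\<close>).

  The link with distributional derivatives rests on three facts: the derivative of a cumulative
  function of a measure is that measure (\<open>Stieltjes_integration_by_parts\<close>), the derivative is
  determined on all Borel sets (\<open>is_distr_deriv_unique\<close>), and a function with vanishing derivative is
  constant (\<open>du_Bois_Reymond\<close>).
\<close>

section \<open>Weak convergence tested on half-lines\<close>

lemma leb_on_ivl_borel:
  assumes [measurable]: "f \<in> borel_measurable borel"
  shows "f \<in> borel_measurable (leb_on_ivl L)"
  by (rule measurable_restrict_space1) (auto intro: measurable_completion)

lemma emeasure_leb_on_ivl_finite: "emeasure (leb_on_ivl L) (space (leb_on_ivl L)) < \<infinity>"
  by (cases "0 \<le> L") (simp_all add: emeasure_restrict_space space_restrict_space)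

lemma finite_measure_leb_on_ivl: "finite_measure (leb_on_ivl L)"
  using emeasure_leb_on_ivl_finite by (intro finite_measureI) (auto simp: less_top)

lemma integrable_bounded_leb:
  fixes f :: "real \<Rightarrow> real"
  assumes "f \<in> borel_measurable (leb_on_ivl L)" "AE x in leb_on_ivl L. \<bar>f x\<bar> \<le> C"
  shows "integrable (leb_on_ivl L) f"
  by (rule finite_measure.integrable_const_bound[OF finite_measure_leb_on_ivl, where B=C])
    (simp_all add: assms)

lemma integrable_bounded_mult:
  fixes f g :: "real \<Rightarrow> real"
  assumes "f \<in> borel_measurable M" "AE x in M. \<bar>f x\<bar> \<le> K" "integrable M g"
  shows "integrable M (\<lambda>x. f x * g x)"
proof (rule Bochner_Integration.integrable_bound[where f="\<lambda>x. K * g x"])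
  show "integrable M (\<lambda>x. K * g x)" using assms by simp
  show "(\<lambda>x. f x * g x) \<in> borel_measurable M" using assms by measurable
  show "AE x in M. norm (f x * g x) \<le> norm (K * g x)"
    using assms(2)
  proof eventually_elim
    case (elim x)
    then have "\<bar>f x\<bar> \<le> \<bar>K\<bar>" by linarith
    then show ?case by (simp add: abs_mult mult_right_mono)
  qed
qed

lemma indicator_leb_measurable [measurable]:
  assumes "A \<in> sets borel"
  shows "(indicator A :: real \<Rightarrow> real) \<in> borel_measurable (leb_on_ivl L)"
  by (rule leb_on_ivl_borel) (use assms in simp)

lemma integrable_indicator_leb:
  assumes "A \<in> sets borel"
  shows "integrable (leb_on_ivl L) (indicator A :: real \<Rightarrow> real)"
  by (rule integrable_bounded_leb[where C=1])
    (use indicator_leb_measurable[OF assms] in \<open>auto simp: indicator_def\<close>)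

abbreviation primitive :: "real \<Rightarrow> (real \<Rightarrow> real) \<Rightarrow> real \<Rightarrow> real" where
  "primitive L f t \<equiv> \<integral>x. f x * indicator {..<t} x \<partial>leb_on_ivl L"

lemma primitive_clamp:
  fixes f :: "real \<Rightarrow> real"
  assumes "L > 0"
  shows "primitive L f a
    = (\<integral>x. f x * indicator {..<max 0 (min a L)} x \<partial>leb_on_ivl L)"
  by (rule Bochner_Integration.integral_cong) (auto simp: space_restrict_space indicator_def)

lemma AE_leb_on_ivl_countable:
  assumes "countable D"
  shows "AE x in leb_on_ivl L. x \<notin> D"
proof -
  have "D \<in> null_sets lborel" using assms by (rule countable_imp_null_set_lborel)
  then have "AE x in lebesgue. x \<notin> D" by (intro AE_completion AE_not_in)
  then show ?thesis by (subst AE_restrict_space_iff) auto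
qed

text \<open>
  Dynkin's theorem for the \<open>\<pi>\<close>-system of open lower half-lines, in the form of an induction rule.
\<close>

lemma borel_real_induct_lessThan [consumes 1, case_names lessThan empty compl union]:
  fixes A :: "real set"
  assumes A: "A \<in> sets borel"
    and base: "\<And>a. P {..<a}" and empty: "P {}"
    and compl: "\<And>A. A \<in> sets borel \<Longrightarrow> P A \<Longrightarrow> P (- A)"
    and union: "\<And>A. disjoint_family A \<Longrightarrow> (\<And>i::nat. A i \<in> sets borel) \<Longrightarrow> (\<And>i. P (A i)) \<Longrightarrow> P (\<Union>i. A i)"
  shows "P A"
proof -
  have "Int_stable (range (lessThan :: real \<Rightarrow> real set))"
    unfolding Int_stable_def
  proof (intro ballI)
    fix A B :: "real set" assume "A \<in> range lessThan" "B \<in> range lessThan"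
    then obtain a b where "A = {..<a}" "B = {..<b}" by auto
    then have "A \<inter> B = {..<min a b}" by auto
    then show "A \<inter> B \<in> range lessThan" by blast
  qed
  moreover have "range (lessThan :: real \<Rightarrow> real set) \<subseteq> Pow UNIV" by simp
  moreover have "A \<in> sigma_sets UNIV (range lessThan)"
    using A by (simp add: borel_Iio)
  ultimately show ?thesis
  proof (induction rule: sigma_sets_induct_disjoint)
    case (compl A)
    then show ?case using assms(4)[of A] by (simp add: borel_Iio Compl_eq_Diff_UNIV)
  next
    case (union A)
    then have "A i \<in> sets borel" for i by (auto simp: borel_Iio)
    then show ?case using assms(5) union by blast
  qed (use base empty in auto)
qed

text \<open>
  The uniform bound \<open>K\<close> makes the error from replacing \<open>g\<close> by \<open>s i\<close> small uniformly in \<open>n\<close>, so the two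
  limits may be exchanged.
\<close>

lemma weak_limit_L1_closed:
  fixes f :: "nat \<Rightarrow> real \<Rightarrow> real" and g :: "real \<Rightarrow> real"
  assumes meas: "\<And>n. f n \<in> borel_measurable M" and bd: "\<And>n. AE x in M. \<bar>f n x\<bar> \<le> K"
    and g: "integrable M g"
    and s: "\<And>i. integrable M (s i)" "\<And>i. (\<lambda>n. \<integral>x. f n x * s i x \<partial>M) \<longlonglongrightarrow> 0"
    and lim: "(\<lambda>i. \<integral>x. \<bar>s i x - g x\<bar> \<partial>M) \<longlonglongrightarrow> 0"
  shows "(\<lambda>n. \<integral>x. f n x * g x \<partial>M) \<longlonglongrightarrow> 0"
proof (rule LIMSEQ_I)
  fix e :: real assume e: "e > 0"
  define K' where "K' = \<bar>K\<bar> + 1"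
  have K': "K' > 0" by (simp add: K'_def)
  obtain i where i: "(\<integral>x. \<bar>s i x - g x\<bar> \<partial>M) < e / (2 * K')"
    using order_tendstoD(2)[OF lim, of "e / (2*K')"] e K'
    by (auto simp: eventually_sequentially)
  obtain N where N: "\<And>n. n \<ge> N \<Longrightarrow> \<bar>\<integral>x. f n x * s i x \<partial>M\<bar> < e / 2"
    using LIMSEQ_D[OF s(2)[of i], of "e/2"] e by auto
  show "\<exists>N. \<forall>n\<ge>N. norm ((\<integral>x. f n x * g x \<partial>M) - 0) < e"
  proof (intro exI allI impI)
    fix n assume n: "n \<ge> N"
    have i1: "integrable M (\<lambda>x. f n x * s i x)" "integrable M (\<lambda>x. f n x * g x)"
      using meas bd s(1) g by (auto intro: integrable_bounded_mult)
    have "\<bar>(\<integral>x. f n x * s i x \<partial>M) - (\<integral>x. f n x * g x \<partial>M)\<bar> = \<bar>\<integral>x. f n x * s i x - f n x * g x \<partial>M\<bar>"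
      using i1 by simp
    also have "\<dots> \<le> (\<integral>x. \<bar>f n x * s i x - f n x * g x\<bar> \<partial>M)"
      using integral_norm_bound[of M "\<lambda>x. f n x * s i x - f n x * g x"] by simp
    also have "\<dots> \<le> (\<integral>x. K' * \<bar>s i x - g x\<bar> \<partial>M)"
    proof (rule integral_mono_AE)
      show "AE x in M. \<bar>f n x * s i x - f n x * g x\<bar> \<le> K' * \<bar>s i x - g x\<bar>"
        using bd[of n]
      proof eventually_elim
        case (elim x)
        have "\<bar>f n x * s i x - f n x * g x\<bar> = \<bar>f n x\<bar> * \<bar>s i x - g x\<bar>"
          by (simp add: abs_mult[symmetric] algebra_simps)
        also have "\<dots> \<le> K' * \<bar>s i x - g x\<bar>"
          using elim by (intro mult_right_mono) (auto simp: K'_def)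
        finally show ?case .
      qed
    qed (use i1 s(1) g in auto)
    also have "\<dots> = K' * (\<integral>x. \<bar>s i x - g x\<bar> \<partial>M)" by simp
    also have "\<dots> < e / 2" using i K' by (simp add: field_simps)
    finally show "norm ((\<integral>x. f n x * g x \<partial>M) - 0) < e" using N[OF n] unfolding real_norm_def by linarith
  qed
qed

text \<open>
  For a uniformly bounded sequence it suffices to test weak-* convergence on half-lines: Dynkin's
  theorem leads from half-lines to Borel sets, completion to Lebesgue sets, and approximation by
  simple functions to all integrable functions.
\<close>

lemma weak_limit_of_primitives:
  fixes f :: "nat \<Rightarrow> real \<Rightarrow> real" and g :: "real \<Rightarrow> real"
  assumes meas: "\<And>n. f n \<in> borel_measurable (leb_on_ivl L)"
    and bd: "\<And>n. AE x in leb_on_ivl L. \<bar>f n x\<bar> \<le> K"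
    and L: "L > 0"
    and prim0: "\<And>a. 0 \<le> a \<Longrightarrow> a \<le> L \<Longrightarrow> (\<lambda>n. primitive L (f n) a) \<longlonglongrightarrow> 0"
    and g: "integrable (leb_on_ivl L) g"
  shows "(\<lambda>n. \<integral>x. f n x * g x \<partial>leb_on_ivl L) \<longlonglongrightarrow> 0"
proof -
  let ?M = "leb_on_ivl L"
  have prim: "(\<lambda>n. primitive L (f n) a) \<longlonglongrightarrow> 0" for a
    unfolding primitive_clamp[OF L, of _ a] by (rule prim0) (use L in auto)
  have fint: "integrable ?M (f n)" for n
    using integrable_bounded_leb[OF meas bd] .
  have fint': "integrable ?M (\<lambda>x. f n x * indicator A x)" if "A \<in> sets borel" for n A
    using integrable_bounded_mult[OF meas bd integrable_indicator_leb[OF that]] .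
  have tot: "(\<lambda>n. \<integral>x. f n x \<partial>?M) \<longlonglongrightarrow> 0"
  proof -
    have "(\<integral>x. f n x * indicator {..<L} x \<partial>?M) = (\<integral>x. f n x \<partial>?M)" for n
      by (rule Bochner_Integration.integral_cong) (auto simp: space_restrict_space)
    then show ?thesis using prim[of L] by simp
  qed
  have borel_case: "(\<lambda>n. \<integral>x. f n x * indicator A x \<partial>?M) \<longlonglongrightarrow> 0" if "A \<in> sets borel" for A
    using that
  proof (induction rule: borel_real_induct_lessThan)
    case (lessThan a)
    show ?case by (rule prim)
  next
    case empty
    then show ?case by simp
    next
    case (compl A)
    note A = compl(1)
    have "(\<integral>x. f n x * indicator (- A) x \<partial>?M)
        = (\<integral>x. f n x \<partial>?M) - (\<integral>x. f n x * indicator A x \<partial>?M)" for n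
      unfolding Bochner_Integration.integral_diff[OF fint fint'[OF A], symmetric]
      by (rule Bochner_Integration.integral_cong) (auto simp: indicator_def)
    then show ?case using tendsto_diff[OF tot compl(2)] by simp
  next
    case (union A)
    note A = union(2)
    define s where "s = (\<lambda>k x. indicator (\<Union>i<k. A i) x :: real)"
    show ?case
    proof (rule weak_limit_L1_closed[OF meas bd, where s=s])
      show "integrable ?M (indicator (\<Union>i. A i) :: real \<Rightarrow> real)"
        by (rule integrable_indicator_leb) (use A in auto)
      show int_s: "integrable ?M (s i)" for i unfolding s_def
        by (rule integrable_indicator_leb) (use A in auto)
      show "(\<lambda>n. \<integral>x. f n x * s k x \<partial>?M) \<longlonglongrightarrow> 0" for k
      proof -
        have "(indicator (\<Union>i<k. A i) x :: real) = (\<Sum>i<k. indicator (A i) x)" for x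
          by (rule indicator_UN_disjoint) (use union(1) in \<open>auto intro: disjoint_family_on_mono\<close>)
        then have "(\<integral>x. f n x * s k x \<partial>?M) = (\<Sum>i<k. \<integral>x. f n x * indicator (A i) x \<partial>?M)" for n
          unfolding s_def
          by (simp only: sum_distrib_left Bochner_Integration.integral_sum[OF fint'[OF A]])
        moreover have "(\<lambda>n. \<Sum>i<k. \<integral>x. f n x * indicator (A i) x \<partial>?M) \<longlonglongrightarrow> (\<Sum>i<k. 0)"
          by (intro tendsto_sum union(3))
        ultimately show ?thesis by simp
      qed
      have "(\<lambda>k. \<integral>x. \<bar>s k x - indicator (\<Union>i. A i) x\<bar> \<partial>?M) \<longlonglongrightarrow> (\<integral>x. 0 \<partial>?M)"
      proof (rule integral_dominated_convergence[where w="\<lambda>_. 1"])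
        show "(\<lambda>x. \<bar>s k x - indicator (\<Union>i. A i) x\<bar>) \<in> borel_measurable ?M" for k
          using int_s[of k] A by (auto intro!: borel_measurable_abs borel_measurable_diff indicator_leb_measurable)
        show "integrable ?M (\<lambda>_. 1::real)"
          by (rule integrable_bounded_leb[where C=1]) auto
        show "AE x in ?M. (\<lambda>k. \<bar>s k x - indicator (\<Union>i. A i) x\<bar>) \<longlonglongrightarrow> 0"
        proof (rule AE_I2)
          fix x
          show "(\<lambda>k. \<bar>s k x - indicator (\<Union>i. A i) x\<bar>) \<longlonglongrightarrow> 0"
          proof (cases "x \<in> (\<Union>i. A i)")
            case True
            then obtain i where "x \<in> A i" by auto
            then have "eventually (\<lambda>k. \<bar>s k x - indicator (\<Union>i. A i) x\<bar> = 0) sequentially"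
              by (auto simp: s_def indicator_def intro!: eventually_mono[OF eventually_gt_at_top[of i]])
            then show ?thesis by (rule tendsto_eventually)
          next
            case False
            then show ?thesis by (auto simp: s_def indicator_def)
          qed
        qed
      qed (auto simp: s_def indicator_def)
      then show "(\<lambda>k. \<integral>x. \<bar>s k x - indicator (\<Union>i. A i) x\<bar> \<partial>?M) \<longlonglongrightarrow> 0" by simp
    qed
  qed
  show ?thesis using g
  proof (induction rule: integrable_induct)
    case (base A c)
    then obtain S where S: "S \<in> sets lebesgue" "A = S \<inter> {0<..<L}"
      by (auto simp: sets_restrict_space)
    then obtain B N N' where B: "S = B \<union> N" "N \<subseteq> N'" "N' \<in> null_sets lborel" "B \<in> sets lborel"
      by (auto elim!: sets_completionE)
    \<comment> \<open>a Lebesgue set differs from a Borel set by a subset of a Borel null set\<close>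
    have N': "AE x in lebesgue. x \<notin> N'"
      using B(3) by (intro AE_completion AE_not_in)
    have "AE x in ?M. f n x * indicator A x *\<^sub>R c = c * (f n x * indicator B x)" for n
      unfolding AE_restrict_space_iff[of "{0<..<L}" lebesgue, simplified]
      using N' by eventually_elim (use B(2) S(2) B(1) in \<open>auto simp: indicator_def\<close>)
    then have "(\<integral>x. f n x * indicator A x *\<^sub>R c \<partial>?M) = (\<integral>x. c * (f n x * indicator B x) \<partial>?M)" for n
      by (intro integral_cong_AE) (use meas base B in \<open>auto intro!: borel_measurable_times
        borel_measurable_indicator borel_measurable_scaleR indicator_leb_measurable\<close>)
    moreover have "(\<lambda>n. c * (\<integral>x. f n x * indicator B x \<partial>?M)) \<longlonglongrightarrow> c * 0"
      by (intro tendsto_mult_left borel_case) (use B in auto)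
    ultimately show ?case by (simp add: mult.assoc)
  next
    case (add g h)
    have "(\<integral>x. f n x * (g x + h x) \<partial>?M) = (\<integral>x. f n x * g x \<partial>?M) + (\<integral>x. f n x * h x \<partial>?M)" for n
      using integrable_bounded_mult[OF meas bd add(1), of n] integrable_bounded_mult[OF meas bd add(2), of n]
      by (simp add: distrib_left)
    then show ?case using tendsto_add[OF add(3,4)] by simp
  next
    case (lim g s)
    show ?case
    proof (rule weak_limit_L1_closed[OF meas bd, where s=s])
      have "(\<lambda>k. \<integral>x. \<bar>s k x - g x\<bar> \<partial>?M) \<longlonglongrightarrow> (\<integral>x. 0 \<partial>?M)"
      proof (rule integral_dominated_convergence[where w="\<lambda>x. 3 * \<bar>g x\<bar>"])
        show "AE x in ?M. (\<lambda>k. \<bar>s k x - g x\<bar>) \<longlonglongrightarrow> 0"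
        proof (rule AE_I2)
          fix x assume "x \<in> space ?M"
          from tendsto_diff[OF lim(2)[OF this] tendsto_const[of "g x"]]
          show "(\<lambda>k. \<bar>s k x - g x\<bar>) \<longlonglongrightarrow> 0" using tendsto_rabs_zero by fastforce
        qed
        show "AE x in ?M. norm \<bar>s k x - g x\<bar> \<le> 3 * \<bar>g x\<bar>" for k
        proof (rule AE_I2)
          fix x assume "x \<in> space ?M"
          from lim(3)[OF this, of k] show "norm \<bar>s k x - g x\<bar> \<le> 3 * \<bar>g x\<bar>" by simp
        qed
      qed (use lim in auto)
      then show "(\<lambda>i. \<integral>x. \<bar>s i x - g x\<bar> \<partial>?M) \<longlonglongrightarrow> 0" by simp
    qed (use lim in auto)
  qed
qed

text \<open>
  A bounded function may be tested against itself, which yields \<open>\<integral> w\<^sup>2 = 0\<close>.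
\<close>

lemma AE_zero_of_primitives:
  fixes w :: "real \<Rightarrow> real"
  assumes w: "w \<in> borel_measurable (leb_on_ivl L)" and bd: "AE x in leb_on_ivl L. \<bar>w x\<bar> \<le> K"
    and L: "L > 0" and z: "\<And>a. 0 \<le> a \<Longrightarrow> a \<le> L \<Longrightarrow> primitive L w a = 0"
  shows "AE x in leb_on_ivl L. w x = 0"
proof -
  have "(\<lambda>n::nat. \<integral>x. w x * w x \<partial>leb_on_ivl L) \<longlonglongrightarrow> 0"
    using z by (intro weak_limit_of_primitives[where f="\<lambda>_. w", OF w bd L _ integrable_bounded_leb[OF w bd]]) simp_all
  then have "(\<integral>x. w x * w x \<partial>leb_on_ivl L) = 0" by (simp add: LIMSEQ_const_iff)
  then have "AE x in leb_on_ivl L. w x * w x = 0"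
    using integrable_bounded_mult[OF w bd integrable_bounded_leb[OF w bd]]
    by (subst (asm) integral_nonneg_eq_0_iff_AE) auto
  then show ?thesis by simp
qed

section \<open>Smooth bump functions\<close>

text \<open>
  With \<open>W x = (x - a) (b - x)\<close>, these are the functions \<open>p W\<^sup>-\<^sup>j exp (- c / W)\<close> cut off outside
  \<open>(a, b)\<close>. Differentiation changes only \<open>p\<close> and \<open>j\<close>, so the family contains all derivatives of its
  members; the usual bump function is the case \<open>p = 1\<close>, \<open>j = 0\<close>.
\<close>

definition bump_term :: "real \<Rightarrow> real \<Rightarrow> real \<Rightarrow> real poly \<Rightarrow> nat \<Rightarrow> real \<Rightarrow> real" where
  "bump_term a b c p j x =
     (if a < x \<and> x < b
      then poly p x * inverse ((x - a) * (b - x)) ^ j * exp (- c * inverse ((x - a) * (b - x)))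
      else 0)"

abbreviation smooth :: "(real \<Rightarrow> real) \<Rightarrow> bool" where
  "smooth f \<equiv> \<forall>k x. (deriv ^^ k) f differentiable (at x)"

lemma continuous_on_Icc_bounded:
  fixes f :: "real \<Rightarrow> real"
  assumes "continuous_on {a..b} f"
  obtains C where "\<And>x. x \<in> {a..b} \<Longrightarrow> \<bar>f x\<bar> \<le> C"
proof -
  have "bounded (f ` {a..b})"
    by (intro compact_imp_bounded compact_continuous_image assms) simp
  then show thesis using that unfolding bounded_iff by (metis image_eqI real_norm_def)
qed

lemma DERIV_zero_of_quadratic_bound:
  fixes f :: "real \<Rightarrow> real"
  assumes "f x0 = 0" and "\<And>y. \<bar>f y\<bar> \<le> K * (y - x0)\<^sup>2"
  shows "(f has_real_derivative 0) (at x0)"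
proof -
  have "((\<lambda>y. (f y - f x0) / (y - x0)) \<longlongrightarrow> 0) (at x0)"
  proof (rule Lim_null_comparison)
    show "\<forall>\<^sub>F y in at x0. norm ((f y - f x0) / (y - x0)) \<le> K * \<bar>y - x0\<bar>"
      unfolding eventually_at_filter
    proof (intro always_eventually allI impI)
      fix y assume "y \<noteq> x0"
      then show "norm ((f y - f x0) / (y - x0)) \<le> K * \<bar>y - x0\<bar>"
        using assms(2)[of y] assms(1)
        by (simp add: abs_divide divide_le_eq power2_eq_square mult.assoc)
    qed
    have "((\<lambda>y. K * \<bar>y - x0\<bar>) \<longlongrightarrow> K * \<bar>x0 - x0\<bar>) (at x0)"
      by (intro tendsto_intros)
    then show "((\<lambda>y. K * \<bar>y - x0\<bar>) \<longlongrightarrow> 0) (at x0)" by simp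
  qed
  then show ?thesis by (simp add: has_field_derivative_iff)
qed

lemma power_times_exp_le:
  fixes t c :: real
  assumes "t \<ge> 0" "c > 0"
  shows "t ^ m * exp (- c * t) \<le> fact m / c ^ m"
proof -
  have "(c * t) ^ m / fact m \<le> exp (c * t)"
  proof -
    have "(\<Sum>k\<in>{m}. (c * t) ^ k /\<^sub>R fact k) \<le> (\<Sum>k. (c * t) ^ k /\<^sub>R fact k)"
      by (rule sum_le_suminf[OF summable_exp_generic]) (use assms in auto)
    then show ?thesis by (simp add: exp_def divide_inverse mult.commute)
  qed
  then have "c ^ m * t ^ m \<le> fact m * exp (c * t)"
    by (simp add: field_simps)
  then show ?thesis using assms
    by (simp add: field_simps exp_minus)
qed

text \<open>
  The exponential beats all powers of \<open>1 / W\<close>, so that a member of the family is \<open>O(W\<^sup>2)\<close>. In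
  particular it is flat at \<open>a\<close> and at \<open>b\<close>.
\<close>

lemma bump_term_quadratic_bound:
  assumes ab: "a < b" and c: "c > 0"
  shows "\<exists>K. \<forall>y. \<bar>bump_term a b c p j y\<bar> \<le> K * (y - a)\<^sup>2 \<and> \<bar>bump_term a b c p j y\<bar> \<le> K * (y - b)\<^sup>2"
proof -
  obtain C where C: "\<And>y. y \<in> {a..b} \<Longrightarrow> \<bar>poly p y\<bar> \<le> C"
    by (rule continuous_on_Icc_bounded[of a b "poly p"]) (auto intro!: continuous_intros)
  define D where "D = fact (j + 2) / c ^ (j + 2)"
  have D: "D \<ge> 0" using c by (simp add: D_def)
  have C0: "C \<ge> 0" using C[of a] ab by auto
  define K where "K = C * D * (b - a)\<^sup>2"
  have main: "\<bar>bump_term a b c p j y\<bar> \<le> C * D * ((y - a) * (b - y))\<^sup>2" if y: "a < y" "y < b" for y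
  proof -
    define t where "t = inverse ((y - a) * (b - y))"
    have t: "t > 0" using y by (simp add: t_def)
    have "t ^ j * exp (- c * t) = (t ^ (j + 2) * exp (- c * t)) * (1/t)\<^sup>2"
      using t by (simp add: power_add power_divide power2_eq_square)
    also have "\<dots> \<le> D * (1/t)\<^sup>2"
      unfolding D_def using power_times_exp_le[of t c "j+2"] t c by (intro mult_right_mono) auto
    also have "1 / t = (y - a) * (b - y)" using y by (simp add: t_def divide_inverse)
    finally have 1: "t ^ j * exp (- c * t) \<le> D * ((y - a) * (b - y))\<^sup>2" .
    have "\<bar>bump_term a b c p j y\<bar> = \<bar>poly p y\<bar> * (t ^ j * exp (- c * t))"
      using y t unfolding bump_term_def t_def[symmetric] by (simp add: abs_mult)
    also have "\<dots> \<le> C * (D * ((y - a) * (b - y))\<^sup>2)"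
      by (rule mult_mono) (use C[of y] y 1 C0 t in auto)
    finally show ?thesis by simp
  qed
  have "\<bar>bump_term a b c p j y\<bar> \<le> K * (y - a)\<^sup>2 \<and> \<bar>bump_term a b c p j y\<bar> \<le> K * (y - b)\<^sup>2" for y
  proof (cases "a < y \<and> y < b")
    case True
    have e: "C * D * ((y - a) * (b - y))\<^sup>2 = C * D * (b - y)\<^sup>2 * (y - a)\<^sup>2"
      "C * D * ((y - a) * (b - y))\<^sup>2 = C * D * (y - a)\<^sup>2 * (b - y)\<^sup>2"
      by (simp_all add: power_mult_distrib)
    have "(b - y)\<^sup>2 \<le> (b - a)\<^sup>2" "(y - a)\<^sup>2 \<le> (b - a)\<^sup>2"
      using True by (auto intro!: power_mono)
    then have "C * D * (b - y)\<^sup>2 * (y - a)\<^sup>2 \<le> K * (y - a)\<^sup>2"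
      "C * D * (y - a)\<^sup>2 * (b - y)\<^sup>2 \<le> K * (b - y)\<^sup>2"
      unfolding K_def using C0 D by (auto intro!: mult_right_mono mult_left_mono)
    then show ?thesis using main[of y] True e unfolding power2_commute[of y b] by linarith
  next
    case False
    then show ?thesis using C0 D by (auto simp: bump_term_def K_def)
  qed
  then show ?thesis by blast
qed

text \<open>
  Inside \<open>(a, b)\<close> this is the product rule, with a factor \<open>W\<^sup>-\<^sup>2\<close> taken out so that the other factor
  is a polynomial again; at the end points it is the quadratic bound.
\<close>

lemma bump_term_deriv:
  assumes ab: "a < b" and c: "c > 0"
  defines "w \<equiv> [:-a, 1:] * [:b, -1:]"
  defines "w' \<equiv> [:a + b, -2:]"
  shows "(bump_term a b c p j has_real_derivative
           bump_term a b c (pderiv p * w\<^sup>2 - smult (real j) (p * w' * w) + smult c (p * w')) (j + 2) x) (at x)"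
    (is "(_ has_real_derivative bump_term a b c ?q _ _) _")
proof -
  consider "a < x \<and> x < b" | "x = a \<or> x = b" | "x < a \<or> x > b" by linarith
  then show ?thesis
  proof cases
    case 1
    let ?W = "\<lambda>x. (x - a) * (b - x)"
    let ?f = "\<lambda>x. poly p x * inverse (?W x) ^ j * exp (- c * inverse (?W x))"
    have W: "?W x > 0" using 1 by simp
    have Winv: "((\<lambda>x. inverse (?W x)) has_real_derivative - (a + b - 2 * x) * (inverse (?W x))\<^sup>2) (at x)"
      using W by (auto intro!: derivative_eq_intros simp: field_simps power2_eq_square)
    have "(?f has_real_derivative
       (poly (pderiv p) x * inverse (?W x) ^ j
         + real j * inverse (?W x) ^ (j - 1) * (- (a + b - 2 * x) * (inverse (?W x))\<^sup>2) * poly p x)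
         * exp (- c * inverse (?W x))
       + exp (- c * inverse (?W x)) * (- c * (- (a + b - 2 * x) * (inverse (?W x))\<^sup>2))
         * (poly p x * inverse (?W x) ^ j)) (at x)" (is "(_ has_real_derivative ?d) _")
      by (rule derivative_eq_intros Winv poly_DERIV refl | simp)+
    moreover have "?d = bump_term a b c ?q (j + 2) x"
    proof -
      define t where "t = inverse (?W x)"
      have t: "t > 0" unfolding t_def using W by (rule positive_imp_inverse_positive)
      have w: "poly w x = 1 / t" "poly w' x = a + b - 2 * x"
        by (simp_all add: w_def w'_def t_def divide_inverse) (simp_all add: algebra_simps)
      have j: "real j * t ^ (j - 1) * t\<^sup>2 = real j * t ^ (j + 1)"
        by (cases j) (simp_all add: power2_eq_square)
      have "?d = (poly (pderiv p) x * t ^ j - (real j * t ^ (j - 1) * t\<^sup>2) * (a + b - 2 * x) * poly p x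
          + c * (a + b - 2 * x) * t\<^sup>2 * poly p x * t ^ j) * exp (- c * t)"
        unfolding t_def[symmetric] by (simp add: algebra_simps)
      also have "\<dots> = poly ?q x * t ^ (j + 2) * exp (- c * t)"
        unfolding j using t by (simp add: w field_simps power2_eq_square power_add)
      finally show ?thesis using 1 by (simp add: bump_term_def t_def)
    qed
    ultimately have "(?f has_real_derivative bump_term a b c ?q (j + 2) x) (at x)" by simp
    then show ?thesis
      by (rule has_field_derivative_transform_within_open[of _ _ _ "{a<..<b}"])
        (use 1 in \<open>auto simp: bump_term_def\<close>)
  next
    case 2
    obtain K where K: "\<And>y. \<bar>bump_term a b c p j y\<bar> \<le> K * (y - a)\<^sup>2 \<and> \<bar>bump_term a b c p j y\<bar> \<le> K * (y - b)\<^sup>2"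
      using bump_term_quadratic_bound[OF ab c] by blast
    have "bump_term a b c ?q (j + 2) x = 0" using 2 by (auto simp: bump_term_def)
    moreover have "(bump_term a b c p j has_real_derivative 0) (at x)"
    proof (rule DERIV_zero_of_quadratic_bound[where K=K])
      show "bump_term a b c p j x = 0" using 2 by (auto simp: bump_term_def)
      show "\<bar>bump_term a b c p j y\<bar> \<le> K * (y - x)\<^sup>2" for y using K 2 by blast
    qed
    ultimately show ?thesis by simp
  next
    case 3
    have "((\<lambda>_. 0) has_real_derivative 0) (at x)" by simp
    then have "(bump_term a b c p j has_real_derivative 0) (at x)"
      by (rule has_field_derivative_transform_within_open[of _ _ _ "- {a..b}"])
        (use 3 in \<open>auto simp: bump_term_def\<close>)
    then show ?thesis using 3 by (auto simp: bump_term_def)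
  qed
qed

lemma smooth_bump_term:
  assumes "a < b" "c > 0"
  shows "smooth (bump_term a b c p j)"
proof (intro allI)
  fix k x
  have "\<exists>q i. (deriv ^^ k) (bump_term a b c p j) = bump_term a b c q i"
  proof (induction k)
    case 0
    then show ?case by auto
  next
    case (Suc k)
    then obtain q i where "(deriv ^^ k) (bump_term a b c p j) = bump_term a b c q i" by blast
    moreover obtain q' where "(bump_term a b c q i has_real_derivative bump_term a b c q' (i + 2) x) (at x)" for x
      using bump_term_deriv[OF assms, of q i] by blast
    then have "deriv (bump_term a b c q i) = bump_term a b c q' (i + 2)"
      by (auto intro!: DERIV_imp_deriv)
    ultimately show ?case by auto
  qed
  then show "(deriv ^^ k) (bump_term a b c p j) differentiable at x"
    using bump_term_deriv[OF assms] by (metis real_differentiable_def)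
qed

lemma smooth_lincomb:
  assumes f: "smooth f" and g: "smooth g"
  shows "smooth (\<lambda>x. \<alpha> * f x + \<beta> * g x)"
proof (intro allI)
  fix k x
  have eq: "(deriv ^^ k) (\<lambda>x. \<alpha> * f x + \<beta> * g x) = (\<lambda>x. \<alpha> * (deriv ^^ k) f x + \<beta> * (deriv ^^ k) g x)"
  proof (induction k)
    case (Suc k)
    have "((\<lambda>x. \<alpha> * (deriv ^^ k) f x + \<beta> * (deriv ^^ k) g x) has_real_derivative
       \<alpha> * deriv ((deriv ^^ k) f) x + \<beta> * deriv ((deriv ^^ k) g) x) (at x)" for x
      by (intro DERIV_add DERIV_cmult) (use f g in \<open>simp_all add: DERIV_deriv_iff_real_differentiable\<close>)
    then show ?case using Suc by (auto intro!: DERIV_imp_deriv)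
  qed simp
  show "(deriv ^^ k) (\<lambda>x. \<alpha> * f x + \<beta> * g x) differentiable at x"
    unfolding eq using f g by (intro derivative_intros) auto
qed

lemma smooth_of_smooth_deriv:
  assumes "\<And>x. (f has_real_derivative g x) (at x)" "smooth g"
  shows "smooth f"
proof (intro allI)
  fix k x
  have "deriv f = g" using assms(1) by (auto intro!: DERIV_imp_deriv)
  then show "(deriv ^^ k) f differentiable at x"
    using assms by (cases k) (auto simp: funpow_swap1 real_differentiable_def simp del: funpow.simps simp add: funpow_Suc_right)
qed

lemma test_functionsI:
  assumes "smooth f" "0 < a" "b < L" "\<And>x. x \<notin> {a..b} \<Longrightarrow> f x = 0"
  shows "f \<in> test_functions L"
proof -
  have "closure {x. f x \<noteq> 0} \<subseteq> {a..b}"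
    by (rule closure_minimal) (use assms(4) in \<open>force+\<close>)
  moreover from this have "bounded (closure {x. f x \<noteq> 0})" using bounded_subset bounded_closed_interval by blast
  ultimately show ?thesis using assms(1-3)
    by (auto simp: test_functions_def compact_eq_bounded_closed)
qed

lemma bump_in_test_functions:
  assumes "a < b" "c > 0" "0 < a" "b < L"
  shows "bump_term a b c 1 0 \<in> test_functions L"
  by (rule test_functionsI[OF smooth_bump_term[OF assms(1,2)] assms(3,4)]) (auto simp: bump_term_def)

lemma bump_range:
  assumes "c > 0"
  shows "0 \<le> bump_term a b c 1 0 x" "bump_term a b c 1 0 x \<le> 1"
  using assms by (auto simp: bump_term_def zero_le_mult_iff)

text \<open>
  As \<open>c\<close> tends to \<open>0\<close>, the bump \<open>exp (- c / W)\<close> tends to \<open>1\<close> inside its interval. The intervals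
  exhaust \<open>(a, b)\<close> from inside, so that the supports stay compact in \<open>(0, L)\<close> even if \<open>a = 0\<close> or
  \<open>b = L\<close>.
\<close>

lemma test_functions_approximate_interval:
  assumes "0 \<le> a" "a < b" "b \<le> L"
  obtains \<phi> where "\<And>k::nat. \<phi> k \<in> test_functions L" "\<And>k x. 0 \<le> \<phi> k x" "\<And>k x. \<phi> k x \<le> 1"
    "\<And>x. (\<lambda>k. \<phi> k x) \<longlonglongrightarrow> indicator {a<..<b} x"
    "\<And>k x. x \<notin> {a<..<b} \<Longrightarrow> \<phi> k x = 0"
proof -
  define a' where "a' = (\<lambda>k::nat. a + (b - a) / (real k + 3))"
  define b' where "b' = (\<lambda>k::nat. b - (b - a) / (real k + 3))"
  define c' where "c' = (\<lambda>k::nat. 1 / (real k + 1))"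
  have ab: "a < a' k \<and> a' k < b' k \<and> b' k < b \<and> c' k > 0" for k
  proof -
    define h where "h = (b - a) / (real k + 3)"
    have "h > 0" using assms by (simp add: h_def)
    moreover have "h < (b - a) / 2"
      unfolding h_def by (rule divide_strict_left_mono) (use assms in auto)
    ultimately show ?thesis unfolding a'_def b'_def c'_def h_def[symmetric] by (auto; argo)
  qed
  have lim0: "(\<lambda>k. (b - a) / (real k + 3)) \<longlonglongrightarrow> 0" by real_asymp
  have lim: "a' \<longlonglongrightarrow> a" "b' \<longlonglongrightarrow> b" "c' \<longlonglongrightarrow> 0"
    unfolding a'_def b'_def c'_def
    using tendsto_add[OF tendsto_const[of a] lim0] tendsto_diff[OF tendsto_const[of b] lim0]
    by (auto) real_asymp
  show thesis
  proof (rule that[of "\<lambda>k. bump_term (a' k) (b' k) (c' k) 1 0"])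
    show "bump_term (a' k) (b' k) (c' k) 1 0 \<in> test_functions L" for k
      using ab[of k] assms by (intro bump_in_test_functions) linarith+
    show z: "bump_term (a' k) (b' k) (c' k) 1 0 x = 0" if "x \<notin> {a<..<b}" for k x
      using ab[of k] that by (auto simp: bump_term_def)
    show "(\<lambda>k. bump_term (a' k) (b' k) (c' k) 1 0 x) \<longlonglongrightarrow> indicator {a<..<b} x" for x
    proof (cases "x \<in> {a<..<b}")
      case True
      have "(\<lambda>k. exp (- c' k * inverse ((x - a' k) * (b' k - x)))) \<longlonglongrightarrow> exp (- 0 * inverse ((x - a) * (b - x)))"
        by (intro tendsto_intros lim) (use True in auto)
      moreover have "eventually (\<lambda>k. exp (- c' k * inverse ((x - a' k) * (b' k - x)))
          = bump_term (a' k) (b' k) (c' k) 1 0 x) sequentially"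
        using order_tendstoD(2)[OF lim(1), of x] order_tendstoD(1)[OF lim(2), of x] True
        by (auto elim: eventually_elim2 simp: bump_term_def)
      ultimately show ?thesis using True by (auto intro: Lim_transform_eventually)
    next
      case False
      then show ?thesis using z by simp
    qed
  qed (use bump_range ab in auto)
qed

lemma test_function_facts:
  assumes "\<phi> \<in> test_functions L"
  shows "(\<phi> has_real_derivative deriv \<phi> x) (at x)"
    and "continuous_on UNIV \<phi>" and "continuous_on UNIV (deriv \<phi>)"
    and "x \<notin> {0<..<L} \<Longrightarrow> \<phi> x = 0" and "x \<notin> {0<..<L} \<Longrightarrow> deriv \<phi> x = 0"
    and "\<exists>C. \<forall>x. \<bar>\<phi> x\<bar> \<le> C \<and> \<bar>deriv \<phi> x\<bar> \<le> C"
proof -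
  have d: "\<phi> differentiable at x" "deriv \<phi> differentiable at x" for x
    using assms by (auto simp: test_functions_def dest: spec[of _ 0] spec[of _ "Suc 0"])
  show D: "(\<phi> has_real_derivative deriv \<phi> x) (at x)" for x
    using d by (simp add: DERIV_deriv_iff_real_differentiable)
  show c: "continuous_on UNIV \<phi>" "continuous_on UNIV (deriv \<phi>)"
    using d by (auto intro!: continuous_at_imp_continuous_on differentiable_imp_continuous_within)
  have cl: "closure {x. \<phi> x \<noteq> 0} \<subseteq> {0<..<L}" using assms by (simp add: test_functions_def)
  show z: "\<phi> x = 0" if "x \<notin> {0<..<L}" for x
    using that cl closure_subset[of "{x. \<phi> x \<noteq> 0}"] by blast
  show dz: "deriv \<phi> x = 0" if "x \<notin> {0<..<L}" for x
  proof (rule DERIV_imp_deriv)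
    have "((\<lambda>_. 0) has_real_derivative 0) (at x)" by simp
    then show "(\<phi> has_real_derivative 0) (at x)"
      by (rule has_field_derivative_transform_within_open[of _ _ _ "- closure {x. \<phi> x \<noteq> 0}"])
        (use that cl closure_subset[of "{x. \<phi> x \<noteq> 0}"] in auto)
  qed
  obtain C1 where C1: "\<And>x. x \<in> {0..L} \<Longrightarrow> \<bar>\<phi> x\<bar> \<le> C1"
    using continuous_on_Icc_bounded[OF continuous_on_subset[OF c(1)]] by blast
  obtain C2 where C2: "\<And>x. x \<in> {0..L} \<Longrightarrow> \<bar>deriv \<phi> x\<bar> \<le> C2"
    using continuous_on_Icc_bounded[OF continuous_on_subset[OF c(2)]] by blast
  have "\<bar>\<phi> x\<bar> \<le> \<bar>C1\<bar> + \<bar>C2\<bar> \<and> \<bar>deriv \<phi> x\<bar> \<le> \<bar>C1\<bar> + \<bar>C2\<bar>" for x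
  proof (cases "x \<in> {0<..<L}")
    case True
    then have "x \<in> {0..L}" by simp
    then show ?thesis using C1[of x] C2[of x] by linarith
  qed (use z dz in simp)
  then show "\<exists>C. \<forall>x. \<bar>\<phi> x\<bar> \<le> C \<and> \<bar>deriv \<phi> x\<bar> \<le> C" by blast
qed

text \<open>
  The primitive of \<open>\<psi>\<close> that vanishes to the left of the support also vanishes to the right of it,
  because \<open>\<psi>\<close> has mean zero.
\<close>

lemma test_function_with_derivative:
  assumes f: "smooth \<psi>" and ab: "0 < a" "a \<le> b" "b < L" and z: "\<And>x. x \<notin> {a..b} \<Longrightarrow> \<psi> x = 0"
    and int: "integral {a..b} \<psi> = 0"
  obtains \<phi> where "\<phi> \<in> test_functions L" "deriv \<phi> = \<psi>"
proof -
  have "\<psi> differentiable at x" for x using f by (auto dest: spec[of _ 0])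
  then have cont: "continuous_on A \<psi>" for A
    by (auto intro!: continuous_at_imp_continuous_on differentiable_imp_continuous_within)
  define \<phi> where "\<phi> = (\<lambda>x. if x \<le> 0 then 0 else integral {0..x} \<psi>)"
  have left: "\<phi> x = 0" if "x < a" for x
  proof -
    have "integral {0..x} \<psi> = integral {0..x} (\<lambda>_. 0)"
      by (rule integral_cong) (use z that in auto)
    then show ?thesis by (simp add: \<phi>_def)
  qed
  have right: "\<phi> x = 0" if "x > b" for x
  proof -
    have "integral {0..x} \<psi> = integral {0..a} \<psi> + integral {a..b} \<psi> + integral {b..x} \<psi>"
      using ab that
      by (simp add: Henstock_Kurzweil_Integration.integral_combine integrable_continuous_real cont)
    moreover have "integral {0..a} \<psi> = integral {0..a} (\<lambda>_. 0)"
      by (rule integral_spike[of "{a}"]) (use z in auto)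
    moreover have "integral {b..x} \<psi> = integral {b..x} (\<lambda>_. 0)"
      by (rule integral_spike[of "{b}"]) (use z in auto)
    ultimately show ?thesis using int ab that by (simp add: \<phi>_def)
  qed
  have D: "(\<phi> has_real_derivative \<psi> x) (at x)" for x
  proof (cases "x < a")
    case True
    have "((\<lambda>_. 0) has_real_derivative 0) (at x)" by simp
    then have "(\<phi> has_real_derivative 0) (at x)"
      by (rule has_field_derivative_transform_within_open[of _ _ _ "{..<a}"])
        (use True left in auto)
    then show ?thesis using z[of x] True by simp
  next
    case False
    have "((\<lambda>u. integral {0..u} \<psi>) has_real_derivative \<psi> x) (at x within {0..x+1})"
      by (rule integral_has_real_derivative[OF cont]) (use False ab in auto)
    then have "((\<lambda>u. integral {0..u} \<psi>) has_real_derivative \<psi> x) (at x)"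
      using False ab by (subst (asm) at_within_interior[of x "{0..x+1}"]) auto
    then show ?thesis
      by (rule has_field_derivative_transform_within_open[of _ _ _ "{0<..}"])
        (use False ab in \<open>auto simp: \<phi>_def\<close>)
  qed
  show thesis
  proof (rule that)
    show "\<phi> \<in> test_functions L"
      by (rule test_functionsI[OF smooth_of_smooth_deriv[OF D f] ab(1,3)]) (use left right in force)
    show "deriv \<phi> = \<psi>" using D by (auto intro!: DERIV_imp_deriv)
  qed
qed

section \<open>Distributional derivatives of cumulative functions\<close>

lemma integral_leb_on_ivl_lborel:
  fixes f :: "real \<Rightarrow> real"
  assumes [measurable]: "f \<in> borel_measurable borel"
  shows "(\<integral>x. f x \<partial>leb_on_ivl L) = (\<integral>x. f x \<partial>restrict_space lborel {0<..<L})"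
proof -
  have "(\<integral>x. f x \<partial>leb_on_ivl L) = (\<integral>x. indicator {0<..<L} x *\<^sub>R f x \<partial>lebesgue)"
    by (rule integral_restrict_space) simp
  also have "\<dots> = (\<integral>x. indicator {0<..<L} x *\<^sub>R f x \<partial>lborel)"
    by (rule integral_completion) measurable
  also have "\<dots> = (\<integral>x. f x \<partial>restrict_space lborel {0<..<L})"
    by (rule integral_restrict_space[symmetric]) simp
  finally show ?thesis .
qed

lemma space_of_borel_ivl:
  assumes "sets lam = sets (borel_ivl L)"
  shows "space lam = {0<..<L}"
  using sets_eq_imp_space_eq[OF assms] by (simp add: space_restrict_space)

lemma borel_sets_borel_ivl:
  assumes "A \<in> sets borel" "A \<subseteq> {0<..<L}"
  shows "A \<in> sets (borel_ivl L)"
  using assms by (auto simp: sets_restrict_space image_iff intro!: bexI[of _ A])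

lemma borel_measurable_borel_ivl:
  fixes f :: "real \<Rightarrow> real"
  assumes "sets lam = sets (borel_ivl L)" "f \<in> borel_measurable borel"
  shows "f \<in> borel_measurable lam"
proof -
  have "f \<in> borel_measurable (borel_ivl L)" by (rule measurable_restrict_space1) fact
  then show ?thesis using measurable_cong_sets[OF assms(1) refl] by blast
qed

lemma cumulative_facts:
  fixes L :: real
  assumes lam: "finite_measure lam" "sets lam = sets (borel_ivl L)"
  defines "G \<equiv> \<lambda>x. measure lam ({0<..<L} \<inter> {..x})"
  shows "mono G" "G \<in> borel_measurable borel" "0 \<le> G x" "G x \<le> measure lam {0<..<L}"
proof -
  interpret finite_measure lam by fact
  have s: "{0<..<L} \<inter> {..x} \<in> sets lam" for x
    unfolding lam(2) by (rule borel_sets_borel_ivl) auto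
  show m: "mono G"
    unfolding G_def by (intro monoI finite_measure_mono s) auto
  then show "G \<in> borel_measurable borel" by (rule borel_measurable_mono)
  show "0 \<le> G x" by (simp add: G_def)
  show "G x \<le> measure lam {0<..<L}"
    unfolding G_def using bounded_measure[of "{0<..<L} \<inter> {..x}"] space_of_borel_ivl[OF lam(2)] by simp
qed

text \<open>
  Fubini's theorem for the kernel that equals \<open>\<phi>' x\<close> for \<open>y \<le> x\<close> and \<open>0\<close> otherwise: integrating in \<open>y\<close>
  first gives the left-hand side, integrating in \<open>x\<close> first gives \<open>- \<phi> y\<close>, because \<open>\<phi>\<close> vanishes at
  \<open>L\<close>.
\<close>

lemma Stieltjes_integration_by_parts:
  fixes L :: real
  assumes lam: "finite_measure lam" "sets lam = sets (borel_ivl L)" and \<phi>: "\<phi> \<in> test_functions L"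
  shows "(\<integral>x. measure lam ({0<..<L} \<inter> {..x}) * deriv \<phi> x \<partial>leb_on_ivl L) = - (\<integral>x. \<phi> x \<partial>lam)"
proof -
  let ?N = "restrict_space lborel {0<..<L}"
  interpret lam: finite_measure lam by fact
  interpret N: finite_measure ?N
    by (rule finite_measureI) (cases "0 \<le> L"; simp add: emeasure_restrict_space space_restrict_space)
  interpret P: pair_sigma_finite ?N lam ..
  interpret finP: finite_measure "?N \<Otimes>\<^sub>M lam"
    by (rule finite_measure_pair_measure) unfold_locales
  note sp = space_of_borel_ivl[OF lam(2)]
  note f = test_function_facts[OF \<phi>]
  obtain C where C: "\<And>x. \<bar>deriv \<phi> x\<bar> \<le> C" using f(6) by blast
  have dm: "deriv \<phi> \<in> borel_measurable borel" by (rule borel_measurable_continuous_onI[OF f(3)])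
  have idN: "(\<lambda>x. x) \<in> borel_measurable ?N" by (rule measurable_restrict_space1) simp
  have idl: "(\<lambda>x. x) \<in> borel_measurable lam" by (rule borel_measurable_borel_ivl[OF lam(2)]) simp
  define h where "h = (\<lambda>x y. if y \<le> x then deriv \<phi> x else 0)"
  have [measurable]: "fst \<in> borel_measurable (?N \<Otimes>\<^sub>M lam)" "snd \<in> borel_measurable (?N \<Otimes>\<^sub>M lam)"
    using measurable_compose[OF measurable_fst[of ?N lam] idN] measurable_compose[OF measurable_snd[of ?N lam] idl] by simp_all
  have [measurable]: "(\<lambda>p. deriv \<phi> (fst p)) \<in> borel_measurable (?N \<Otimes>\<^sub>M lam)"
    by (rule measurable_compose[OF _ dm]) measurable
  have "case_prod h \<in> borel_measurable (?N \<Otimes>\<^sub>M lam)"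
    unfolding h_def case_prod_beta by measurable
  then have hint: "integrable (?N \<Otimes>\<^sub>M lam) (case_prod h)"
    using C order_trans[OF abs_ge_zero C]
    by (intro finP.integrable_const_bound[where B=C]) (auto simp: h_def)
  have inner: "(\<integral>x. h x y \<partial>?N) = - \<phi> y" if y: "y \<in> {0<..<L}" for y
  proof -
    have "(\<integral>x. h x y \<partial>?N) = (\<integral>x. indicator {0<..<L} x *\<^sub>R h x y \<partial>lborel)"
      by (rule integral_restrict_space) simp
    also have "\<dots> = (\<integral>x. deriv \<phi> x * indicator {y..L} x \<partial>lborel)"
      using y f(5) by (intro Bochner_Integration.integral_cong) (auto simp: h_def indicator_def)
    also have "\<dots> = \<phi> L - \<phi> y"
      using y f(1) f(3) by (intro integral_FTC_Icc_real) (auto simp: continuous_on_eq_continuous_at)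
    finally show ?thesis using f(4)[of L] by simp
  qed
  have outer: "(\<integral>y. h x y \<partial>lam) = measure lam ({0<..<L} \<inter> {..x}) * deriv \<phi> x" for x
  proof -
    have "(\<integral>y. h x y \<partial>lam) = (\<integral>y. deriv \<phi> x * indicator ({0<..<L} \<inter> {..x}) y \<partial>lam)"
      by (rule Bochner_Integration.integral_cong) (auto simp: h_def indicator_def sp)
    also have "\<dots> = deriv \<phi> x * measure lam ({0<..<L} \<inter> {..x})"
      by (subst integral_mult_right_zero, subst Bochner_Integration.integral_indicator) (simp add: sp Int_absorb1 inf_commute inf_left_commute)
    finally show ?thesis by simp
  qed
  have "(\<integral>x. measure lam ({0<..<L} \<inter> {..x}) * deriv \<phi> x \<partial>leb_on_ivl L)
      = (\<integral>x. (\<integral>y. h x y \<partial>lam) \<partial>?N)"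
    unfolding outer
    by (rule integral_leb_on_ivl_lborel) (intro borel_measurable_times dm cumulative_facts(2)[OF lam])
  also have "\<dots> = (\<integral>y. (\<integral>x. h x y \<partial>?N) \<partial>lam)"
    by (rule P.Fubini_integral[OF hint, symmetric])
  also have "\<dots> = (\<integral>y. - \<phi> y \<partial>lam)"
    by (rule Bochner_Integration.integral_cong) (auto simp: sp inner)
  finally show ?thesis by simp
qed

lemma is_distr_deriv_cumulative:
  fixes L :: real
  assumes mu: "finite_measure \<mu>" "sets \<mu> = sets (borel_ivl L)"
    and nu: "finite_measure \<nu>" "sets \<nu> = sets (borel_ivl L)"
    and u: "u \<in> borel_measurable (leb_on_ivl L)"
    and eq: "AE x in leb_on_ivl L. u x = c + measure \<mu> ({0<..<L} \<inter> {..x}) - measure \<nu> ({0<..<L} \<inter> {..x})"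
  shows "is_distr_deriv L u (\<lambda>A. measure \<mu> A - measure \<nu> A)"
  unfolding is_distr_deriv_def
proof (rule exI[of _ \<mu>], rule exI[of _ \<nu>], intro conjI ballI mu nu refl)
  fix \<phi> assume \<phi>: "\<phi> \<in> test_functions L"
  note f = test_function_facts[OF \<phi>]
  let ?M = "leb_on_ivl L"
  define G H where "G = (\<lambda>x. measure \<mu> ({0<..<L} \<inter> {..x}))" and "H = (\<lambda>x. measure \<nu> ({0<..<L} \<inter> {..x}))"
  have dm: "deriv \<phi> \<in> borel_measurable borel" by (rule borel_measurable_continuous_onI[OF f(3)])
  have dint: "integrable ?M (deriv \<phi>)"
    using f(6) by (auto intro!: integrable_bounded_leb leb_on_ivl_borel dm)
  have G: "G \<in> borel_measurable borel" "\<And>x. \<bar>G x\<bar> \<le> measure \<mu> {0<..<L}"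
    and H: "H \<in> borel_measurable borel" "\<And>x. \<bar>H x\<bar> \<le> measure \<nu> {0<..<L}"
    using cumulative_facts[OF mu] cumulative_facts[OF nu] by (auto simp: G_def H_def)
  have Gi: "integrable ?M (\<lambda>x. G x * deriv \<phi> x)" "integrable ?M (\<lambda>x. H x * deriv \<phi> x)"
    by (auto intro!: integrable_bounded_mult dint leb_on_ivl_borel G H AE_I2)
  have d0: "(\<integral>x. deriv \<phi> x \<partial>?M) = 0"
  proof (cases "0 \<le> L")
    case True
    have "(\<integral>x. deriv \<phi> x \<partial>?M) = (\<integral>x. deriv \<phi> x \<partial>restrict_space lborel {0<..<L})"
      by (rule integral_leb_on_ivl_lborel[OF dm])
    also have "\<dots> = (\<integral>x. indicator {0<..<L} x *\<^sub>R deriv \<phi> x \<partial>lborel)"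
      by (rule integral_restrict_space) simp
    also have "\<dots> = (\<integral>x. deriv \<phi> x * indicator {0..L} x \<partial>lborel)"
      using f(5) by (intro Bochner_Integration.integral_cong) (auto simp: indicator_def)
    also have "\<dots> = \<phi> L - \<phi> 0"
      using f(1) f(3) True by (intro integral_FTC_Icc_real) (auto simp: continuous_on_eq_continuous_at)
    finally show ?thesis using f(4)[of L] f(4)[of 0] by simp
  next
    case False
    then have "(\<integral>x. deriv \<phi> x \<partial>?M) = (\<integral>x. 0 \<partial>?M)"
      by (intro Bochner_Integration.integral_cong) (auto simp: space_restrict_space)
    then show ?thesis by simp
  qed
  have "(\<integral>x. u x * deriv \<phi> x \<partial>?M) = (\<integral>x. c * deriv \<phi> x + G x * deriv \<phi> x - H x * deriv \<phi> x \<partial>?M)"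
  proof (rule integral_cong_AE)
    show "AE x in ?M. u x * deriv \<phi> x = c * deriv \<phi> x + G x * deriv \<phi> x - H x * deriv \<phi> x"
      using eq by eventually_elim (simp only: G_def H_def, simp add: algebra_simps)
  qed (use dint Gi u in \<open>auto intro!: borel_measurable_times borel_measurable_diff borel_measurable_add\<close>)
  also have "\<dots> = c * (\<integral>x. deriv \<phi> x \<partial>?M) + (\<integral>x. G x * deriv \<phi> x \<partial>?M) - (\<integral>x. H x * deriv \<phi> x \<partial>?M)"
    using dint Gi by simp
  also have "\<dots> = - ((\<integral>x. \<phi> x \<partial>\<mu>) - (\<integral>x. \<phi> x \<partial>\<nu>))"
    using Stieltjes_integration_by_parts[OF mu \<phi>] Stieltjes_integration_by_parts[OF nu \<phi>]
    by (simp add: G_def H_def d0)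
  finally show "(\<integral>x. u x * deriv \<phi> x \<partial>?M) = - ((\<integral>x. \<phi> x \<partial>\<mu>) - (\<integral>x. \<phi> x \<partial>\<nu>))" .
qed

lemma integral_test_functions_tendsto_measure:
  assumes lam: "finite_measure lam" "sets lam = sets (borel_ivl L)"
    and \<phi>: "\<And>k::nat. \<phi> k \<in> test_functions L" "\<And>k x. 0 \<le> \<phi> k x" "\<And>k x. \<phi> k x \<le> 1"
    "\<And>x. (\<lambda>k. \<phi> k x) \<longlonglongrightarrow> indicator {a<..<b} x" and ab: "0 \<le> a" "b \<le> L"
  shows "(\<lambda>k. \<integral>x. \<phi> k x \<partial>lam) \<longlonglongrightarrow> measure lam {a<..<b}"
proof -
  interpret finite_measure lam by fact
  have "(\<lambda>k. \<integral>x. \<phi> k x \<partial>lam) \<longlonglongrightarrow> (\<integral>x. indicator {a<..<b} x \<partial>lam)"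
  proof (rule integral_dominated_convergence[where w="\<lambda>_. 1"])
    show "\<phi> k \<in> borel_measurable lam" for k
      by (intro borel_measurable_borel_ivl[OF lam(2)] borel_measurable_continuous_onI test_function_facts(2)[OF \<phi>(1)])
    show "(indicator {a<..<b} :: real \<Rightarrow> real) \<in> borel_measurable lam"
      by (rule borel_measurable_borel_ivl[OF lam(2)]) simp
  qed (use \<phi> in auto)
  also have "(\<integral>x. indicator {a<..<b} x \<partial>lam) = measure lam {a<..<b}"
    using ab by (subst Bochner_Integration.integral_indicator) (auto simp: space_of_borel_ivl[OF lam(2)] intro!: arg_cong[where f="measure lam"])
  finally show ?thesis .
qed

lemma signed_measure_sums:
  assumes mu: "finite_measure \<mu>" "sets \<mu> = S" and nu: "finite_measure \<nu>" "sets \<nu> = S"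
    and m: "\<And>A. A \<in> S \<Longrightarrow> m A = measure \<mu> A - measure \<nu> A"
    and A: "range A \<subseteq> S" "disjoint_family A"
  shows "(\<lambda>i::nat. m (A i)) sums m (\<Union>i. A i)"
proof -
  have "(\<lambda>i. measure \<mu> (A i)) sums measure \<mu> (\<Union>i. A i)" "(\<lambda>i. measure \<nu> (A i)) sums measure \<nu> (\<Union>i. A i)"
    using finite_measure.finite_measure_UNION[OF mu(1), of A] finite_measure.finite_measure_UNION[OF nu(1), of A] mu nu A by auto
  moreover have "(\<Union>i. A i) \<in> S" using A unfolding mu(2)[symmetric] by blast
  ultimately show ?thesis using m A by (auto dest: sums_diff simp: range_subsetD)
qed

text \<open>
  Two derivatives of \<open>u\<close> integrate test functions alike, hence agree on open intervals, which are
  limits of test functions, and then on all Borel sets. Whatever is proved for one representation of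
  the derivative therefore holds for the one selected by \<open>distr_deriv\<close>.
\<close>

lemma is_distr_deriv_unique:
  assumes d: "is_distr_deriv L u m" "is_distr_deriv L u m'" and A: "A \<in> sets (borel_ivl L)"
  shows "m A = m' A"
proof (cases "L > 0")
  case False
  then have "A = {}" using sets.sets_into_space[OF A] by (simp add: space_restrict_space)
  moreover have "m {} = 0" "m' {} = 0" using d by (force simp: is_distr_deriv_def)+
  ultimately show ?thesis by simp
next
  case True
  obtain \<mu> \<nu> where pq: "finite_measure \<mu>" "sets \<mu> = sets (borel_ivl L)" "finite_measure \<nu>" "sets \<nu> = sets (borel_ivl L)"
    and m: "\<And>A. A \<in> sets (borel_ivl L) \<Longrightarrow> m A = measure \<mu> A - measure \<nu> A"
    and p: "\<And>\<phi>. \<phi> \<in> test_functions L \<Longrightarrow> (\<integral>x. u x * deriv \<phi> x \<partial>leb_on_ivl L) = - ((\<integral>x. \<phi> x \<partial>\<mu>) - (\<integral>x. \<phi> x \<partial>\<nu>))"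
    using d(1) unfolding is_distr_deriv_def by blast
  obtain \<mu>' \<nu>' where pq': "finite_measure \<mu>'" "sets \<mu>' = sets (borel_ivl L)" "finite_measure \<nu>'" "sets \<nu>' = sets (borel_ivl L)"
    and m': "\<And>A. A \<in> sets (borel_ivl L) \<Longrightarrow> m' A = measure \<mu>' A - measure \<nu>' A"
    and p': "\<And>\<phi>. \<phi> \<in> test_functions L \<Longrightarrow> (\<integral>x. u x * deriv \<phi> x \<partial>leb_on_ivl L) = - ((\<integral>x. \<phi> x \<partial>\<mu>') - (\<integral>x. \<phi> x \<partial>\<nu>'))"
    using d(2) unfolding is_distr_deriv_def by blast
  note sums = signed_measure_sums[OF pq m] and sums' = signed_measure_sums[OF pq' m']
  have E: "m {} = 0" "m' {} = 0" using m[of "{}"] m'[of "{}"] by auto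
  have ivl: "m {a<..<b} = m' {a<..<b}" if ab: "0 \<le> a" "b \<le> L" for a b
  proof (cases "a < b")
    case ab': True
    obtain \<phi> where \<phi>: "\<And>k::nat. \<phi> k \<in> test_functions L" "\<And>k x. 0 \<le> \<phi> k x" "\<And>k x. \<phi> k x \<le> 1"
      "\<And>x. (\<lambda>k. \<phi> k x) \<longlonglongrightarrow> indicator {a<..<b} x"
      using test_functions_approximate_interval[OF ab(1) ab' ab(2)] by metis
    note T = integral_test_functions_tendsto_measure[OF _ _ \<phi> ab]
    have "(\<lambda>k. (\<integral>x. \<phi> k x \<partial>\<mu>) - (\<integral>x. \<phi> k x \<partial>\<nu>)) \<longlonglongrightarrow> measure \<mu> {a<..<b} - measure \<nu> {a<..<b}"
      by (intro tendsto_diff T pq)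
    moreover have "(\<lambda>k. (\<integral>x. \<phi> k x \<partial>\<mu>') - (\<integral>x. \<phi> k x \<partial>\<nu>')) \<longlonglongrightarrow> measure \<mu>' {a<..<b} - measure \<nu>' {a<..<b}"
      by (intro tendsto_diff T pq')
    moreover have "(\<integral>x. \<phi> k x \<partial>\<mu>) - (\<integral>x. \<phi> k x \<partial>\<nu>) = (\<integral>x. \<phi> k x \<partial>\<mu>') - (\<integral>x. \<phi> k x \<partial>\<nu>')" for k
      using p[OF \<phi>(1), of k] p'[OF \<phi>(1), of k] by linarith
    ultimately have "measure \<mu> {a<..<b} - measure \<nu> {a<..<b} = measure \<mu>' {a<..<b} - measure \<nu>' {a<..<b}"
      by (auto dest: LIMSEQ_unique)
    moreover have "{a<..<b} \<in> sets (borel_ivl L)" using ab by (intro borel_sets_borel_ivl) auto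
    ultimately show ?thesis using m m' by simp
  qed (simp add: E)
  have all: "m (A \<inter> {0<..<L}) = m' (A \<inter> {0<..<L})" if "A \<in> sets borel" for A
    using that
  proof (induction rule: borel_real_induct_lessThan)
    case (lessThan a)
    have "{..<a} \<inter> {0<..<L} = {0<..<min a L}" by auto
    then show ?case using ivl[of 0 "min a L"] by simp
  next
    case empty
    show ?case by (simp add: E)
  next
    case (compl A)
    note A = compl(1)
    have s: "A \<inter> {0<..<L} \<in> sets (borel_ivl L)" "{0<..<L} \<in> sets (borel_ivl L)" "{0<..<L} - A \<inter> {0<..<L} \<in> sets (borel_ivl L)"
      using A by (auto intro!: borel_sets_borel_ivl)
    have e: "(- A) \<inter> {0<..<L} = {0<..<L} - A \<inter> {0<..<L}" by auto
    have D: "measure lam ({0<..<L} - A \<inter> {0<..<L}) = measure lam {0<..<L} - measure lam (A \<inter> {0<..<L})"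
      if "finite_measure lam" "sets lam = sets (borel_ivl L)" for lam
      using that s by (intro finite_measure.finite_measure_Diff) auto
    have "m {0<..<L} = m' {0<..<L}" using ivl[of 0 L] by simp
    then show ?case using compl(2) unfolding e m[OF s(1)] m[OF s(2)] m[OF s(3)] m'[OF s(1)] m'[OF s(2)] m'[OF s(3)]
        D[OF pq(1,2)] D[OF pq(3,4)] D[OF pq'(1,2)] D[OF pq'(3,4)] by linarith
  next
    case (union A)
    have s: "range (\<lambda>i. A i \<inter> {0<..<L}) \<subseteq> sets (borel_ivl L)"
      using union(2) by (auto intro!: borel_sets_borel_ivl)
    have dj: "disjoint_family (\<lambda>i. A i \<inter> {0<..<L})"
      using union(1) by (auto simp: disjoint_family_on_def)
    have "(\<lambda>i. m (A i \<inter> {0<..<L})) sums m (\<Union>i. A i \<inter> {0<..<L})"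
      by (rule sums[OF _ s dj]) simp
    moreover have "(\<lambda>i. m' (A i \<inter> {0<..<L})) sums m' (\<Union>i. A i \<inter> {0<..<L})"
      by (rule sums'[OF _ s dj]) simp
    ultimately have "m (\<Union>i. A i \<inter> {0<..<L}) = m' (\<Union>i. A i \<inter> {0<..<L})"
      using union(3) sums_unique2 by simp
    then show ?case by simp
  qed
  obtain B where "B \<in> sets borel" "A = B \<inter> {0<..<L}"
    using A by (auto simp: sets_restrict_space)
  then show ?thesis using all by simp
qed

lemma distr_deriv_is_distr_deriv:
  assumes "u \<in> BV L"
  shows "is_distr_deriv L u (distr_deriv L u)"
  using assms someI_ex[of "is_distr_deriv L u"] unfolding BV_def distr_deriv_def by auto

text \<open>
  By uniqueness the derivative is \<open>\<mu> - \<nu>\<close>, and \<open>\<bar>\<mu> B - \<nu> B\<bar> \<le> \<mu> B + \<nu> B\<close> on every piece \<open>B\<close> of a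
  partition.
\<close>

lemma total_variation_le:
  fixes L :: real
  assumes mu: "finite_measure \<mu>" "sets \<mu> = sets (borel_ivl L)"
    and nu: "finite_measure \<nu>" "sets \<nu> = sets (borel_ivl L)"
    and u: "u \<in> borel_measurable (leb_on_ivl L)" "integrable (leb_on_ivl L) u"
    and eq: "AE x in leb_on_ivl L. u x = c + measure \<mu> ({0<..<L} \<inter> {..x}) - measure \<nu> ({0<..<L} \<inter> {..x})"
  shows "u \<in> BV L"
    and "total_variation (borel_ivl L) (distr_deriv L u) {0<..<L} \<le> ennreal (measure \<mu> {0<..<L} + measure \<nu> {0<..<L})"
proof -
  have d: "is_distr_deriv L u (\<lambda>A. measure \<mu> A - measure \<nu> A)"
    by (rule is_distr_deriv_cumulative[OF mu nu u(1) eq])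
  then show bv: "u \<in> BV L" using u by (auto simp: BV_def)
  have m: "distr_deriv L u A = measure \<mu> A - measure \<nu> A" if "A \<in> sets (borel_ivl L)" for A
    by (rule is_distr_deriv_unique[OF distr_deriv_is_distr_deriv[OF bv] d that])
  show "total_variation (borel_ivl L) (distr_deriv L u) {0<..<L} \<le> ennreal (measure \<mu> {0<..<L} + measure \<nu> {0<..<L})"
    unfolding total_variation_def
  proof (rule SUP_least, clarify)
    fix B :: "nat \<Rightarrow> real set"
    assume B: "range B \<subseteq> sets (borel_ivl L)" "disjoint_family B" "(\<Union>i. B i) = {0<..<L}"
    have "(\<Sum>i. ennreal \<bar>distr_deriv L u (B i)\<bar>) \<le> (\<Sum>i. emeasure \<mu> (B i) + emeasure \<nu> (B i))"
    proof (rule suminf_le)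
      fix i
      have "\<bar>distr_deriv L u (B i)\<bar> \<le> measure \<mu> (B i) + measure \<nu> (B i)"
        using m[of "B i"] B by (auto simp: abs_if measure_nonneg intro: add_increasing add_increasing2)
      then show "ennreal \<bar>distr_deriv L u (B i)\<bar> \<le> emeasure \<mu> (B i) + emeasure \<nu> (B i)"
        by (metis finite_measure.emeasure_eq_measure mu(1) nu(1) ennreal_leI ennreal_plus measure_nonneg)
    qed auto
    also have "\<dots> = (\<Sum>i. emeasure \<mu> (B i)) + (\<Sum>i. emeasure \<nu> (B i))"
      by (rule suminf_add[symmetric]) auto
    also have "\<dots> = emeasure \<mu> {0<..<L} + emeasure \<nu> {0<..<L}"
      using B mu nu by (simp add: suminf_emeasure)
    also have "\<dots> = ennreal (measure \<mu> {0<..<L} + measure \<nu> {0<..<L})"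
      using mu nu by (simp add: finite_measure.emeasure_eq_measure)
    finally show "(\<Sum>i. ennreal \<bar>distr_deriv L u (B i)\<bar>) \<le> ennreal (measure \<mu> {0<..<L} + measure \<nu> {0<..<L})" .
  qed
qed

section \<open>Representatives of functions of bounded variation\<close>

lemma measure_leb_on_ivl:
  assumes "A \<in> sets borel" "A \<subseteq> {0<..<L}"
  shows "measure (leb_on_ivl L) A = measure lborel A"
  using assms by (subst measure_restrict_space) auto

lemma test_function_support:
  assumes "\<phi> \<in> test_functions L" "L > 0"
  obtains a b where "0 < a" "a \<le> b" "b < L" "\<And>x. x \<notin> {a..b} \<Longrightarrow> \<phi> x = 0"
proof (cases "closure {x. \<phi> x \<noteq> 0} = {}")
  case True
  then have "\<phi> x = 0" for x using closure_subset[of "{x. \<phi> x \<noteq> 0}"] by auto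
  then show ?thesis using that[of "L/2" "L/2"] assms by simp
next
  case False
  let ?K = "closure {x. \<phi> x \<noteq> 0}"
  have K: "compact ?K" "?K \<subseteq> {0<..<L}" using assms by (auto simp: test_functions_def)
  obtain a b where ab: "a \<in> ?K" "\<And>x. x \<in> ?K \<Longrightarrow> a \<le> x" "b \<in> ?K" "\<And>x. x \<in> ?K \<Longrightarrow> x \<le> b"
    using compact_attains_inf[OF K(1) False] compact_attains_sup[OF K(1) False] by blast
  have z: "\<phi> x = 0" if "x \<notin> {a..b}" for x
  proof (rule ccontr)
    assume "\<phi> x \<noteq> 0"
    then have "x \<in> ?K" using closure_subset[of "{x. \<phi> x \<noteq> 0}"] by blast
    then show False using ab(2,4) that by auto
  qed
  show ?thesis
  proof (rule that[OF _ _ _ z])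
    show "0 < a" "b < L" using ab(1,3) K(2) by auto
    show "a \<le> b" using ab(2)[OF ab(3)] .
  qed
qed

lemma integral_leb_on_ivl_eq_integral:
  fixes f :: "real \<Rightarrow> real"
  assumes int: "integrable (leb_on_ivl L) f" and ab: "0 < a" "b < L" and z: "\<And>x. x \<notin> {a..b} \<Longrightarrow> f x = 0"
  shows "(\<integral>x. f x \<partial>leb_on_ivl L) = integral {a..b} f"
proof -
  have "(f has_integral (\<integral>x. f x \<partial>leb_on_ivl L)) {0<..<L}"
    using has_integral_integral_lebesgue_on[OF int] by simp
  then have "((\<lambda>x. if x \<in> {a..b} then f x else 0) has_integral (\<integral>x. f x \<partial>leb_on_ivl L)) {0<..<L}"
    by (rule has_integral_eq[rotated]) (use z in auto)
  then have "(f has_integral (\<integral>x. f x \<partial>leb_on_ivl L)) {a..b}"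
    using ab by (subst (asm) has_integral_restrict) auto
  then show ?thesis by (simp add: integral_unique)
qed

text \<open>
  For test functions \<open>f\<close> and \<open>g\<close>, the combination \<open>(\<integral> g) f - (\<integral> f) g\<close> has mean zero and is therefore
  the derivative of a test function. Hence \<open>\<integral> w f\<close> is proportional to \<open>\<integral> f\<close>. Letting \<open>f\<close> and \<open>g\<close> tend
  to the indicators of \<open>(0, s)\<close> and \<open>(0, L)\<close> shows that the primitive of \<open>w\<close> is linear.
\<close>

lemma du_Bois_Reymond:
  fixes w :: "real \<Rightarrow> real"
  assumes L: "L > 0" and w: "w \<in> borel_measurable (leb_on_ivl L)" "AE x in leb_on_ivl L. \<bar>w x\<bar> \<le> K"
    and z: "\<And>\<phi>. \<phi> \<in> test_functions L \<Longrightarrow> (\<integral>x. w x * deriv \<phi> x \<partial>leb_on_ivl L) = 0"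
  obtains c where "AE x in leb_on_ivl L. w x = c"
proof -
  let ?M = "leb_on_ivl L"
  interpret finite_measure ?M by (rule finite_measure_leb_on_ivl)
  have wint: "integrable ?M w" by (rule integrable_bounded_leb[OF w])
  have test_int: "integrable ?M f" if "f \<in> test_functions L" for f
    using test_function_facts(2,6)[OF that]
    by (auto intro!: integrable_bounded_leb leb_on_ivl_borel borel_measurable_continuous_onI)
  have eqn: "(\<integral>x. g x \<partial>?M) * (\<integral>x. w x * f x \<partial>?M) = (\<integral>x. f x \<partial>?M) * (\<integral>x. w x * g x \<partial>?M)"
    if f: "f \<in> test_functions L" and g: "g \<in> test_functions L" for f g
  proof -
    define \<alpha> \<beta> where "\<alpha> = (\<integral>x. g x \<partial>?M)" and "\<beta> = - (\<integral>x. f x \<partial>?M)"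
    define h where "h = (\<lambda>x. \<alpha> * f x + \<beta> * g x)"
    obtain a b where a: "0 < a" "a \<le> b" "b < L" "\<And>x. x \<notin> {a..b} \<Longrightarrow> f x = 0"
      using test_function_support[OF f L] by metis
    obtain a' b' where a': "0 < a'" "a' \<le> b'" "b' < L" "\<And>x. x \<notin> {a'..b'} \<Longrightarrow> g x = 0"
      using test_function_support[OF g L] by metis
    define l r where "l = min a a'" and "r = max b b'"
    have lr: "h x = 0" if "x \<notin> {l..r}" for x
    proof -
      have "x \<notin> {a..b}" "x \<notin> {a'..b'}" using that by (auto simp: l_def r_def)
      then show ?thesis using a(4) a'(4) by (simp add: h_def)
    qed
    have lr': "0 < l" "l \<le> r" "r < L" using a a' by (auto simp: l_def r_def)
    have hint: "integrable ?M h" unfolding h_def using test_int[OF f] test_int[OF g] by simp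
    have "(\<integral>x. h x \<partial>?M) = 0"
      unfolding h_def using test_int[OF f] test_int[OF g] by (simp add: \<alpha>_def \<beta>_def)
    then have "integral {l..r} h = 0"
      using integral_leb_on_ivl_eq_integral[OF hint lr'(1,3)] lr by simp
    moreover have "smooth h" unfolding h_def
      by (rule smooth_lincomb) (use f g in \<open>auto simp: test_functions_def\<close>)
    ultimately obtain \<phi> where "\<phi> \<in> test_functions L" "deriv \<phi> = h"
      using test_function_with_derivative[of h l r L] lr lr' by metis
    then have "(\<integral>x. w x * h x \<partial>?M) = 0" using z by metis
    moreover have "(\<integral>x. w x * h x \<partial>?M) = (\<integral>x. \<alpha> * (w x * f x) + \<beta> * (w x * g x) \<partial>?M)"
      by (simp add: h_def algebra_simps)
    moreover have "\<dots> = \<alpha> * (\<integral>x. w x * f x \<partial>?M) + \<beta> * (\<integral>x. w x * g x \<partial>?M)"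
      using integrable_bounded_mult[OF w test_int[OF f]] integrable_bounded_mult[OF w test_int[OF g]] by simp
    ultimately show ?thesis by (simp add: \<alpha>_def \<beta>_def)
  qed
  define I where "I = (\<integral>x. w x \<partial>?M) / L"
  have prim: "(\<integral>x. w x * indicator {..<s} x \<partial>?M) = s * I" if s: "0 < s" "s \<le> L" for s
  proof -
    have lim: "(\<lambda>k. \<integral>x. v x * f k x \<partial>?M) \<longlonglongrightarrow> (\<integral>x. v x * indicator {0<..<b} x \<partial>?M)"
      if f: "\<And>k::nat. f k \<in> test_functions L" "\<And>k x. 0 \<le> f k x" "\<And>k x. f k x \<le> 1"
       "\<And>x. (\<lambda>k. f k x) \<longlonglongrightarrow> indicator {0<..<b} x" and v: "integrable ?M v" for v f b
    proof (rule integral_dominated_convergence[where w="\<lambda>x. \<bar>v x\<bar>"])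
      show "(\<lambda>x. v x * f k x) \<in> borel_measurable ?M" for k
        using v test_int[OF f(1), of k] by (intro borel_measurable_times) auto
      show "(\<lambda>x. v x * indicator {0<..<b} x) \<in> borel_measurable ?M"
        using v by (intro borel_measurable_times indicator_leb_measurable) auto
      show "AE x in ?M. (\<lambda>k. v x * f k x) \<longlonglongrightarrow> v x * indicator {0<..<b} x"
        using f(4) by (intro AE_I2 tendsto_mult_left)
      show "AE x in ?M. norm (v x * f k x) \<le> \<bar>v x\<bar>" for k
        using f(2,3) by (intro AE_I2) (simp add: abs_mult mult_left_le)
    qed (use v in auto)
    obtain f where f: "\<And>k::nat. f k \<in> test_functions L" "\<And>k x. 0 \<le> f k x" "\<And>k x. f k x \<le> 1"
       "\<And>x. (\<lambda>k. f k x) \<longlonglongrightarrow> indicator {0<..<s} x"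
      using test_functions_approximate_interval[of 0 s L] s by (metis order_refl)
    obtain g where g: "\<And>k::nat. g k \<in> test_functions L" "\<And>k x. 0 \<le> g k x" "\<And>k x. g k x \<le> 1"
       "\<And>x. (\<lambda>k. g k x) \<longlonglongrightarrow> indicator {0<..<L} x"
      using test_functions_approximate_interval[of 0 L L] L by (metis order_refl)
    have one: "integrable ?M (\<lambda>_. 1)" by simp
    have "(\<lambda>k. (\<integral>x. g k x \<partial>?M) * (\<integral>x. w x * f k x \<partial>?M)) \<longlonglongrightarrow>
        (\<integral>x. 1 * indicator {0<..<L} x \<partial>?M) * (\<integral>x. w x * indicator {0<..<s} x \<partial>?M)"
      using lim[OF g one] lim[OF f wint] by (intro tendsto_mult) simp_all
    moreover have "(\<lambda>k. (\<integral>x. f k x \<partial>?M) * (\<integral>x. w x * g k x \<partial>?M)) \<longlonglongrightarrow>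
        (\<integral>x. 1 * indicator {0<..<s} x \<partial>?M) * (\<integral>x. w x * indicator {0<..<L} x \<partial>?M)"
      using lim[OF f one] lim[OF g wint] by (intro tendsto_mult) simp_all
    ultimately have "(\<integral>x. 1 * indicator {0<..<L} x \<partial>?M) * (\<integral>x. w x * indicator {0<..<s} x \<partial>?M)
       = (\<integral>x. 1 * indicator {0<..<s} x \<partial>?M) * (\<integral>x. w x * indicator {0<..<L} x \<partial>?M)"
      using eqn[OF f(1) g(1)] by (auto dest: LIMSEQ_unique)
    moreover have meas: "(\<integral>x. 1 * indicator {0<..<b} x \<partial>?M) = b" if "0 < b" "b \<le> L" for b :: real
    proof -
      have "(\<integral>x. 1 * indicator {0<..<b} x \<partial>?M) = measure ?M ({0<..<b} \<inter> space ?M)" by simp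
      also have "{0<..<b} \<inter> space ?M = {0<..<b}" using that by (auto simp: space_restrict_space)
      also have "measure ?M {0<..<b} = b" using that by (subst measure_leb_on_ivl) auto
      finally show ?thesis .
    qed
    moreover have "(\<integral>x. w x * indicator {0<..<b} x \<partial>?M) = (\<integral>x. w x * indicator {..<b} x \<partial>?M)" for b
      by (rule Bochner_Integration.integral_cong) (auto simp: indicator_def space_restrict_space)
    moreover have "(\<integral>x. w x * indicator {0<..<L} x \<partial>?M) = (\<integral>x. w x \<partial>?M)"
      by (rule Bochner_Integration.integral_cong) (auto simp: indicator_def space_restrict_space)
    ultimately show ?thesis using meas[OF s] meas[of L] L by (simp add: I_def field_simps)
  qed
  have "AE x in ?M. w x - I = 0"
  proof (rule AE_zero_of_primitives)
    show "(\<lambda>x. w x - I) \<in> borel_measurable ?M" using w by simp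
    show "AE x in ?M. \<bar>w x - I\<bar> \<le> K + \<bar>I\<bar>" using w(2) by eventually_elim linarith
    show "L > 0" by fact
    fix a
    have i1: "integrable ?M (\<lambda>x. w x * indicator {..<a} x)" "integrable ?M (indicator {..<a} :: real \<Rightarrow> real)"
      by (auto intro!: integrable_bounded_mult w integrable_indicator_leb)
    have m: "measure ?M ({..<a} \<inter> space ?M) = max 0 (min a L)"
    proof -
      have e: "{..<a} \<inter> space ?M = {0<..<min a L}" by (auto simp: space_restrict_space)
      have "measure ?M {0<..<min a L} = measure lborel {0<..<min a L}"
        by (rule measure_leb_on_ivl) auto
      then show ?thesis unfolding e using L by (cases "0 \<le> a") simp_all
    qed
    have "(\<integral>x. (w x - I) * indicator {..<a} x \<partial>?M) = (\<integral>x. w x * indicator {..<a} x - I * indicator {..<a} x \<partial>?M)"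
      by (simp add: algebra_simps)
    also have "\<dots> = (\<integral>x. w x * indicator {..<a} x \<partial>?M) - I * max 0 (min a L)"
      using i1 m by (subst Bochner_Integration.integral_diff) auto
    also have "\<dots> = 0"
    proof -
      consider "a \<le> 0" | "0 < a" "a \<le> L" | "a > L" by linarith
      then show ?thesis
      proof cases
        case 1
        then have "(\<integral>x. w x * indicator {..<a} x \<partial>?M) = (\<integral>x. 0 \<partial>?M)"
          by (intro Bochner_Integration.integral_cong) (auto simp: space_restrict_space)
        then show ?thesis using 1 L by simp
      next
        case 2
        then show ?thesis using prim by simp
      next
        case 3
        then have "(\<integral>x. w x * indicator {..<a} x \<partial>?M) = (\<integral>x. w x \<partial>?M)"
          by (intro Bochner_Integration.integral_cong) (auto simp: space_restrict_space)
        then show ?thesis using 3 L by (simp add: I_def)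
      qed
    qed
    finally show "(\<integral>x. (w x - I) * indicator {..<a} x \<partial>?M) = 0" .
  qed
  then have "AE x in ?M. w x = I" by simp
  then show thesis by (rule that)
qed

lemma BV_representative:
  fixes L :: real
  assumes L: "L > 0" and bv: "u \<in> BV L" and um: "u \<in> borel_measurable (leb_on_ivl L)"
    and bd: "AE x in leb_on_ivl L. \<bar>u x\<bar> \<le> K"
  obtains \<mu> \<nu> c where "finite_measure \<mu>" "sets \<mu> = sets (borel_ivl L)"
    "finite_measure \<nu>" "sets \<nu> = sets (borel_ivl L)"
    "\<And>A. A \<in> sets (borel_ivl L) \<Longrightarrow> distr_deriv L u A = measure \<mu> A - measure \<nu> A"
    "AE x in leb_on_ivl L. u x = c + measure \<mu> ({0<..<L} \<inter> {..x}) - measure \<nu> ({0<..<L} \<inter> {..x})"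
proof -
  let ?M = "leb_on_ivl L"
  obtain \<mu> \<nu> where mu: "finite_measure \<mu>" "sets \<mu> = sets (borel_ivl L)"
    and nu: "finite_measure \<nu>" "sets \<nu> = sets (borel_ivl L)"
    and m: "\<And>A. A \<in> sets (borel_ivl L) \<Longrightarrow> distr_deriv L u A = measure \<mu> A - measure \<nu> A"
    and p: "\<And>\<phi>. \<phi> \<in> test_functions L \<Longrightarrow> (\<integral>x. u x * deriv \<phi> x \<partial>leb_on_ivl L) = - ((\<integral>x. \<phi> x \<partial>\<mu>) - (\<integral>x. \<phi> x \<partial>\<nu>))"
    using distr_deriv_is_distr_deriv[OF bv] unfolding is_distr_deriv_def by blast
  define G H where "G = (\<lambda>x. measure \<mu> ({0<..<L} \<inter> {..x}))" and "H = (\<lambda>x. measure \<nu> ({0<..<L} \<inter> {..x}))"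
  have G: "G \<in> borel_measurable borel" "\<And>x. 0 \<le> G x" "\<And>x. G x \<le> measure \<mu> {0<..<L}"
    and H: "H \<in> borel_measurable borel" "\<And>x. 0 \<le> H x" "\<And>x. H x \<le> measure \<nu> {0<..<L}"
    using cumulative_facts[OF mu] cumulative_facts[OF nu] by (auto simp: G_def H_def)
  have GH: "G \<in> borel_measurable ?M" "H \<in> borel_measurable ?M" using G H by (auto intro: leb_on_ivl_borel)
  define w where "w = (\<lambda>x. u x - (G x - H x))"
  obtain c where c: "AE x in ?M. w x = c"
  proof (rule du_Bois_Reymond[OF L])
    show "w \<in> borel_measurable ?M" using um GH by (simp add: w_def)
    show "AE x in ?M. \<bar>w x\<bar> \<le> K + measure \<mu> {0<..<L} + measure \<nu> {0<..<L}"
      using bd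
    proof eventually_elim
      case (elim x)
      then show ?case using G(2)[of x] G(3)[of x] H(2)[of x] H(3)[of x] unfolding w_def by linarith
    qed
    fix \<phi> assume \<phi>: "\<phi> \<in> test_functions L"
    note f = test_function_facts[OF \<phi>]
    have "integrable ?M (deriv \<phi>)"
      using f(6) by (auto intro!: integrable_bounded_leb leb_on_ivl_borel borel_measurable_continuous_onI[OF f(3)])
    then have i: "integrable ?M (\<lambda>x. u x * deriv \<phi> x)" "integrable ?M (\<lambda>x. G x * deriv \<phi> x)" "integrable ?M (\<lambda>x. H x * deriv \<phi> x)"
      using integrable_bounded_mult[OF um bd] integrable_bounded_mult[OF GH(1), of "measure \<mu> {0<..<L}"]
        integrable_bounded_mult[OF GH(2), of "measure \<nu> {0<..<L}"] G(2,3) H(2,3) by auto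
    have "(\<integral>x. w x * deriv \<phi> x \<partial>?M) = (\<integral>x. u x * deriv \<phi> x - (G x * deriv \<phi> x - H x * deriv \<phi> x) \<partial>?M)"
      by (simp add: w_def algebra_simps)
    also have "\<dots> = (\<integral>x. u x * deriv \<phi> x \<partial>?M) - ((\<integral>x. G x * deriv \<phi> x \<partial>?M) - (\<integral>x. H x * deriv \<phi> x \<partial>?M))"
      using i by simp
    also have "\<dots> = 0"
      using p[OF \<phi>] Stieltjes_integration_by_parts[OF mu \<phi>] Stieltjes_integration_by_parts[OF nu \<phi>]
      by (simp add: G_def H_def)
    finally show "(\<integral>x. w x * deriv \<phi> x \<partial>?M) = 0" .
  qed
  have "AE x in ?M. u x = c + G x - H x"
    using c by eventually_elim (simp add: w_def algebra_simps)
  then show thesis using that[OF mu nu m] by (simp add: G_def H_def)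
qed

text \<open>
  The pieces between consecutive points and the rest of \<open>(0, L)\<close>, followed by empty sets, form one of
  the countable partitions in the definition of the total variation.
\<close>

lemma partition_variation_le:
  fixes L :: real and x :: "nat \<Rightarrow> real"
  assumes mu: "finite_measure \<mu>" "sets \<mu> = sets (borel_ivl L)"
    and nu: "finite_measure \<nu>" "sets \<nu> = sets (borel_ivl L)"
    and m: "\<And>A. A \<in> sets (borel_ivl L) \<Longrightarrow> m A = measure \<mu> A - measure \<nu> A"
    and x: "mono x"
  defines "G \<equiv> \<lambda>x. m ({0<..<L} \<inter> {..x})"
  shows "ennreal (\<Sum>j<J. \<bar>G (x (Suc j)) - G (x j)\<bar>) \<le> total_variation (borel_ivl L) m {0<..<L}"
proof -
  define A where "A = (\<lambda>j. {0<..<L} \<inter> {x j<..x (Suc j)})"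
  define B where "B = (\<lambda>j. if j < J then A j else if j = J then {0<..<L} - (\<Union>i<J. A i) else {})"
  have sA: "A j \<in> sets (borel_ivl L)" "{0<..<L} \<inter> {..t} \<in> sets (borel_ivl L)" for j t
    by (auto simp: A_def intro!: borel_sets_borel_ivl)
  have mA: "m (A j) = G (x (Suc j)) - G (x j)" for j
  proof -
    have e: "A j = ({0<..<L} \<inter> {..x (Suc j)}) - ({0<..<L} \<inter> {..x j})" by (auto simp: A_def)
    have le: "x j \<le> x (Suc j)" using x by (simp add: monoD)
    have D: "measure lam (A j) = measure lam ({0<..<L} \<inter> {..x (Suc j)}) - measure lam ({0<..<L} \<inter> {..x j})"
      if "finite_measure lam" "sets lam = sets (borel_ivl L)" for lam
      unfolding e using that sA le by (intro finite_measure.finite_measure_Diff) auto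
    show ?thesis unfolding G_def m[OF sA(1)] m[OF sA(2)] D[OF mu] D[OF nu] by simp
  qed
  have disjA: "A i \<inter> A j = {}" if "i < j" for i j
  proof -
    have "x (Suc i) \<le> x j" using x that by (simp add: monoD)
    then show ?thesis by (auto simp: A_def)
  qed
  then have disjA': "i \<noteq> j \<Longrightarrow> A i \<inter> A j = {}" for i j by (metis inf_commute linorder_neqE_nat)
  have "(\<Sum>i. ennreal \<bar>m (B i)\<bar>) \<le> total_variation (borel_ivl L) m {0<..<L}"
    unfolding total_variation_def
  proof (rule SUP_upper, clarify, intro conjI)
    show "range B \<subseteq> sets (borel_ivl L)"
    proof clarify
      fix j
      have "{0<..<L} \<in> sets (borel_ivl L)" by (rule borel_sets_borel_ivl) auto
      then show "B j \<in> sets (borel_ivl L)" using sA by (auto simp: B_def)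
    qed
    show "disjoint_family B"
      unfolding disjoint_family_on_def
    proof (intro ballI impI)
      fix i j :: nat assume "i \<noteq> j"
      then show "B i \<inter> B j = {}" using disjA'[of i j] by (auto simp: B_def)
    qed
    show "\<Union> (range B) = {0<..<L}"
    proof
      show "\<Union> (range B) \<subseteq> {0<..<L}" by (auto simp: B_def A_def split: if_splits)
      show "{0<..<L} \<subseteq> \<Union> (range B)"
      proof
        fix y assume y: "y \<in> {0<..<L}"
        show "y \<in> \<Union> (range B)"
        proof (cases "y \<in> (\<Union>i<J. A i)")
          case True
          then obtain i where "i < J" "y \<in> A i" by auto
          then have "y \<in> B i" by (simp add: B_def)
          then show ?thesis by blast
        next
          case False
          then have "y \<in> B J" using y by (simp add: B_def)
          then show ?thesis by blast
        qed
      qed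
    qed
  qed
  moreover have "ennreal (\<Sum>j<J. \<bar>G (x (Suc j)) - G (x j)\<bar>) \<le> (\<Sum>i. ennreal \<bar>m (B i)\<bar>)"
  proof -
    have "ennreal (\<Sum>j<J. \<bar>G (x (Suc j)) - G (x j)\<bar>) = (\<Sum>j<J. ennreal \<bar>m (B j)\<bar>)"
      by (subst sum_ennreal[symmetric]) (auto simp: B_def mA)
    also have "\<dots> \<le> (\<Sum>i. ennreal \<bar>m (B i)\<bar>)" by (rule sum_le_suminf) auto
    finally show ?thesis .
  qed
  ultimately show ?thesis by (rule order_trans[rotated])
qed

lemma cumulative_right_continuous:
  fixes L :: real
  assumes lam: "finite_measure lam" "sets lam = sets (borel_ivl L)"
  shows "continuous (at_right x) (\<lambda>x. measure lam ({0<..<L} \<inter> {..x}))"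
proof -
  interpret finite_measure lam by fact
  let ?G = "\<lambda>x. measure lam ({0<..<L} \<inter> {..x})"
  have "(?G \<longlongrightarrow> ?G x) (at_right x)"
  proof (rule tendsto_at_right_sequentially[of x "x + 1"])
    fix S assume S: "\<And>n. x < S n" "\<And>n. S n < x + 1" "decseq S" "S \<longlonglongrightarrow> x"
    have "(\<lambda>n. measure lam ({0<..<L} \<inter> {..S n})) \<longlonglongrightarrow> measure lam (\<Inter>n. {0<..<L} \<inter> {..S n})"
    proof (rule finite_Lim_measure_decseq)
      show "range (\<lambda>n. {0<..<L} \<inter> {..S n}) \<subseteq> sets lam"
        unfolding lam(2) by (auto intro!: borel_sets_borel_ivl)
      show "decseq (\<lambda>n. {0<..<L} \<inter> {..S n})" using S(3) by (fastforce simp: decseq_def)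
    qed
    moreover have "(\<Inter>n. {0<..<L} \<inter> {..S n}) = {0<..<L} \<inter> {..x}"
      using less_imp_le[OF S(1)] LIMSEQ_le_const[OF S(4)] by (auto intro: order_trans)
    ultimately show "(\<lambda>n. ?G (S n)) \<longlonglongrightarrow> ?G x" by simp
  qed simp
  then show ?thesis by (simp add: continuous_within)
qed

section \<open>Sites, bonds and step functions\<close>

abbreviation nsites :: "real \<Rightarrow> nat \<Rightarrow> nat" where
  "nsites L n \<equiv> nat \<lfloor>L * (real n)\<^sup>2\<rfloor>"

lemma le_nat_floor_iff: "i > 0 \<Longrightarrow> i \<le> nat \<lfloor>y\<rfloor> \<longleftrightarrow> real i \<le> y"
  using le_floor_iff[of "int i" y] by (auto simp: le_nat_iff)

lemma sites_eq: "sites L n = {1..nsites L n}"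
  using le_nat_floor_iff by (auto simp: sites_def Suc_le_eq)

text \<open>
  The step function with value \<open>a i\<close> on the cell \<open>((i - 1) / N, i / N]\<close>. Truncation in \<open>nat\<close> gives it
  the value \<open>a 0\<close> at all \<open>x \<le> 0\<close>.
\<close>

definition cell_fun :: "real \<Rightarrow> (nat \<Rightarrow> real) \<Rightarrow> real \<Rightarrow> real" where
  "cell_fun N a x = a (nat \<lceil>N * x\<rceil>)"

definition near_sum :: "(nat \<Rightarrow> real) \<Rightarrow> nat \<Rightarrow> real" where
  "near_sum a M = (\<Sum>i\<in>{1..<M}. \<bar>a (Suc i) - a i\<bar>)"

text \<open>
  The index is the lower end point of the bond; by truncated subtraction the sum is empty if
  \<open>M \<le> n\<close>.
\<close>

definition far_sum :: "(nat \<Rightarrow> real) \<Rightarrow> nat \<Rightarrow> nat \<Rightarrow> real" where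
  "far_sum a n M = (\<Sum>i\<in>{1..M - n}. \<bar>a (i + n) - a i\<bar>)"

text \<open>
  This is the lattice energy if \<open>n \<ge> 2\<close>; for \<open>n = 1\<close> the two kinds of bonds coincide and would be
  counted twice.
\<close>

abbreviation helix_energy :: "real \<Rightarrow> nat \<Rightarrow> (nat \<Rightarrow> real) \<Rightarrow> real" where
  "helix_energy L n a \<equiv> (near_sum a (nsites L n) + far_sum a n (nsites L n)) / real n"

abbreviation density :: "nat \<Rightarrow> (nat \<Rightarrow> real) \<Rightarrow> real \<Rightarrow> real" where
  "density n a t \<equiv> (\<Sum>i\<in>{1..nat \<lfloor>(real n)\<^sup>2 * t\<rfloor>}. a i) / (real n)\<^sup>2"

lemma near_sum_nonneg: "0 \<le> near_sum a M" and far_sum_nonneg: "0 \<le> far_sum a n M"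
  by (auto simp: near_sum_def far_sum_def intro: sum_nonneg)

lemma edges_eq:
  "edges L n = (\<lambda>i. {i, Suc i}) ` {1..<nsites L n} \<union> (\<lambda>i. {i, i + n}) ` {1..nsites L n - n}"
  (is "_ = ?A \<union> ?B")
proof
  show "edges L n \<subseteq> ?A \<union> ?B"
  proof
    fix e assume "e \<in> edges L n"
    then obtain i j where e: "e = {i, j}" "i \<in> {1..nsites L n}" "j \<in> {1..nsites L n}"
      and d: "\<bar>int i - int j\<bar> = 1 \<or> \<bar>int i - int j\<bar> = int n"
      unfolding edges_def sites_eq by blast
    from d consider "j = Suc i" | "i = Suc j" | "j = i + n" | "i = j + n" by linarith
    then show "e \<in> ?A \<union> ?B"
    proof cases
      case 1
      then have "e = {i, Suc i}" "i \<in> {1..<nsites L n}" using e by auto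
      then show ?thesis by blast
    next
      case 2
      then have "e = {j, Suc j}" "j \<in> {1..<nsites L n}" using e by auto
      then show ?thesis by blast
    next
      case 3
      then have "e = {i, i + n}" "i \<in> {1..nsites L n - n}" using e by auto
      then show ?thesis by blast
    next
      case 4
      then have "e = {j, j + n}" "j \<in> {1..nsites L n - n}" using e by auto
      then show ?thesis by blast
    qed
  qed
  show "?A \<union> ?B \<subseteq> edges L n"
    unfolding edges_def sites_eq by (auto intro!: exI)
qed

text \<open>
  A bond is determined by its length and its lower end point, and on values \<open>0\<close> and \<open>1\<close> the square of
  a difference is its absolute value.
\<close>

lemma lattice_energy_eq:
  assumes n: "n \<ge> 2" and v: "\<And>i. i \<in> sites L n \<Longrightarrow> site_value n v i = a i"
    and a: "\<And>i. i \<in> {1..nsites L n} \<Longrightarrow> a i \<in> {0, 1}"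
  shows "lattice_energy L n v = helix_energy L n a"
proof -
  let ?M = "nsites L n"
  let ?f = "\<lambda>e. (site_value n v (Max e) - site_value n v (Min e))\<^sup>2"
  have pair: "Max {i, i + k} = i + k" "Min {i, i + k} = i" for i k :: nat
    by (auto simp: max_def min_def)
  have sq: "(a i - a j)\<^sup>2 = \<bar>a i - a j\<bar>" if "i \<in> {1..?M}" "j \<in> {1..?M}" for i j
    using a[OF that(1)] a[OF that(2)] by auto
  have inj: "inj_on (\<lambda>i. {i, i + k}) A" for k :: nat and A
    by (rule inj_onI) (metis pair(2))
  have "(\<lambda>i. {i, i + 1}) ` {1..<?M} \<inter> (\<lambda>i. {i, i + n}) ` {1..?M - n} = {}"
  proof (rule ccontr)
    assume "\<not> ?thesis"
    then obtain i j where "{i, i + 1} = {j, j + n}" by blast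
    then have "Max {i, i + 1} = Max {j, j + n}" "Min {i, i + 1} = Min {j, j + n}" by simp_all
    then show False using n unfolding pair by simp
  qed
  then have "(\<Sum>e\<in>edges L n. ?f e) = (\<Sum>e\<in>(\<lambda>i. {i, i + 1}) ` {1..<?M}. ?f e) + (\<Sum>e\<in>(\<lambda>i. {i, i + n}) ` {1..?M - n}. ?f e)"
    unfolding edges_eq by (subst sum.union_disjoint[symmetric]) auto
  also have "(\<Sum>e\<in>(\<lambda>i. {i, i + 1}) ` {1..<?M}. ?f e) = near_sum a ?M"
    unfolding sum.reindex[OF inj] comp_def pair near_sum_def
    by (rule sum.cong) (auto simp: v sites_eq sq)
  also have "(\<Sum>e\<in>(\<lambda>i. {i, i + n}) ` {1..?M - n}. ?f e) = far_sum a n ?M"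
    unfolding sum.reindex[OF inj] comp_def pair far_sum_def
    by (rule sum.cong) (auto simp: v sites_eq sq)
  finally show ?thesis by (simp add: lattice_energy_def)
qed

lemma lattice_energy_nonneg: "0 \<le> lattice_energy L n v"
  by (simp add: lattice_energy_def sum_nonneg)

lemma nat_ceiling_cell:
  assumes "N > 0"
  shows "x \<in> {(real i - 1) / N <.. real i / N} \<and> i > 0 \<longleftrightarrow> x > 0 \<and> nat \<lceil>N * x\<rceil> = i"
proof -
  have "x \<in> {(real i - 1) / N <.. real i / N} \<longleftrightarrow> real i - 1 < N * x \<and> N * x \<le> real i"
    using assms by (auto simp: field_simps)
  also have "\<dots> \<longleftrightarrow> \<lceil>N * x\<rceil> = int i" by (auto simp: ceiling_eq_iff)
  finally have 1: "x \<in> {(real i - 1) / N <.. real i / N} \<longleftrightarrow> \<lceil>N * x\<rceil> = int i" .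
  have 2: "0 < x \<longleftrightarrow> 0 < \<lceil>N * x\<rceil>" using assms by (simp add: zero_less_mult_iff)
  have "z = int i \<and> i > 0 \<longleftrightarrow> 0 < z \<and> nat z = i" for z :: int by auto
  then show ?thesis unfolding 1 2 .
qed

lemma admissible_cell_fun:
  assumes n: "n \<ge> 1" and v: "v \<in> admissible L n k"
  obtains a where "v = cell_fun ((real n)\<^sup>2) a" "\<And>i. a i \<in> {0, 1}" "\<And>i. i \<notin> {1..nsites L n} \<Longrightarrow> a i = 0"
    "\<And>i. i \<in> sites L n \<Longrightarrow> site_value n v i = a i" "(\<Sum>i\<in>{1..nsites L n}. a i) = real k"
proof -
  let ?M = "nsites L n" and ?N = "(real n)\<^sup>2"
  have N: "?N > 0" using n by simp
  define a where "a = (\<lambda>i. if i \<in> {1..?M} then site_value n v i else 0)"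
  have dl: "x \<le> discrete_length L n \<longleftrightarrow> ?N * x \<le> of_int \<lfloor>L * ?N\<rfloor>" for x
    using N by (simp add: discrete_length_def field_simps)
  have in_range: "nat \<lceil>?N * x\<rceil> \<in> {1..?M} \<longleftrightarrow> x \<in> {0<..discrete_length L n}" for x
  proof -
    have "x \<in> {0<..discrete_length L n} \<longleftrightarrow> 0 < ?N * x \<and> \<lceil>?N * x\<rceil> \<le> \<lfloor>L * ?N\<rfloor>"
      using N dl by (simp add: zero_less_mult_iff ceiling_le_iff)
    also have "\<dots> \<longleftrightarrow> 0 < \<lceil>?N * x\<rceil> \<and> \<lceil>?N * x\<rceil> \<le> \<lfloor>L * ?N\<rfloor>" by simp
    also have "\<dots> \<longleftrightarrow> nat \<lceil>?N * x\<rceil> \<in> {1..?M}"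
      by (auto simp: Suc_le_eq) linarith+
    finally show ?thesis by simp
  qed
  have v01: "v x \<in> {0, 1}" if "x \<in> {0<..discrete_length L n}" for x
    using v that by (auto simp: admissible_def)
  have rng: "real i / ?N \<in> {0<..discrete_length L n}" if "i \<in> {1..?M}" for i
    using in_range[of "real i / ?N"] that N by simp
  show thesis
  proof (rule that[of a])
    show "a i \<in> {0, 1}" for i
      using v01[OF rng[of i]] by (auto simp: a_def site_value_def)
    show "v = cell_fun ?N a"
    proof
      fix x
      show "v x = cell_fun ?N a x"
      proof (cases "x \<in> {0<..discrete_length L n}")
        case True
        define i where "i = nat \<lceil>?N * x\<rceil>"
        have i: "i \<in> {1..?M}" using True in_range i_def by blast
        have "x \<in> {(real i - 1) / ?N <.. real i / ?N}"
          using nat_ceiling_cell[OF N, of x i] True i_def by auto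
        moreover have "real i / ?N \<in> {(real i - 1) / ?N <.. real i / ?N}"
          using N by (auto simp: divide_strict_right_mono)
        moreover have "v constant_on {(real i - 1) / ?N <.. real i / ?N}"
          using v i by (auto simp: admissible_def sites_eq)
        ultimately have "v x = v (real i / ?N)" unfolding constant_on_def by metis
        then show ?thesis using i by (simp add: cell_fun_def a_def i_def[symmetric] site_value_def)
      next
        case False
        then have "v x = 0" using v by (auto simp: admissible_def)
        moreover have "nat \<lceil>?N * x\<rceil> \<notin> {1..?M}" using False in_range by blast
        then have "a (nat \<lceil>?N * x\<rceil>) = 0" unfolding a_def by (rule if_not_P)
        ultimately show ?thesis by (simp add: cell_fun_def)
      qed
    qed
    have "(\<Sum>i\<in>{1..?M}. a i) = (\<Sum>i\<in>{i\<in>{1..?M}. site_value n v i = 1}. 1)"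
      unfolding sum.inter_filter[OF finite_atLeastAtMost]
      by (rule sum.cong) (use v01[OF rng] in \<open>auto simp: a_def site_value_def\<close>)
    also have "\<dots> = real (card {i \<in> {1..?M}. site_value n v i = 1})" by simp
    also have "card {i \<in> {1..?M}. site_value n v i = 1} = k"
      using v by (simp add: admissible_def sites_eq)
    finally show "(\<Sum>i\<in>{1..?M}. a i) = real k" .
  qed (auto simp: a_def sites_eq)
qed

lemma cell_fun_admissible:
  assumes n: "n \<ge> 1" and a: "\<And>i. a i \<in> {0, 1}" "\<And>i. i \<notin> {1..nsites L n} \<Longrightarrow> a i = 0"
    and k: "(\<Sum>i\<in>{1..nsites L n}. a i) = real k"
  shows "cell_fun ((real n)\<^sup>2) a \<in> admissible L n k"
    and "site_value n (cell_fun ((real n)\<^sup>2) a) i = a i"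
proof -
  let ?M = "nsites L n" and ?N = "(real n)\<^sup>2"
  have N: "?N > 0" using n by simp
  show sv: "site_value n (cell_fun ?N a) i = a i" for i
    using N by (simp add: site_value_def cell_fun_def)
  have out: "cell_fun ?N a x = 0" if "x \<notin> {0<..discrete_length L n}" for x
  proof -
    have "nat \<lceil>?N * x\<rceil> \<notin> {1..?M}"
    proof
      assume "nat \<lceil>?N * x\<rceil> \<in> {1..?M}"
      then have *: "0 < \<lceil>?N * x\<rceil>" "\<lceil>?N * x\<rceil> \<le> \<lfloor>L * ?N\<rfloor>" by auto linarith+
      then have "0 < ?N * x" "?N * x \<le> of_int \<lfloor>L * ?N\<rfloor>" by (simp_all add: ceiling_le_iff)
      then show False using that N by (auto simp: discrete_length_def field_simps zero_less_mult_iff)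
    qed
    then show ?thesis using a(2) by (simp add: cell_fun_def)
  qed
  have const: "cell_fun ?N a constant_on {(real i - 1) / ?N <.. real i / ?N}" if "i \<in> sites L n" for i
  proof -
    have "i > 0" using that by (simp add: sites_eq)
    then have "\<forall>x\<in>{(real i - 1) / ?N <.. real i / ?N}. cell_fun ?N a x = a i"
      using nat_ceiling_cell[OF N] by (metis cell_fun_def)
    then show ?thesis by (auto simp: constant_on_def)
  qed
  have "real (card {i \<in> {1..?M}. a i = 1}) = (\<Sum>i\<in>{i \<in> {1..?M}. a i = 1}. 1)" by simp
  also have "\<dots> = (\<Sum>i\<in>{1..?M}. a i)"
    unfolding sum.inter_filter[OF finite_atLeastAtMost]
    by (rule sum.cong) (use a(1) in auto)
  finally have "card {i \<in> {1..?M}. a i = 1} = k" using k by simp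
  then show "cell_fun ?N a \<in> admissible L n k"
    using out const a(1) unfolding admissible_def by (auto simp: cell_fun_def sites_eq sv)
qed

lemma cell_fun_measurable: "cell_fun N a \<in> borel_measurable borel"
proof -
  have "(\<lambda>x::real. nat \<lceil>N * x\<rceil>) \<in> measurable borel (count_space UNIV)" by measurable
  then show ?thesis unfolding cell_fun_def by (rule measurable_compose) simp
qed

lemma integral_leb_indicator:
  fixes f :: "real \<Rightarrow> real"
  assumes [measurable]: "f \<in> borel_measurable borel" and t: "t \<le> L"
  shows "primitive L f t = (\<integral>x. f x * indicator {0<..<t} x \<partial>lborel)"
proof -
  have "primitive L f t = (\<integral>x. indicator {0<..<L} x *\<^sub>R (f x * indicator {..<t} x) \<partial>lebesgue)"
    by (rule integral_restrict_space) simp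
  also have "\<dots> = (\<integral>x. indicator {0<..<L} x *\<^sub>R (f x * indicator {..<t} x) \<partial>lborel)"
    by (rule integral_completion) measurable
  also have "\<dots> = (\<integral>x. f x * indicator {0<..<t} x \<partial>lborel)"
    using t by (intro Bochner_Integration.integral_cong) (auto simp: indicator_def)
  finally show ?thesis .
qed

text \<open>
  The cells to the left of \<open>t\<close> contribute exactly; the error is the part of the cell cut by \<open>t\<close>.
\<close>

lemma integral_cell_fun:
  fixes a :: "nat \<Rightarrow> real"
  assumes N: "N > 0" and t: "0 \<le> t" "t \<le> L" and K: "\<And>i. \<bar>a i\<bar> \<le> K"
  shows "\<bar>primitive L (cell_fun N a) t - (\<Sum>i\<in>{1..nat \<lfloor>N * t\<rfloor>}. a i) / N\<bar> \<le> K / N"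
proof -
  define m where "m = nat \<lfloor>N * t\<rfloor>"
  have m: "real m \<le> N * t" "N * t < real m + 1" using N t by (auto simp: m_def)
  define C where "C = (\<lambda>i::nat. {(real i - 1) / N <.. real i / N})"
  have "cell_fun N a x * indicator {0<..<t} x = (\<Sum>i\<in>{1..Suc m}. a i * indicator (C i \<inter> {0<..<t}) x)" for x
  proof (cases "x \<in> {0<..<t}")
    case True
    define j where "j = nat \<lceil>N * x\<rceil>"
    have "N * x \<le> N * t" using True N by simp
    then have "\<lceil>N * x\<rceil> \<le> int (Suc m)" using m by (simp add: ceiling_le_iff)
    moreover have "0 < \<lceil>N * x\<rceil>" using N True by simp
    moreover have "nat z \<in> {1..Suc m}" if "z \<le> int (Suc m)" "0 < z" for z :: int
      using that by auto
    ultimately have j: "j \<in> {1..Suc m}" unfolding j_def by blast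
    have "(\<Sum>i\<in>{1..Suc m}. a i * indicator (C i \<inter> {0<..<t}) x) = (\<Sum>i\<in>{1..Suc m}. if i = j then a i else 0)"
    proof (rule sum.cong[OF refl])
      fix i assume "i \<in> {1..Suc m}"
      then have "x \<in> C i \<longleftrightarrow> i = j"
        using nat_ceiling_cell[OF N, of x i] True by (auto simp: C_def j_def)
      then show "a i * indicator (C i \<inter> {0<..<t}) x = (if i = j then a i else 0)"
        using True by (simp add: indicator_def)
    qed
    also have "\<dots> = a j" using j by simp
    finally show ?thesis using True by (simp add: cell_fun_def j_def)
  qed simp
  then have "primitive L (cell_fun N a) t
      = (\<integral>x. (\<Sum>i\<in>{1..Suc m}. a i * indicator (C i \<inter> {0<..<t}) x) \<partial>lborel)"
    unfolding integral_leb_indicator[OF cell_fun_measurable t(2)] by simp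
  also have "\<dots> = (\<Sum>i\<in>{1..Suc m}. \<integral>x. a i * indicator (C i \<inter> {0<..<t}) x \<partial>lborel)"
  proof (rule Bochner_Integration.integral_sum)
    fix i
    have "emeasure lborel (C i \<inter> {0<..<t}) \<le> emeasure lborel {0<..<t}" by (rule emeasure_mono) auto
    also have "\<dots> < \<infinity>" using t by simp
    finally show "integrable lborel (\<lambda>x. a i * indicator (C i \<inter> {0<..<t}) x)"
      by (intro integrable_mult_right integrable_real_indicator) (auto simp: C_def)
  qed
  also have "\<dots> = (\<Sum>i\<in>{1..Suc m}. a i * measure lborel (C i \<inter> {0<..<t}))" by simp
  also have "\<dots> = (\<Sum>i\<in>{1..m}. a i * measure lborel (C i \<inter> {0<..<t})) + a (Suc m) * measure lborel (C (Suc m) \<inter> {0<..<t})"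
    by simp
  also have "(\<Sum>i\<in>{1..m}. a i * measure lborel (C i \<inter> {0<..<t})) = (\<Sum>i\<in>{1..m}. a i) / N"
    unfolding sum_divide_distrib
  proof (rule sum.cong[OF refl])
    fix i assume i: "i \<in> {1..m}"
    have "real i / N \<le> t" using i m N by (simp add: divide_le_eq mult.commute)
    have "measure lborel (C i \<inter> {0<..<t}) = measure lborel {(real i - 1) / N <..< real i / N}"
    proof (rule measure_eq_AE)
      show "AE x in lborel. (x \<in> C i \<inter> {0<..<t}) = (x \<in> {(real i - 1) / N <..< real i / N})"
        using AE_lborel_singleton[of "real i / N"]
      proof eventually_elim
        case (elim x)
        have "(real i - 1) / N \<ge> 0" using i N by simp
        then show ?case using elim \<open>real i / N \<le> t\<close> by (auto simp: C_def)
      qed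
    qed (auto simp: C_def)
    also have "\<dots> = 1 / N" using N by (simp add: diff_divide_distrib divide_right_mono)
    finally show "a i * measure lborel (C i \<inter> {0<..<t}) = a i / N" by simp
  qed
  finally have eq: "primitive L (cell_fun N a) t - (\<Sum>i\<in>{1..m}. a i) / N
      = a (Suc m) * measure lborel (C (Suc m) \<inter> {0<..<t})" by simp
  have "measure lborel (C (Suc m) \<inter> {0<..<t}) \<le> measure lborel (C (Suc m))"
    using N by (intro measure_mono_fmeasurable)
      (auto simp: C_def emeasure_lborel_Ioc divide_right_mono intro!: fmeasurableI)
  also have "\<dots> = 1 / N" using N by (simp add: C_def divide_right_mono diff_divide_distrib add_divide_distrib)
  finally have "\<bar>a (Suc m)\<bar> * measure lborel (C (Suc m) \<inter> {0<..<t}) \<le> K * (1 / N)"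
    using K[of "Suc m"] by (intro mult_mono) auto
  then show ?thesis unfolding m_def[symmetric] eq by (simp add: abs_mult)
qed

lemma primitive_minus_density:
  fixes a :: "nat \<Rightarrow> nat \<Rightarrow> real"
  assumes a: "\<And>n i. \<bar>a n i\<bar> \<le> 1" and t: "0 \<le> t" "t \<le> L"
  shows "(\<lambda>n. primitive L (cell_fun ((real n)\<^sup>2) (a n)) t - density n (a n) t) \<longlonglongrightarrow> 0"
proof (rule Lim_null_comparison)
  show "\<forall>\<^sub>F n in sequentially. norm (primitive L (cell_fun ((real n)\<^sup>2) (a n)) t - density n (a n) t) \<le> 1 / (real n)\<^sup>2"
    using eventually_gt_at_top[of 0]
  proof eventually_elim
    case (elim n)
    then show ?case using integral_cell_fun[of "(real n)\<^sup>2" t L "a n" 1] a t by simp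
  qed
  show "(\<lambda>n. 1 / (real n)\<^sup>2) \<longlonglongrightarrow> 0" by real_asymp
qed

section \<open>Window means\<close>

text \<open>
  The proportion of ones in a row of the helix that may start at any site.
\<close>

definition window_mean :: "nat \<Rightarrow> (nat \<Rightarrow> real) \<Rightarrow> nat \<Rightarrow> real" where
  "window_mean n a i = (\<Sum>l<n. a (i + l)) / real n"

lemma window_mean_range:
  assumes "\<And>i. a i \<in> {0..1}"
  shows "window_mean n a i \<in> {0..1}"
proof -
  have "(\<Sum>l<n. a (i + l)) \<le> (\<Sum>l<n. 1)" by (rule sum_mono) (use assms in auto)
  moreover have "0 \<le> (\<Sum>l<n. a (i + l))" by (rule sum_nonneg) (use assms in auto)
  ultimately show ?thesis by (auto simp: window_mean_def divide_le_eq_1)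
qed

text \<open>
  Sliding the window by one site drops \<open>a i\<close> and gains \<open>a (i + n)\<close>: the variation of the window means
  is carried exactly by the bonds of length \<open>n\<close>.
\<close>

lemma window_mean_Suc:
  "window_mean n a (Suc i) - window_mean n a i = (a (i + n) - a i) / real n"
proof -
  have "(\<Sum>l<n. a (Suc i + l)) - (\<Sum>l<n. a (i + l)) = (\<Sum>l<n. a (i + Suc l) - a (i + l))"
    by (simp add: sum_subtractf)
  also have "\<dots> = a (i + n) - a (i + 0)" by (rule sum_lessThan_telescope)
  finally show ?thesis by (simp add: window_mean_def diff_divide_distrib[symmetric])
qed

text \<open>
  Shifting the range of summation by \<open>l\<close> sites exchanges \<open>l\<close> terms, each of them in \<open>[0, 1]\<close>.
\<close>

lemma sum_window_mean:
  assumes a: "\<And>i. a i \<in> {0..1}" and False: "n > 0"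
  shows "\<bar>(\<Sum>i\<in>{1..m}. window_mean n a i) - (\<Sum>i\<in>{1..m}. a i)\<bar> \<le> real n"
proof -
  have shift: "\<bar>(\<Sum>i\<in>{1..m}. a (i + l)) - (\<Sum>i\<in>{1..m}. a i)\<bar> \<le> real l" for l
  proof (induction l)
    case (Suc l)
    have "(\<Sum>i\<in>{1..m}. a (i + Suc l)) - (\<Sum>i\<in>{1..m}. a (i + l)) = (\<Sum>i\<in>{1..m}. a (Suc i + l) - a (i + l))"
      by (simp add: sum_subtractf)
    also have "\<dots> = a (Suc m + l) - a (1 + l)"
      by (rule sum_Suc_diff'[of 1 "Suc m" "\<lambda>i. a (i + l)", unfolded atLeastLessThanSuc_atLeastAtMost]) simp
    finally show ?case using Suc a[of "Suc m + l"] a[of "1 + l"] by (simp add: abs_le_iff)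
  qed simp
  have "(\<Sum>i\<in>{1..m}. window_mean n a i) - (\<Sum>i\<in>{1..m}. a i)
      = (\<Sum>l<n. (\<Sum>i\<in>{1..m}. a (i + l)) - (\<Sum>i\<in>{1..m}. a i)) / real n"
    using False unfolding window_mean_def
    by (simp add: sum_subtractf sum_divide_distrib[symmetric] diff_divide_distrib sum.swap[of _ "{..<n}"])
  also have "\<bar>\<dots>\<bar> \<le> (\<Sum>l<n. real n) / real n"
    unfolding abs_divide abs_of_nat
    by (intro divide_right_mono order_trans[OF sum_abs] sum_mono order_trans[OF shift]) auto
  finally show ?thesis using False by simp
qed

text \<open>
  If the two ends of the window carry the same value, then a window with both values contains a way
  out of this value and a way back. Otherwise the last summand is already \<open>2\<close>.
\<close>

lemma two_jumps_in_mixed_window: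
  assumes a: "\<And>i. a i \<in> {0, 1::real}" and w: "window_mean n a i \<notin> {0, 1}"
  shows "2 \<le> (\<Sum>j\<in>{i..<i + n}. \<bar>a (Suc j) - a j\<bar>) + 2 * \<bar>a (i + n) - a i\<bar>"
proof -
  have n: "n > 0" using w by (cases n) (auto simp: window_mean_def)
  obtain l where l: "l < n" "a (i + l) \<noteq> a i"
  proof (rule ccontr)
    assume "\<not> thesis"
    then have "(\<Sum>l<n. a (i + l)) = (\<Sum>l<n. a i)" using that by (intro sum.cong) auto
    then have "window_mean n a i = a i" using n by (simp add: window_mean_def)
    then show False using w a[of i] by auto
  qed
  have tele: "\<bar>a q - a p\<bar> \<le> (\<Sum>j\<in>{p..<q}. \<bar>a (Suc j) - a j\<bar>)" if "p \<le> q" for p q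
    using sum_Suc_diff'[OF that, of a] sum_abs[of "\<lambda>j. a (Suc j) - a j" "{p..<q}"] by simp
  have "(\<Sum>j\<in>{i..<i + n}. \<bar>a (Suc j) - a j\<bar>)
      = (\<Sum>j\<in>{i..<i + l}. \<bar>a (Suc j) - a j\<bar>) + (\<Sum>j\<in>{i + l..<i + n}. \<bar>a (Suc j) - a j\<bar>)"
    using l by (simp add: sum.atLeastLessThan_concat)
  moreover have "\<bar>a (i + l) - a i\<bar> \<le> (\<Sum>j\<in>{i..<i + l}. \<bar>a (Suc j) - a j\<bar>)"
    "\<bar>a (i + n) - a (i + l)\<bar> \<le> (\<Sum>j\<in>{i + l..<i + n}. \<bar>a (Suc j) - a j\<bar>)"
    using tele[of i "i + l"] tele[of "i + l" "i + n"] l by auto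
  ultimately show ?thesis using a[of i] a[of "i + l"] a[of "i + n"] l by auto
qed

lemma sum_over_windows_le:
  fixes d :: "nat \<Rightarrow> real"
  assumes d: "\<And>j. 0 \<le> d j"
  shows "(\<Sum>i\<in>{1..M - n}. \<Sum>j\<in>{i..<i + n}. d j) \<le> real n * (\<Sum>j\<in>{1..<M}. d j)"
proof -
  have "(\<Sum>i\<in>{1..M - n}. \<Sum>j\<in>{i..<i + n}. d j) = (\<Sum>i\<in>{1..M - n}. \<Sum>l<n. d (i + l))"
  proof (rule sum.cong[OF refl])
    show "(\<Sum>j\<in>{i..<i + n}. d j) = (\<Sum>l<n. d (i + l))" for i
      by (rule sum.reindex_bij_witness[of _ "\<lambda>l. i + l" "\<lambda>j. j - i"]) auto
  qed
  also have "\<dots> = (\<Sum>l<n. \<Sum>i\<in>{1..M - n}. d (i + l))" by (rule sum.swap)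
  also have "\<dots> \<le> (\<Sum>l<n. (\<Sum>j\<in>{1..<M}. d j))"
  proof (rule sum_mono)
    fix l assume l: "l \<in> {..<n}"
    have "(\<Sum>i\<in>{1..M - n}. d (i + l)) = (\<Sum>j\<in>(\<lambda>i. i + l) ` {1..M - n}. d j)"
      by (subst sum.reindex) (auto simp: inj_on_def)
    also have "\<dots> \<le> (\<Sum>j\<in>{1..<M}. d j)"
      by (rule sum_mono2) (use l d in auto)
    finally show "(\<Sum>i\<in>{1..M - n}. d (i + l)) \<le> (\<Sum>j\<in>{1..<M}. d j)" .
  qed
  finally show ?thesis by simp
qed

text \<open>
  Summing over all windows counts each bond of length \<open>1\<close> at most \<open>n\<close> times.
\<close>

lemma mixed_windows_le_near_sum:
  assumes a: "\<And>i. a i \<in> {0, 1::real}"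
  shows "2 * real (card {i \<in> {1..M - n}. window_mean n a i \<notin> {0, 1}}) \<le> real n * near_sum a M + 2 * far_sum a n M"
proof -
  let ?S = "{i \<in> {1..M - n}. window_mean n a i \<notin> {0, 1}}"
  let ?d = "\<lambda>j. \<bar>a (Suc j) - a j\<bar>"
  have "2 * real (card ?S) = (\<Sum>i\<in>?S. 2)" by simp
  also have "\<dots> \<le> (\<Sum>i\<in>?S. (\<Sum>j\<in>{i..<i + n}. ?d j) + 2 * \<bar>a (i + n) - a i\<bar>)"
    by (intro sum_mono two_jumps_in_mixed_window a) auto
  also have "\<dots> \<le> (\<Sum>i\<in>{1..M - n}. (\<Sum>j\<in>{i..<i + n}. ?d j) + 2 * \<bar>a (i + n) - a i\<bar>)"
    by (rule sum_mono2) (auto intro!: add_nonneg_nonneg sum_nonneg)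
  also have "\<dots> = (\<Sum>i\<in>{1..M - n}. \<Sum>j\<in>{i..<i + n}. ?d j) + 2 * far_sum a n M"
    by (simp add: sum.distrib sum_distrib_left far_sum_def)
  also have "(\<Sum>i\<in>{1..M - n}. \<Sum>j\<in>{i..<i + n}. ?d j) \<le> real n * near_sum a M"
    unfolding near_sum_def by (rule sum_over_windows_le) simp
  finally show ?thesis by simp
qed

lemma far_sum_le_near_sum: "far_sum a n M \<le> real n * near_sum a M"
proof -
  have "far_sum a n M \<le> (\<Sum>i\<in>{1..M - n}. \<Sum>j\<in>{i..<i + n}. \<bar>a (Suc j) - a j\<bar>)"
    unfolding far_sum_def
  proof (rule sum_mono)
    fix i
    show "\<bar>a (i + n) - a i\<bar> \<le> (\<Sum>j\<in>{i..<i + n}. \<bar>a (Suc j) - a j\<bar>)"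
      using sum_Suc_diff'[of i "i + n" a] sum_abs[of "\<lambda>j. a (Suc j) - a j" "{i..<i + n}"] by simp
  qed
  also have "\<dots> \<le> real n * near_sum a M"
    unfolding near_sum_def by (rule sum_over_windows_le) simp
  finally show ?thesis .
qed

section \<open>Compactness and the lower bound\<close>

lemma step_sum_facts:
  fixes c :: "'i \<Rightarrow> real" and p :: "'i \<Rightarrow> real" and b :: real
  assumes I: "finite I" and c: "\<And>i. i \<in> I \<Longrightarrow> 0 \<le> c i"
  defines "F \<equiv> \<lambda>x. b + (\<Sum>i\<in>I. if p i \<le> x then c i else 0)"
  shows "mono F" "continuous (at_right x) F" "b \<le> F x" "F x \<le> b + sum c I"
proof -
  show "mono F"
    unfolding F_def by (intro monoI add_left_mono sum_mono) (use c in auto)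
  have "((\<lambda>x. if p i \<le> x then c i else 0) \<longlongrightarrow> (if p i \<le> x then c i else 0)) (at_right x)" for i
  proof (rule tendsto_eventually)
    show "\<forall>\<^sub>F y in at_right x. (if p i \<le> y then c i else 0) = (if p i \<le> x then c i else 0)"
    proof (cases "p i \<le> x")
      case True
      then show ?thesis by (intro eventually_mono[OF eventually_at_right_less[of x]]) auto
    next
      case False
      then have "\<forall>\<^sub>F y in at_right x. y < p i"
        by (intro order_tendstoD(2)[OF tendsto_ident_at]) auto
      then show ?thesis by (rule eventually_mono) (use False in auto)
    qed
  qed
  then show "continuous (at_right x) F"
    unfolding F_def continuous_within by (intro tendsto_add tendsto_const tendsto_sum)
  show "b \<le> F x" unfolding F_def using c by (auto intro!: sum_nonneg)
  show "F x \<le> b + sum c I" unfolding F_def using c by (auto intro!: sum_mono)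
qed

lemma continuity_point_between:
  fixes F G :: "real \<Rightarrow> real"
  assumes "mono F" "mono G" "a < b"
  obtains x where "a < x" "x < b" "isCont F x" "isCont G x"
proof -
  have "\<not> {a<..<b} \<subseteq> {x. \<not> isCont F x} \<union> {x. \<not> isCont G x}"
    using mono_ctble_discont[OF assms(1)] mono_ctble_discont[OF assms(2)] uncountable_open_interval[of a b] assms(3)
    by (metis countable_Un countable_subset)
  then show thesis using that by auto
qed

text \<open>
  The total mass is only bounded by the increment of \<open>P\<close>, since \<open>P\<close> may jump at \<open>L\<close>.
\<close>

lemma cumulative_interval_measure:
  fixes P :: "real \<Rightarrow> real"
  assumes P: "mono P" "\<And>x. continuous (at_right x) P" and L: "L > 0"
  defines "\<mu> \<equiv> restrict_space (interval_measure P) {0<..<L}"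
  shows "finite_measure \<mu>" "sets \<mu> = sets (borel_ivl L)"
    and "measure \<mu> {0<..<L} \<le> P L - P 0"
    and "x \<in> {0<..<L} \<Longrightarrow> measure \<mu> ({0<..<L} \<inter> {..x}) = P x - P 0"
proof -
  have mono: "\<And>x y. x \<le> y \<Longrightarrow> P x \<le> P y" using P(1) by (simp add: monoD)
  have em: "emeasure (interval_measure P) {a<..b} = P b - P a" if "a \<le> b" for a b
    by (rule emeasure_interval_measure_Ioc[OF that mono P(2)])
  have res: "emeasure \<mu> A = emeasure (interval_measure P) A" if "A \<subseteq> {0<..<L}" for A
    unfolding \<mu>_def using that by (intro emeasure_restrict_space) auto
  have sp: "space \<mu> = {0<..<L}" by (simp add: \<mu>_def space_restrict_space)
  have "emeasure \<mu> {0<..<L} \<le> emeasure (interval_measure P) {0<..L}"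
    unfolding res[OF order_refl] by (rule emeasure_mono) auto
  also have "\<dots> = P L - P 0" using L by (intro em) simp
  finally have le: "emeasure \<mu> {0<..<L} \<le> ennreal (P L - P 0)" .
  then show fin: "finite_measure \<mu>" by (intro finite_measureI) (auto simp: sp top_unique)
  show "sets \<mu> = sets (borel_ivl L)" by (simp add: \<mu>_def sets_restrict_space)
  show "measure \<mu> {0<..<L} \<le> P L - P 0"
    using le mono[of 0 L] L by (simp add: finite_measure.emeasure_eq_measure[OF fin])
  assume x: "x \<in> {0<..<L}"
  then have "{0<..<L} \<inter> {..x} = {0<..x}" by auto
  moreover have "emeasure \<mu> {0<..x} = P x - P 0" using x by (subst res) (auto intro!: em)
  ultimately show "measure \<mu> ({0<..<L} \<inter> {..x}) = P x - P 0"
    using mono[of 0 x] x by (simp add: measure_def)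
qed

lemma real_sequence_cluster:
  fixes f :: "nat \<Rightarrow> real"
  assumes "\<And>j. a \<le> f j" "\<And>j. f j \<le> b"
  obtains s e where "strict_mono (s :: nat \<Rightarrow> nat)" "(\<lambda>j. f (s j)) \<longlonglongrightarrow> e"
proof -
  have "bounded (range f)" using assms by (intro boundedI[of _ "max \<bar>a\<bar> \<bar>b\<bar>"]) (auto simp: abs_le_iff le_max_iff_disj; smt (verit))
  then show thesis using that bounded_imp_convergent_subsequence[of f] by (auto simp: comp_def)
qed

lemma Helly_selection_pair:
  fixes P N :: "nat \<Rightarrow> real \<Rightarrow> real" and f :: "nat \<Rightarrow> real"
  assumes P: "\<And>j. mono (P j)" "\<And>j x. continuous (at_right x) (P j)" "\<And>j x. \<bar>P j x\<bar> \<le> K"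
    and N: "\<And>j. mono (N j)" "\<And>j x. continuous (at_right x) (N j)" "\<And>j x. \<bar>N j x\<bar> \<le> K"
    and f: "\<And>j. a \<le> f j" "\<And>j. f j \<le> b"
  obtains s P' N' e where "strict_mono (s :: nat \<Rightarrow> nat)" "(\<lambda>j. f (s j)) \<longlonglongrightarrow> e"
    "mono P'" "\<And>x. continuous (at_right x) P'" "\<And>x. isCont P' x \<Longrightarrow> (\<lambda>j. P (s j) x) \<longlonglongrightarrow> P' x"
    "mono N'" "\<And>x. continuous (at_right x) N'" "\<And>x. isCont N' x \<Longrightarrow> (\<lambda>j. N (s j) x) \<longlonglongrightarrow> N' x"
proof -
  obtain s1 P' where s1: "strict_mono s1" and P': "mono P'" "\<And>x. continuous (at_right x) P'"
    "\<And>x. isCont P' x \<Longrightarrow> (\<lambda>j. P (s1 j) x) \<longlonglongrightarrow> P' x"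
    using Helly_selection[of P K] P by metis
  obtain s2 N' where s2: "strict_mono s2" and N': "mono N'" "\<And>x. continuous (at_right x) N'"
    "\<And>x. isCont N' x \<Longrightarrow> (\<lambda>j. N (s1 (s2 j)) x) \<longlonglongrightarrow> N' x"
    using Helly_selection[of "\<lambda>j. N (s1 j)" K] N by metis
  obtain s3 e where s3: "strict_mono s3" "(\<lambda>j. f (s1 (s2 (s3 j)))) \<longlonglongrightarrow> e"
    using real_sequence_cluster[of a "\<lambda>j. f (s1 (s2 j))" b] f by metis
  show thesis
  proof (rule that[of "s1 \<circ> s2 \<circ> s3"])
    show "strict_mono (s1 \<circ> s2 \<circ> s3)" using s1 s2 s3(1) by (intro strict_mono_o)
    show "(\<lambda>j. P ((s1 \<circ> s2 \<circ> s3) j) x) \<longlonglongrightarrow> P' x" if "isCont P' x" for x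
      using LIMSEQ_subseq_LIMSEQ[OF P'(3)[OF that] strict_mono_o[OF s2 s3(1)]] by (simp add: comp_def)
    show "(\<lambda>j. N ((s1 \<circ> s2 \<circ> s3) j) x) \<longlonglongrightarrow> N' x" if "isCont N' x" for x
      using LIMSEQ_subseq_LIMSEQ[OF N'(3)[OF that] s3(1)] by (simp add: comp_def)
  qed (use s3 P' N' in auto)
qed

text \<open>
  The sum of the upward steps of the window means up to \<open>x\<close>; with \<open>- a\<close> in place of \<open>a\<close> it is the sum
  of the downward steps, so the two give the Jordan decomposition of the window means. The step from
  site \<open>i\<close> to site \<open>i + 1\<close> is placed at \<open>i / n\<^sup>2\<close>, which makes the function right-continuous, as
  Helly's theorem requires.
\<close>

definition pos_increments :: "nat \<Rightarrow> (nat \<Rightarrow> real) \<Rightarrow> nat \<Rightarrow> real \<Rightarrow> real" where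
  "pos_increments n a M x =
     (\<Sum>i\<in>{1..M - n}. if real i / (real n)\<^sup>2 \<le> x then max 0 (a (i + n) - a i) / real n else 0)"

lemma pos_increments_facts:
  shows "mono (\<lambda>x. b + pos_increments n a M x)" "continuous (at_right x) (\<lambda>x. b + pos_increments n a M x)"
    "0 \<le> pos_increments n a M x"
    "pos_increments n a M x \<le> (\<Sum>i\<in>{1..M - n}. max 0 (a (i + n) - a i) / real n)"
proof -
  note F = step_sum_facts[where I="{1..M - n}" and c="\<lambda>i. max 0 (a (i + n) - a i) / real n"
      and p="\<lambda>i. real i / (real n)\<^sup>2" and b=b]
  show "mono (\<lambda>x. b + pos_increments n a M x)" "continuous (at_right x) (\<lambda>x. b + pos_increments n a M x)"
    "0 \<le> pos_increments n a M x"
    "pos_increments n a M x \<le> (\<Sum>i\<in>{1..M - n}. max 0 (a (i + n) - a i) / real n)"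
    using F(1) F(2)[of x] F(3)[of x] F(4)[of x] by (simp_all add: pos_increments_def)
qed

lemma pos_increments_total:
  "(\<Sum>i\<in>{1..M - n}. max 0 (a (i + n) - a i) / real n) + (\<Sum>i\<in>{1..M - n}. max 0 (- a (i + n) + a i) / real n)
     = far_sum a n M / real n"
  unfolding far_sum_def sum.distrib[symmetric] sum_divide_distrib
  by (intro sum.cong refl) (auto simp: max_def add_divide_distrib[symmetric])

text \<open>
  Grid points are excluded, because there the cells, closed on the right, and the right-continuous
  increments disagree.
\<close>

lemma window_mean_eq_increments:
  assumes n: "n > 0" and i: "real i - 1 < (real n)\<^sup>2 * x" "(real n)\<^sup>2 * x < real i" "1 \<le> i" "i \<le> M - n + 1"
  shows "window_mean n a i = window_mean n a 1 + pos_increments n a M x - pos_increments n (\<lambda>i. - a i) M x"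
proof -
  have "pos_increments n a M x - pos_increments n (\<lambda>i. - a i) M x
    = (\<Sum>l\<in>{1..M - n}. if l \<in> {1..<i} then window_mean n a (Suc l) - window_mean n a l else 0)"
    unfolding pos_increments_def sum_subtractf[symmetric]
  proof (rule sum.cong[OF refl])
    fix l assume "l \<in> {1..M - n}"
    have "real l / (real n)\<^sup>2 \<le> x \<longleftrightarrow> real l \<le> (real n)\<^sup>2 * x" using n by (simp add: divide_le_eq mult.commute)
    also have "\<dots> \<longleftrightarrow> l < i" using i(1,2) by linarith
    finally have "real l / (real n)\<^sup>2 \<le> x \<longleftrightarrow> l \<in> {1..<i}" using \<open>l \<in> {1..M - n}\<close> by auto
    then show "(if real l / (real n)\<^sup>2 \<le> x then max 0 (a (l + n) - a l) / real n else 0)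
      - (if real l / (real n)\<^sup>2 \<le> x then max 0 (- a (l + n) - - a l) / real n else 0)
      = (if l \<in> {1..<i} then window_mean n a (Suc l) - window_mean n a l else 0)"
      unfolding window_mean_Suc by (auto simp: max_def diff_divide_distrib)
  qed
  also have "\<dots> = (\<Sum>l\<in>{1..<i}. window_mean n a (Suc l) - window_mean n a l)"
    using i(4) by (intro sum.mono_neutral_cong_right) auto
  also have "\<dots> = window_mean n a i - window_mean n a 1" using i(3) by (rule sum_Suc_diff')
  finally show ?thesis by simp
qed

text \<open>
  Taking window means is an averaging over a length \<open>1 / n\<close>, so it does not affect weak limits.
\<close>

lemma integral_window_mean_minus_cell:
  assumes n: "n > 0" and a: "\<And>i. a i \<in> {0, 1::real}" and t: "0 \<le> t" "t \<le> L"
  shows "\<bar>primitive L (cell_fun ((real n)\<^sup>2) (window_mean n a)) t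
      - primitive L (cell_fun ((real n)\<^sup>2) a) t\<bar> \<le> 3 / real n"
proof -
  let ?N = "(real n)\<^sup>2"
  define m where "m = nat \<lfloor>?N * t\<rfloor>"
  have N: "?N > 0" using n by simp
  have a': "a i \<in> {0..1}" for i using a[of i] by auto
  have 1: "\<bar>primitive L (cell_fun ?N (window_mean n a)) t - (\<Sum>i\<in>{1..m}. window_mean n a i) / ?N\<bar> \<le> 1 / ?N"
    unfolding m_def by (rule integral_cell_fun[OF N t]) (use window_mean_range[OF a'] in \<open>auto simp: abs_le_iff intro: order_trans[OF _ zero_le_one]\<close>)
  have 2: "\<bar>primitive L (cell_fun ?N a) t - (\<Sum>i\<in>{1..m}. a i) / ?N\<bar> \<le> 1 / ?N"
    unfolding m_def by (rule integral_cell_fun[OF N t]) (use a' in \<open>auto simp: abs_le_iff intro: order_trans[OF _ zero_le_one]\<close>)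
  have 3: "\<bar>(\<Sum>i\<in>{1..m}. window_mean n a i) / ?N - (\<Sum>i\<in>{1..m}. a i) / ?N\<bar> \<le> real n / ?N"
    unfolding diff_divide_distrib[symmetric] abs_divide using sum_window_mean[of a n m, OF a' n]
    by (simp add: divide_right_mono)
  have "1 / ?N \<le> real n / ?N" using n by (intro divide_right_mono) auto
  moreover have "real n / ?N = 1 / real n" using n by (simp add: power2_eq_square)
  ultimately show ?thesis using 1 2 3 by linarith
qed

lemma emeasure_mixed_eq:
  fixes u F :: "real \<Rightarrow> real"
  assumes um: "u \<in> borel_measurable (leb_on_ivl L)" and Fm: "F \<in> borel_measurable borel"
    and uF: "AE x in leb_on_ivl L. u x = F x"
  shows "emeasure lebesgue {x \<in> {0<..<L}. 0 < u x \<and> u x < 1} = ennreal (\<integral>x. of_bool (0 < F x \<and> F x < 1) \<partial>leb_on_ivl L)"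
proof -
  let ?\<Omega> = "leb_on_ivl L"
  interpret finite_measure ?\<Omega> by (rule finite_measure_leb_on_ivl)
  let ?U = "{x \<in> {0<..<L}. 0 < u x \<and> u x < 1}" and ?F = "{x \<in> space ?\<Omega>. 0 < F x \<and> F x < 1}"
  have Fs: "?F \<in> sets ?\<Omega>" using leb_on_ivl_borel[OF Fm, of L] by measurable
  have "{x \<in> space ?\<Omega>. 0 < u x \<and> u x < 1} \<in> sets ?\<Omega>" using um by measurable
  then have Us: "?U \<in> sets ?\<Omega>" by (simp add: space_restrict_space)
  have "emeasure lebesgue ?U = emeasure ?\<Omega> ?U"
    by (rule emeasure_restrict_space[symmetric]) auto
  also have "\<dots> = emeasure ?\<Omega> ?F"
  proof (rule emeasure_eq_AE[OF _ Us Fs])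
    show "AE x in ?\<Omega>. (x \<in> ?U) = (x \<in> ?F)"
      using uF by eventually_elim (auto simp: space_restrict_space)
  qed
  also have "\<dots> = ennreal (measure ?\<Omega> ?F)" by (rule emeasure_eq_measure)
  also have "measure ?\<Omega> ?F = (\<integral>x. indicator ?F x \<partial>?\<Omega>)"
  proof -
    have "?F \<inter> space ?\<Omega> = ?F" by blast
    then show ?thesis by (simp only: Bochner_Integration.integral_indicator)
  qed
  also have "\<dots> = (\<integral>x. of_bool (0 < F x \<and> F x < 1) \<partial>?\<Omega>)"
    by (rule Bochner_Integration.integral_cong) (auto simp: indicator_def)
  finally show ?thesis .
qed

text \<open>
  Sequences with energy at most \<open>C\<close> whose step functions converge weakly to \<open>u\<close>: along a subsequence
  the energy of the long bonds tends to some \<open>e\<close>, which bounds the total variation of \<open>u\<close>, and then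
  the short bonds, with energy at most \<open>C - e\<close> in the limit, bound the length of the mixed set.
\<close>

lemma energy_lower_bound:
  fixes L C :: real and n :: "nat \<Rightarrow> nat" and a :: "nat \<Rightarrow> nat \<Rightarrow> real"
  assumes L: "L > 0" and n: "\<And>j. n j \<ge> 2" "filterlim n at_top sequentially"
    and a: "\<And>j i. a j i \<in> {0, 1}"
    and energy: "\<And>j. helix_energy L (n j) (a j) \<le> C"
    and um: "u \<in> borel_measurable (leb_on_ivl L)" and ub: "AE x in leb_on_ivl L. \<bar>u x\<bar> \<le> K"
    and weak: "\<And>t. 0 \<le> t \<Longrightarrow> t \<le> L \<Longrightarrow> (\<lambda>j. primitive L (cell_fun ((real (n j))\<^sup>2) (a j)) t)
       \<longlonglongrightarrow> primitive L u t"
  shows "u \<in> BV L" and "AE x in leb_on_ivl L. 0 \<le> u x \<and> u x \<le> 1"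
    and "2 * emeasure lebesgue {x \<in> {0<..<L}. 0 < u x \<and> u x < 1} +
           total_variation (borel_ivl L) (distr_deriv L u) {0<..<L} \<le> ennreal C"
proof -
  let ?\<Omega> = "leb_on_ivl L"
  interpret finite_measure ?\<Omega> by (rule finite_measure_leb_on_ivl)
  define M where "M = (\<lambda>j. nsites L (n j))"
  define w where "w = (\<lambda>j. window_mean (n j) (a j))"
  define far where "far = (\<lambda>j. far_sum (a j) (n j) (M j) / real (n j))"
  define near where "near = (\<lambda>j. near_sum (a j) (M j) / real (n j))"
  have n0: "real (n j) > 0" for j using n(1)[of j] by simp
  have far0: "0 \<le> far j" for j unfolding far_def by (simp add: far_sum_nonneg)
  have near0: "0 \<le> near j" for j unfolding near_def by (simp add: near_sum_nonneg)
  have nf: "near j + far j \<le> C" for j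
    using energy[of j] by (simp add: near_def far_def M_def add_divide_distrib)
  have a': "a j i \<in> {0..1}" for j i using a[of j i] by auto
  have w01: "0 \<le> w j i" "w j i \<le> 1" for j i
    using window_mean_range[of "a j" "n j" i, OF a'] by (auto simp: w_def)
  \<comment> \<open>the mean of the first window is added to \<open>P\<close>, so that \<open>P - N\<close> is the window mean, off the grid points\<close>
  define P where "P = (\<lambda>j x. w j 1 + pos_increments (n j) (a j) (M j) x)"
  define N where "N = (\<lambda>j x. 0 + pos_increments (n j) (\<lambda>i. - a j i) (M j) x)"
  define cP where "cP = (\<lambda>j. \<Sum>i\<in>{1..M j - n j}. max 0 (a j (i + n j) - a j i) / real (n j))"
  define cN where "cN = (\<lambda>j. \<Sum>i\<in>{1..M j - n j}. max 0 (- a j (i + n j) + a j i) / real (n j))"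
  have cPN: "cP j + cN j = far j" for j
    unfolding cP_def cN_def far_def by (rule pos_increments_total)
  have P: "mono (P j)" "continuous (at_right x) (P j)" "w j 1 \<le> P j x" "P j x \<le> w j 1 + cP j" for j x
    unfolding P_def cP_def using pos_increments_facts by auto
  have N: "mono (N j)" "continuous (at_right x) (N j)" "0 \<le> N j x" "N j x \<le> cN j" for j x
    unfolding N_def cN_def using pos_increments_facts(1,2)[where b=0 and n="n j" and a="\<lambda>i. - a j i" and M="M j"]
      pos_increments_facts(3,4)[where n="n j" and a="\<lambda>i. - a j i" and M="M j"] by auto
  have c0: "0 \<le> cP j" "0 \<le> cN j" for j
    unfolding cP_def cN_def by (auto intro!: sum_nonneg)
  have PN_bd: "\<bar>P j x\<bar> \<le> 1 + C" "\<bar>N j x\<bar> \<le> 1 + C" for j x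
    using P(3,4)[of j x] N(3,4)[of j x] w01[of j 1] c0[of j] cPN[of j] nf[of j] near0[of j] by linarith+
  have farC: "far j \<le> C" for j using nf[of j] near0[of j] by linarith
  obtain s P' N' e where s: "strict_mono s" and e: "(\<lambda>j. far (s j)) \<longlonglongrightarrow> e"
    and P': "mono P'" "\<And>x. continuous (at_right x) P'" "\<And>x. isCont P' x \<Longrightarrow> (\<lambda>j. P (s j) x) \<longlonglongrightarrow> P' x"
    and N': "mono N'" "\<And>x. continuous (at_right x) N'" "\<And>x. isCont N' x \<Longrightarrow> (\<lambda>j. N (s j) x) \<longlonglongrightarrow> N' x"
    using Helly_selection_pair[of P "1 + C" N 0 far C, OF P(1,2) PN_bd(1) N(1,2) PN_bd(2) far0 farC] by metis
  define F where "F = (\<lambda>x. P' x - N' x)"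
  have Fm: "F \<in> borel_measurable borel"
    unfolding F_def using P'(1) N'(1) by (intro borel_measurable_diff borel_measurable_mono)
  have ns: "filterlim (\<lambda>j. n (s j)) at_top sequentially"
    using filterlim_compose[OF n(2) filterlim_subseq[OF s]] .
  have Ns: "filterlim (\<lambda>j. real (n (s j))) at_top sequentially"
    by (rule filterlim_compose[OF filterlim_real_sequentially ns])
  define W where "W = (\<lambda>j. cell_fun ((real (n (s j)))\<^sup>2) (w (s j)))"
  \<comment> \<open>the rational numbers contain all grid points\<close>
  define D where "D = {x. \<not> isCont P' x} \<union> {x. \<not> isCont N' x} \<union> \<rat>"
  have D: "AE x in ?\<Omega>. x \<notin> D"
    unfolding D_def by (intro AE_leb_on_ivl_countable countable_Un mono_ctble_discont P' N' countable_rat)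
  have inside: "\<forall>\<^sub>F j in sequentially. nat \<lceil>(real (n (s j)))\<^sup>2 * x\<rceil> \<in> {1..M (s j) - n (s j)}"
    if x: "x \<in> {0<..<L}" for x
  proof -
    have "\<forall>\<^sub>F j in sequentially. real (n (s j)) \<ge> 1 \<and> real (n (s j)) \<ge> 3 / (L - x)"
      using Ns unfolding filterlim_at_top by (intro eventually_conj) blast+
    then show ?thesis
    proof eventually_elim
      case (elim j)
      let ?n = "real (n (s j))"
      have "3 \<le> ?n * (L - x)" using elim x by (simp add: divide_le_eq)
      then have "3 * ?n \<le> ?n * (L - x) * ?n" using elim by (intro mult_right_mono) auto
      then have 1: "?n\<^sup>2 * x + 3 * ?n \<le> L * ?n\<^sup>2" by (simp add: power2_eq_square algebra_simps)
      have 2: "0 < ?n\<^sup>2 * x" using elim x by simp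
      define z where "z = \<lceil>?n\<^sup>2 * x\<rceil>"
      have z: "0 < z" "real_of_int z < ?n\<^sup>2 * x + 1" using 2 unfolding z_def by linarith+
      define y where "y = \<lfloor>L * ?n\<^sup>2\<rfloor>"
      have y: "L * ?n\<^sup>2 < real_of_int y + 1" unfolding y_def by linarith
      have "real_of_int z + ?n < real_of_int y + 1" using z(2) y 1 elim by linarith
      then have "z + int (n (s j)) \<le> y" by linarith
      then have "nat z \<le> nat y - n (s j)" using z(1) by linarith
      moreover have "1 \<le> nat z" using z(1) by linarith
      ultimately have "nat z \<in> {1..nat y - n (s j)}" unfolding atLeastAtMost_iff by blast
      then show ?case unfolding M_def z_def y_def .
    qed
  qed
  have conv: "(\<lambda>j. W j x) \<longlonglongrightarrow> F x" if x: "x \<in> {0<..<L}" "x \<notin> D" for x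
  proof -
    have "(\<lambda>j. P (s j) x - N (s j) x) \<longlonglongrightarrow> F x"
      unfolding F_def by (intro tendsto_diff P'(3) N'(3)) (use x in \<open>auto simp: D_def\<close>)
    moreover have "\<forall>\<^sub>F j in sequentially. P (s j) x - N (s j) x = W j x"
      using inside[OF x(1)]
    proof eventually_elim
      case (elim j)
      let ?n = "n (s j)"
      define i where "i = nat \<lceil>(real ?n)\<^sup>2 * x\<rceil>"
      have pos: "(real ?n)\<^sup>2 * x > 0" using x n0[of "s j"] by simp
      have "(real ?n)\<^sup>2 * x \<noteq> real i"
      proof
        assume "(real ?n)\<^sup>2 * x = real i"
        then have "x = real i / (real ?n)\<^sup>2" using n0[of "s j"] by (simp add: field_simps)
        then have "x \<in> \<rat>" by simp
        then show False using x by (simp add: D_def)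
      qed
      then have "real i - 1 < (real ?n)\<^sup>2 * x" "(real ?n)\<^sup>2 * x < real i"
        using pos unfolding i_def by linarith+
      then have "window_mean ?n (a (s j)) i = w (s j) 1 + pos_increments ?n (a (s j)) (M (s j)) x
          - pos_increments ?n (\<lambda>i. - a (s j) i) (M (s j)) x"
        unfolding w_def by (intro window_mean_eq_increments) (use elim n0[of "s j"] in \<open>auto simp: i_def\<close>)
      then show ?case by (simp add: W_def cell_fun_def P_def N_def w_def i_def)
    qed
    ultimately show ?thesis by (rule Lim_transform_eventually)
  qed
  have AEconv: "AE x in ?\<Omega>. x \<in> {0<..<L} \<and> x \<notin> D \<and> (\<lambda>j. W j x) \<longlonglongrightarrow> F x"
    using D AE_space by eventually_elim (auto simp: space_restrict_space intro: conv)
  have Wm: "W j \<in> borel_measurable ?\<Omega>" for j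
    unfolding W_def by (intro leb_on_ivl_borel cell_fun_measurable)
  have W01: "0 \<le> W j x" "W j x \<le> 1" for j x by (simp_all add: W_def cell_fun_def w01)
  have F01: "AE x in ?\<Omega>. 0 \<le> F x \<and> F x \<le> 1"
    using AEconv by eventually_elim (use W01 in \<open>auto intro: LIMSEQ_le_const LIMSEQ_le_const2\<close>)
  have uF: "AE x in ?\<Omega>. u x - F x = 0"
  proof (rule AE_zero_of_primitives[OF _ _ L])
    show "(\<lambda>x. u x - F x) \<in> borel_measurable ?\<Omega>"
      by (intro borel_measurable_diff um leb_on_ivl_borel Fm)
    show "AE x in ?\<Omega>. \<bar>u x - F x\<bar> \<le> K + 1" using ub F01 by eventually_elim linarith
    fix t :: real assume t: "0 \<le> t" "t \<le> L"
    let ?i = "indicator {..<t} :: real \<Rightarrow> real"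
    have im: "?i \<in> borel_measurable ?\<Omega>" by (rule indicator_leb_measurable) simp
    have lim1: "(\<lambda>j. \<integral>x. W j x * ?i x \<partial>?\<Omega>) \<longlonglongrightarrow> (\<integral>x. F x * ?i x \<partial>?\<Omega>)"
    proof (rule integral_dominated_convergence[where w="\<lambda>_. 1"])
      show "(\<lambda>x. F x * ?i x) \<in> borel_measurable ?\<Omega>" by (intro borel_measurable_times im leb_on_ivl_borel Fm)
      show "(\<lambda>x. W j x * ?i x) \<in> borel_measurable ?\<Omega>" for j by (intro borel_measurable_times im Wm)
      show "AE x in ?\<Omega>. (\<lambda>j. W j x * ?i x) \<longlonglongrightarrow> F x * ?i x"
        using AEconv by eventually_elim (auto intro: tendsto_mult_right)
      show "AE x in ?\<Omega>. norm (W j x * ?i x) \<le> 1" for j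
        using W01[of j] by (intro AE_I2) (auto simp: indicator_def)
    qed simp
    have lim2: "(\<lambda>j. (\<integral>x. W j x * ?i x \<partial>?\<Omega>) - (\<integral>x. cell_fun ((real (n (s j)))\<^sup>2) (a (s j)) x * ?i x \<partial>?\<Omega>)) \<longlonglongrightarrow> 0"
    proof (rule Lim_null_comparison)
      show "\<forall>\<^sub>F j in sequentially. norm ((\<integral>x. W j x * ?i x \<partial>?\<Omega>) - (\<integral>x. cell_fun ((real (n (s j)))\<^sup>2) (a (s j)) x * ?i x \<partial>?\<Omega>)) \<le> 3 / real (n (s j))"
        unfolding W_def w_def real_norm_def
        by (intro always_eventually allI integral_window_mean_minus_cell a t) (use n0 in simp)
      show "(\<lambda>j. 3 / real (n (s j))) \<longlonglongrightarrow> 0" by (rule tendsto_divide_0[OF tendsto_const filterlim_at_top_imp_at_infinity[OF Ns]])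
    qed
    have lim3: "(\<lambda>j. \<integral>x. cell_fun ((real (n (s j)))\<^sup>2) (a (s j)) x * ?i x \<partial>?\<Omega>) \<longlonglongrightarrow> (\<integral>x. u x * ?i x \<partial>?\<Omega>)"
      using LIMSEQ_subseq_LIMSEQ[OF weak[OF t] s] by (simp add: comp_def)
    have "(\<integral>x. F x * ?i x \<partial>?\<Omega>) = (\<integral>x. u x * ?i x \<partial>?\<Omega>)"
      using LIMSEQ_unique[OF tendsto_diff[OF lim1 lim2]] lim3 by simp
    moreover have "(\<integral>x. (u x - F x) * ?i x \<partial>?\<Omega>) = (\<integral>x. u x * ?i x \<partial>?\<Omega>) - (\<integral>x. F x * ?i x \<partial>?\<Omega>)"
    proof -
      have ii: "integrable ?\<Omega> ?i" by (rule integrable_indicator_leb) simp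
      have "integrable ?\<Omega> (\<lambda>x. u x * ?i x)" by (rule integrable_bounded_mult[OF um ub ii])
      moreover have "integrable ?\<Omega> (\<lambda>x. F x * ?i x)"
        by (rule integrable_bounded_mult[OF leb_on_ivl_borel[OF Fm] _ ii, where K=1]) (use F01 in \<open>eventually_elim, simp\<close>)
      ultimately show ?thesis by (simp add: left_diff_distrib)
    qed
    ultimately show "(\<integral>x. (u x - F x) * ?i x \<partial>?\<Omega>) = 0" by simp
  qed
  show "AE x in ?\<Omega>. 0 \<le> u x \<and> u x \<le> 1" using uF F01 by eventually_elim simp
  \<comment> \<open>compare with continuity points outside \<open>[0, L]\<close>, where the increments converge\<close>
  have incr: "(P' L - P' 0) + (N' L - N' 0) \<le> e"
  proof -
    obtain x where x: "L < x" "isCont P' x" "isCont N' x"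
      using continuity_point_between[OF P'(1) N'(1), of L "L + 1"] by auto
    obtain y where y: "y < 0" "isCont P' y" "isCont N' y"
      using continuity_point_between[OF P'(1) N'(1), of "-1" 0] by auto
    have "(P' L - P' 0) + (N' L - N' 0) \<le> (P' x - P' y) + (N' x - N' y)"
      using monoD[OF P'(1), of L x] monoD[OF P'(1), of y 0] monoD[OF N'(1), of L x] monoD[OF N'(1), of y 0] x y by simp
    also have "\<dots> \<le> e"
    proof (rule LIMSEQ_le[OF _ e])
      show "(\<lambda>j. (P (s j) x - P (s j) y) + (N (s j) x - N (s j) y)) \<longlonglongrightarrow> (P' x - P' y) + (N' x - N' y)"
        by (intro tendsto_add tendsto_diff P'(3) N'(3) x y)
      show "\<exists>N0. \<forall>j\<ge>N0. (P (s j) x - P (s j) y) + (N (s j) x - N (s j) y) \<le> far (s j)"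
        using P(3)[of "s _" y] P(4)[of "s _" x] N(3)[of "s _" y] N(4)[of "s _" x] cPN[of "s _"]
        by (intro exI allI impI) (smt (verit))
    qed
    finally show ?thesis .
  qed
  define \<mu> where "\<mu> = restrict_space (interval_measure P') {0<..<L}"
  define \<nu> where "\<nu> = restrict_space (interval_measure N') {0<..<L}"
  note mu = cumulative_interval_measure[OF P'(1,2) L, folded \<mu>_def]
  note nu = cumulative_interval_measure[OF N'(1,2) L, folded \<nu>_def]
  have rep: "AE x in ?\<Omega>. u x = (P' 0 - N' 0) + measure \<mu> ({0<..<L} \<inter> {..x}) - measure \<nu> ({0<..<L} \<inter> {..x})"
    using uF AEconv
  proof eventually_elim
    case (elim x)
    then show ?case using mu(4)[of x] nu(4)[of x] by (simp add: F_def)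
  qed
  have ui: "integrable ?\<Omega> u" by (rule integrable_bounded_leb[OF um ub])
  note TV = total_variation_le[OF mu(1,2) nu(1,2) um ui rep]
  show "u \<in> BV L" by (rule TV(1))
  have TVe: "total_variation (borel_ivl L) (distr_deriv L u) {0<..<L} \<le> ennreal e"
    by (rule order_trans[OF TV(2)]) (use mu(3) nu(3) incr in \<open>intro ennreal_leI, linarith\<close>)
  define g where "g = (\<lambda>x. of_bool (0 < F x \<and> F x < 1) :: real)"
  have gm: "g \<in> borel_measurable borel"
  proof -
    have "g = (\<lambda>x. indicator {0<..<1} (F x))" by (auto simp: g_def indicator_def)
    moreover have "(\<lambda>x. indicator {0<..<1} (F x) :: real) \<in> borel_measurable borel"
      by (rule measurable_compose[OF Fm]) simp
    ultimately show ?thesis by (simp only:)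
  qed
  \<comment> \<open>marks the windows that lie in the chain and are mixed\<close>
  define b where "b = (\<lambda>j i. of_bool (i \<in> {1..M (s j) - n (s j)} \<and> w (s j) i \<notin> {0, 1}) :: real)"
  have gb: "(\<lambda>j. \<integral>x. g x * cell_fun ((real (n (s j)))\<^sup>2) (b j) x \<partial>?\<Omega>) \<longlonglongrightarrow> (\<integral>x. g x \<partial>?\<Omega>)"
  proof (rule integral_dominated_convergence[where w="\<lambda>_. 1"])
    show "g \<in> borel_measurable ?\<Omega>" by (rule leb_on_ivl_borel[OF gm])
    show "(\<lambda>x. g x * cell_fun ((real (n (s j)))\<^sup>2) (b j) x) \<in> borel_measurable ?\<Omega>" for j
      by (intro leb_on_ivl_borel borel_measurable_times gm cell_fun_measurable)
    show "AE x in ?\<Omega>. (\<lambda>j. g x * cell_fun ((real (n (s j)))\<^sup>2) (b j) x) \<longlonglongrightarrow> g x"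
      using AEconv
    proof eventually_elim
      case (elim x)
      show ?case
      proof (cases "0 < F x \<and> F x < 1")
        case True
        have "\<forall>\<^sub>F j in sequentially. 0 < W j x" "\<forall>\<^sub>F j in sequentially. W j x < 1"
          using order_tendstoD[OF conjunct2[OF conjunct2[OF elim]]] True by auto
        moreover have "\<forall>\<^sub>F j in sequentially. nat \<lceil>(real (n (s j)))\<^sup>2 * x\<rceil> \<in> {1..M (s j) - n (s j)}"
          using inside elim by blast
        ultimately have "\<forall>\<^sub>F j in sequentially. g x * cell_fun ((real (n (s j)))\<^sup>2) (b j) x = g x"
          by eventually_elim (simp add: b_def cell_fun_def W_def)
        then show ?thesis by (rule tendsto_eventually)
      next
        case False
        then show ?thesis by (auto simp: g_def)
      qed
    qed
  qed (auto simp: g_def b_def cell_fun_def)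
  have "2 * (\<integral>x. g x \<partial>?\<Omega>) \<le> C - e"
  proof (rule LIMSEQ_le)
    show "(\<lambda>j. 2 * (\<integral>x. g x * cell_fun ((real (n (s j)))\<^sup>2) (b j) x \<partial>?\<Omega>)) \<longlonglongrightarrow> 2 * (\<integral>x. g x \<partial>?\<Omega>)"
      by (intro tendsto_mult_left gb)
    have z: "(\<lambda>j. (2 * C + 2) / real (n (s j))) \<longlonglongrightarrow> 0"
      by (rule tendsto_divide_0[OF tendsto_const filterlim_at_top_imp_at_infinity[OF Ns]])
    show "(\<lambda>j. C - far (s j) + (2 * C + 2) / real (n (s j))) \<longlonglongrightarrow> C - e"
      using tendsto_add[OF tendsto_diff[OF tendsto_const[of C] e] z] by simp
    show "\<exists>N0. \<forall>j\<ge>N0. 2 * (\<integral>x. g x * cell_fun ((real (n (s j)))\<^sup>2) (b j) x \<partial>?\<Omega>)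
        \<le> C - far (s j) + (2 * C + 2) / real (n (s j))"
    proof (intro exI allI impI)
      fix j
      let ?n = "n (s j)" and ?M = "M (s j)" and ?a = "a (s j)"
      let ?N = "(real ?n)\<^sup>2"
      have npos: "real ?n > 0" "real ?n \<ge> 1" using n(1)[of "s j"] by auto
      have "(\<integral>x. g x * cell_fun ?N (b j) x \<partial>?\<Omega>) \<le> (\<integral>x. cell_fun ?N (b j) x * indicator {..<L} x \<partial>?\<Omega>)"
      proof (rule integral_mono)
        show "integrable ?\<Omega> (\<lambda>x. g x * cell_fun ?N (b j) x)"
        proof (rule integrable_bounded_leb[where C=1])
          show "(\<lambda>x. g x * cell_fun ?N (b j) x) \<in> borel_measurable ?\<Omega>"
            by (intro leb_on_ivl_borel borel_measurable_times gm cell_fun_measurable)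
        qed (auto simp: g_def b_def cell_fun_def)
        show "integrable ?\<Omega> (\<lambda>x. cell_fun ?N (b j) x * indicator {..<L} x)"
          by (rule integrable_bounded_leb[where C=1])
            (auto intro!: leb_on_ivl_borel borel_measurable_times cell_fun_measurable simp: b_def cell_fun_def indicator_def)
      qed (auto simp: g_def b_def cell_fun_def space_restrict_space)
      also have "\<dots> \<le> (\<Sum>i\<in>{1..nat \<lfloor>?N * L\<rfloor>}. b j i) / ?N + 1 / ?N"
        using integral_cell_fun[of ?N L L "b j" 1] npos L by (auto simp: b_def abs_le_iff)
      also have "(\<Sum>i\<in>{1..nat \<lfloor>?N * L\<rfloor>}. b j i) = real (card {i \<in> {1..?M - ?n}. w (s j) i \<notin> {0, 1}})"
      proof -
        have "(\<Sum>i\<in>{1..nat \<lfloor>?N * L\<rfloor>}. b j i) = (\<Sum>i\<in>{i \<in> {1..?M - ?n}. w (s j) i \<notin> {0, 1}}. 1)"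
          by (rule sum.mono_neutral_cong_right) (auto simp: b_def M_def mult.commute)
        then show ?thesis by simp
      qed
      finally have 1: "2 * (\<integral>x. g x * cell_fun ?N (b j) x \<partial>?\<Omega>)
          \<le> (2 * real (card {i \<in> {1..?M - ?n}. w (s j) i \<notin> {0, 1}}) + 2) / ?N"
        by (simp add: add_divide_distrib)
      also have "\<dots> \<le> (real ?n * near_sum ?a ?M + 2 * far_sum ?a ?n ?M + 2) / ?N"
        using mixed_windows_le_near_sum[of ?a ?M ?n, OF a] unfolding w_def by (intro divide_right_mono) auto
      also have "\<dots> = near (s j) + (2 * far (s j) + 2 / real ?n) / real ?n"
        using npos by (simp add: near_def far_def power2_eq_square field_simps)
      also have "\<dots> \<le> (C - far (s j)) + (2 * C + 2) / real ?n"
      proof (rule add_mono)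
        show "near (s j) \<le> C - far (s j)" using nf[of "s j"] by linarith
        have "2 / real ?n \<le> 2" using npos by (simp add: divide_le_eq)
        then show "(2 * far (s j) + 2 / real ?n) / real ?n \<le> (2 * C + 2) / real ?n"
          using farC[of "s j"] npos by (intro divide_right_mono) auto
      qed
      finally show "2 * (\<integral>x. g x * cell_fun ?N (b j) x \<partial>?\<Omega>) \<le> C - far (s j) + (2 * C + 2) / real ?n" .
    qed
  qed
  moreover have "emeasure lebesgue {x \<in> {0<..<L}. 0 < u x \<and> u x < 1} = ennreal (\<integral>x. g x \<partial>?\<Omega>)"
    unfolding g_def by (rule emeasure_mixed_eq[OF um Fm]) (use uF in simp)
  moreover have "0 \<le> (\<integral>x. g x \<partial>?\<Omega>)" by (rule integral_nonneg_AE) (simp add: g_def)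
  moreover have "0 \<le> e" by (rule LIMSEQ_le_const[OF e]) (use far0 in auto)
  ultimately show "2 * emeasure lebesgue {x \<in> {0<..<L}. 0 < u x \<and> u x < 1} +
           total_variation (borel_ivl L) (distr_deriv L u) {0<..<L} \<le> ennreal C"
  proof -
    assume a: "2 * (\<integral>x. g x \<partial>?\<Omega>) \<le> C - e" "emeasure lebesgue {x \<in> {0<..<L}. 0 < u x \<and> u x < 1} = ennreal (\<integral>x. g x \<partial>?\<Omega>)"
      "0 \<le> (\<integral>x. g x \<partial>?\<Omega>)" "0 \<le> e"
    have "2 * emeasure lebesgue {x \<in> {0<..<L}. 0 < u x \<and> u x < 1} + total_variation (borel_ivl L) (distr_deriv L u) {0<..<L}
      \<le> ennreal (2 * (\<integral>x. g x \<partial>?\<Omega>)) + ennreal e"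
      unfolding a(2) using TVe a(3) by (intro add_mono) (simp_all add: ennreal_mult)
    also have "\<dots> = ennreal (2 * (\<integral>x. g x \<partial>?\<Omega>) + e)" using a(3,4) by (simp add: ennreal_plus)
    also have "\<dots> \<le> ennreal C" using a(1) by (intro ennreal_leI) linarith
    finally show ?thesis .
  qed
qed

section \<open>Rows filled from the left\<close>

text \<open>
  Row \<open>r\<close> carries ones in its first \<open>h r\<close> columns. Sites are numbered from \<open>1\<close>, so that site \<open>i\<close> lies
  in row \<open>(i - 1) div n\<close> and column \<open>(i - 1) mod n\<close>.
\<close>

definition row_fun :: "nat \<Rightarrow> (nat \<Rightarrow> nat) \<Rightarrow> nat \<Rightarrow> real" where
  "row_fun n h i = of_bool (i > 0 \<and> (i - 1) mod n < h ((i - 1) div n))"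

lemma row_fun_values: "row_fun n h i \<in> {0, 1}"
  by (auto simp: row_fun_def)

lemma row_fun_at:
  assumes "c < n"
  shows "row_fun n h (Suc (r * n + c)) = of_bool (c < h r)"
  using assms by (simp add: row_fun_def)

lemma sum_by_rows:
  fixes f :: "nat \<Rightarrow> 'b :: comm_monoid_add"
  shows "(\<Sum>i\<in>{1..R * n}. f i) = (\<Sum>r<R. \<Sum>c<n. f (Suc (r * n + c)))"
proof -
  have "(\<Sum>i\<in>{1..R * n}. f i) = (\<Sum>j<R * n. f (Suc j))"
    by (rule sum.reindex_bij_witness[of _ Suc "\<lambda>i. i - 1"]) auto
  also have "\<dots> = (\<Sum>r<R. \<Sum>j\<in>{r * n..<r * n + n}. f (Suc j))"
    by (rule sum.nat_group[symmetric])
  also have "\<dots> = (\<Sum>r<R. \<Sum>c<n. f (Suc (r * n + c)))"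
  proof (rule sum.cong[OF refl])
    show "(\<Sum>j\<in>{r * n..<r * n + n}. f (Suc j)) = (\<Sum>c<n. f (Suc (r * n + c)))" for r
      by (rule sum.reindex_bij_witness[of _ "\<lambda>c. r * n + c" "\<lambda>j. j - r * n"]) auto
  qed
  finally show ?thesis .
qed

lemma sum_of_bool_less:
  assumes "h \<le> (n::nat)"
  shows "(\<Sum>c<n. of_bool (c < h) :: real) = real h"
proof -
  have "(\<Sum>c<n. of_bool (c < h) :: real) = (\<Sum>c<h. 1)"
    using assms by (intro sum.mono_neutral_cong_right) auto
  then show ?thesis by simp
qed

lemma sum_row_fun:
  assumes "\<And>r. h r \<le> n"
  shows "(\<Sum>i\<in>{1..R * n}. row_fun n h i) = (\<Sum>r<R. real (h r))"
  unfolding sum_by_rows by (simp add: row_fun_at sum_of_bool_less[OF assms])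

text \<open>
  Two rows filled from the left differ exactly in the columns between their heights.
\<close>

lemma far_sum_row_fun_le:
  assumes n: "n > 0" and h: "\<And>r. h r \<le> n"
  shows "far_sum (row_fun n h) n M \<le> (\<Sum>r<M div n. \<bar>real (h (Suc r)) - real (h r)\<bar>)"
proof -
  have "M - n \<le> (M div n) * n"
    using div_mult_mod_eq[of M n] mod_less_divisor[OF n, of M] by linarith
  then have "far_sum (row_fun n h) n M \<le> (\<Sum>i\<in>{1..(M div n) * n}. \<bar>row_fun n h (i + n) - row_fun n h i\<bar>)"
    unfolding far_sum_def by (intro sum_mono2) auto
  also have "\<dots> = (\<Sum>r<M div n. \<Sum>c<n. \<bar>of_bool (c < h (Suc r)) - of_bool (c < h r)\<bar>)"
    unfolding sum_by_rows
  proof (intro sum.cong refl)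
    fix r c assume "c \<in> {..<n}"
    then show "\<bar>row_fun n h (Suc (r * n + c) + n) - row_fun n h (Suc (r * n + c))\<bar> = \<bar>of_bool (c < h (Suc r)) - of_bool (c < h r)\<bar>"
      using row_fun_at[of c n h r] row_fun_at[of c n h "Suc r"] by (simp add: ac_simps)
  qed
  also have "\<dots> \<le> (\<Sum>r<M div n. \<bar>real (h (Suc r)) - real (h r)\<bar>)"
  proof (rule sum_mono)
    fix r
    show "(\<Sum>c<n. \<bar>of_bool (c < h (Suc r)) - of_bool (c < h r)\<bar>) \<le> \<bar>real (h (Suc r)) - real (h r)\<bar>"
    proof (cases "h r \<le> h (Suc r)")
      case True
      then have "(\<Sum>c<n. \<bar>of_bool (c < h (Suc r)) - of_bool (c < h r)\<bar>) = (\<Sum>c<n. of_bool (c < h (Suc r)) - of_bool (c < h r) :: real)"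
        by (intro sum.cong refl) auto
      then show ?thesis using True by (simp add: sum_subtractf sum_of_bool_less[OF h])
    next
      case False
      then have "(\<Sum>c<n. \<bar>of_bool (c < h (Suc r)) - of_bool (c < h r)\<bar>) = (\<Sum>c<n. of_bool (c < h r) - of_bool (c < h (Suc r)) :: real)"
        by (intro sum.cong refl) auto
      then show ?thesis using False by (simp add: sum_subtractf sum_of_bool_less[OF h])
    qed
  qed
  finally show ?thesis .
qed

text \<open>
  A mixed row has one jump inside and at most one at its end. A pure row has none inside, and the next
  row starts with the same value if it has the same height.
\<close>

lemma near_sum_row_fun_le:
  assumes n: "n > 0" and h: "\<And>r. h r \<le> n"
  shows "near_sum (row_fun n h) M \<le>
    (\<Sum>r<Suc (M div n). 2 * of_bool (0 < h r \<and> h r < n) + of_bool (h (Suc r) \<noteq> h r))"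
proof -
  let ?a = "row_fun n h"
  obtain n' where n': "n = Suc n'" using n by (cases n) auto
  have "M \<le> Suc (M div n) * n"
    using div_mult_mod_eq[of M n] mod_less_divisor[OF n, of M] by (simp only: mult_Suc)
  then have "near_sum ?a M \<le> (\<Sum>i\<in>{1..Suc (M div n) * n}. \<bar>?a (Suc i) - ?a i\<bar>)"
    unfolding near_sum_def by (intro sum_mono2) auto
  also have "\<dots> = (\<Sum>r<Suc (M div n). \<Sum>c<n. \<bar>?a (Suc (Suc (r * n + c))) - ?a (Suc (r * n + c))\<bar>)"
    by (rule sum_by_rows)
  also have "\<dots> \<le> (\<Sum>r<Suc (M div n). 2 * of_bool (0 < h r \<and> h r < n) + of_bool (h (Suc r) \<noteq> h r))"
  proof (rule sum_mono)
    fix r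
    have "(\<Sum>c<n'. \<bar>?a (Suc (Suc (r * n + c))) - ?a (Suc (r * n + c))\<bar>)
        = (\<Sum>c<n'. of_bool (c < h r) - of_bool (Suc c < h r) :: real)"
    proof (rule sum.cong[OF refl])
      fix c assume "c \<in> {..<n'}"
      then show "\<bar>?a (Suc (Suc (r * n + c))) - ?a (Suc (r * n + c))\<bar> = of_bool (c < h r) - of_bool (Suc c < h r)"
        using row_fun_at[of c n h r] row_fun_at[of "Suc c" n h r] n' by simp
    qed
    also have "\<dots> = of_bool (0 < h r) - of_bool (n' < h r)"
      by (rule sum_lessThan_telescope')
    also have "\<dots> = of_bool (0 < h r \<and> h r < n)" using h[of r] n' by auto
    finally have inner: "(\<Sum>c<n'. \<bar>?a (Suc (Suc (r * n + c))) - ?a (Suc (r * n + c))\<bar>) = of_bool (0 < h r \<and> h r < n)" .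
    have "?a (Suc (Suc (r * n + n'))) = of_bool (0 < h (Suc r))" "?a (Suc (r * n + n')) = of_bool (n' < h r)"
      using row_fun_at[of 0 n h "Suc r"] row_fun_at[of n' n h r] n n' by (simp_all add: ac_simps)
    then have "\<bar>?a (Suc (Suc (r * n + n'))) - ?a (Suc (r * n + n'))\<bar> \<le> of_bool (0 < h r \<and> h r < n) + of_bool (h (Suc r) \<noteq> h r)"
      using h[of r] n' by auto
    then show "(\<Sum>c<n. \<bar>?a (Suc (Suc (r * n + c))) - ?a (Suc (r * n + c))\<bar>)
       \<le> 2 * of_bool (0 < h r \<and> h r < n) + of_bool (h (Suc r) \<noteq> h r)"
      using inner n' by simp
  qed
  finally show ?thesis .
qed

lemma indicator_interval_variation:
  "(\<Sum>r<Q. \<bar>indicator {s..<t} (Suc r) - indicator {s..<t} r :: real\<bar>) \<le> 2"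
proof -
  have "\<bar>indicator {s..<t} (Suc r) - indicator {s..<t} r :: real\<bar> \<le> of_bool (Suc r = s) + of_bool (Suc r = t)" for r
    by (auto simp: indicator_def)
  then have "(\<Sum>r<Q. \<bar>indicator {s..<t} (Suc r) - indicator {s..<t} r :: real\<bar>)
     \<le> (\<Sum>r<Q. of_bool (Suc r = s)) + (\<Sum>r<Q. of_bool (Suc r = t))"
    unfolding sum.distrib[symmetric] by (rule sum_mono)
  also have one: "(\<Sum>r<Q. of_bool (Suc r = x) :: real) \<le> 1" for x
  proof -
    have "(\<Sum>r<Q. of_bool (Suc r = x) :: real) \<le> (\<Sum>r<Q. if r = x - 1 then 1 else 0)"
      by (rule sum_mono) auto
    also have "\<dots> \<le> 1" by simp
    finally show ?thesis .
  qed
  note add_mono[OF one one]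
  finally show ?thesis by simp
qed

lemma block_boundaries:
  assumes "B > 0"
  shows "(\<Sum>r<Q. of_bool (Suc r div B \<noteq> r div B) :: real) \<le> real Q / real B"
proof -
  have "of_bool (Suc r div B \<noteq> r div B) = real (Suc r div B) - real (r div B)" for r
    by (auto simp: div_Suc)
  then have "(\<Sum>r<Q. of_bool (Suc r div B \<noteq> r div B) :: real) = (\<Sum>r<Q. real (Suc r div B) - real (r div B))"
    by simp
  also have "\<dots> = real (Q div B)" using sum_lessThan_telescope[of "\<lambda>r. real (r div B)" Q] by simp
  also have "\<dots> \<le> real Q / real B" by (rule of_nat_div_le_of_nat)
  finally show ?thesis .
qed

lemma integral_row_fun:
  assumes n: "n > 0" and h: "\<And>r. h r \<le> n" and t: "0 \<le> t" "t \<le> L"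
  shows "\<bar>density n (row_fun n h) t
    - primitive L (cell_fun (real n) (\<lambda>i. real (h (i - 1)) / real n)) t\<bar> \<le> 2 / real n"
proof -
  define m where "m = nat \<lfloor>(real n)\<^sup>2 * t\<rfloor>"
  define q where "q = nat \<lfloor>real n * t\<rfloor>"
  have q: "real q \<le> real n * t" "real n * t < real q + 1" using t by (auto simp: q_def)
  have m: "real m \<le> (real n)\<^sup>2 * t" "(real n)\<^sup>2 * t < real m + 1" using t by (auto simp: m_def)
  have "real q * real n \<le> real n * t * real n" "real n * t * real n < (real q + 1) * real n"
    using mult_right_mono[OF q(1), of "real n"] mult_strict_right_mono[OF q(2), of "real n"] n by simp_all
  then have "real q * real n \<le> (real n)\<^sup>2 * t" "(real n)\<^sup>2 * t \<le> real q * real n + real n"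
    by (simp_all add: power2_eq_square algebra_simps)
  then have "real (q * n) < real (Suc m)" "real m \<le> real (q * n + n)" using m by simp_all
  then have qm: "q * n \<le> m" "m \<le> q * n + n" by linarith+
  have "(\<Sum>i\<in>{1..m}. row_fun n h i) = (\<Sum>i\<in>{1..q * n}. row_fun n h i) + (\<Sum>i\<in>{q * n<..m}. row_fun n h i)"
    using qm(1) by (subst sum.union_disjoint[symmetric]) (auto intro!: sum.cong)
  moreover have "(\<Sum>i\<in>{q * n<..m}. row_fun n h i) \<le> (\<Sum>i\<in>{q * n<..m}. 1)"
    by (rule sum_mono) (simp add: row_fun_def)
  moreover have "0 \<le> (\<Sum>i\<in>{q * n<..m}. row_fun n h i)" by (rule sum_nonneg) (simp add: row_fun_def)
  ultimately have "\<bar>(\<Sum>i\<in>{1..m}. row_fun n h i) - (\<Sum>r<q. real (h r))\<bar> \<le> real n"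
    using qm sum_row_fun[of h n q, OF h] \<open>real m \<le> real (q * n + n)\<close> by simp
  then have 1: "\<bar>(\<Sum>i\<in>{1..m}. row_fun n h i) / (real n)\<^sup>2 - (\<Sum>r<q. real (h r)) / (real n)\<^sup>2\<bar> \<le> real n / (real n)\<^sup>2"
    unfolding diff_divide_distrib[symmetric] abs_divide by (simp add: divide_right_mono)
  have 2: "\<bar>primitive L (cell_fun (real n) (\<lambda>i. real (h (i - 1)) / real n)) t
     - (\<Sum>i\<in>{1..q}. real (h (i - 1)) / real n) / real n\<bar> \<le> 1 / real n"
    unfolding q_def by (rule integral_cell_fun) (use n h t in auto)
  have "(\<Sum>i\<in>{1..q}. real (h (i - 1)) / real n) = (\<Sum>r<q. real (h r) / real n)"
    by (rule sum.reindex_bij_witness[of _ Suc "\<lambda>i. i - 1"]) auto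
  then have "(\<Sum>i\<in>{1..q}. real (h (i - 1)) / real n) / real n = (\<Sum>r<q. real (h r)) / (real n)\<^sup>2"
    by (simp add: sum_divide_distrib[symmetric] power2_eq_square)
  moreover have "real n / (real n)\<^sup>2 = 1 / real n" by (simp add: power2_eq_square)
  ultimately show ?thesis using 1 2 unfolding m_def[symmetric] by simp
qed

section \<open>The blockwise filling of a profile\<close>

text \<open>
  The right-continuous representative of a function of bounded variation with values in \<open>[0, 1]\<close>.
  While \<open>V\<close> is the sharp bound for its variation, \<open>G\<close> is the cumulative function of a measure that
  dominates its derivative; it localises the oscillation of \<open>U\<close> to short intervals.
\<close>

locale bv_profile =
  fixes L V \<Lambda> :: real and U G :: "real \<Rightarrow> real"
  assumes L: "L > 0"
    and right_cont: "\<And>x. continuous (at_right x) U"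
    and range: "\<And>x. 0 \<le> x \<Longrightarrow> x < L \<Longrightarrow> 0 \<le> U x \<and> U x \<le> 1"
    and variation: "\<And>x J. mono x \<Longrightarrow> (\<Sum>j<J. \<bar>U (x (Suc j)) - U (x j)\<bar>) \<le> V"
    and dominated: "\<And>x y. x \<le> y \<Longrightarrow> \<bar>U y - U x\<bar> \<le> G y - G x"
    and G_range: "\<And>x. 0 \<le> G x" "\<And>x. G x \<le> \<Lambda>"
begin

definition mixed_length :: real where
  "mixed_length = (\<integral>x. of_bool (0 < U x \<and> U x < 1) \<partial>leb_on_ivl L)"

lemma mono_G: "mono G"
proof (rule monoI)
  fix x y :: real assume "x \<le> y"
  then show "G x \<le> G y" using dominated[of x y] by linarith
qed

lemma V_nonneg: "0 \<le> V"
  using variation[of "\<lambda>_. 0" 0] by (simp add: mono_def)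

lemma isCont_U: "isCont G x \<Longrightarrow> isCont U x"
proof -
  assume G: "isCont G x"
  have "((\<lambda>y. \<bar>G y - G x\<bar>) \<longlongrightarrow> \<bar>G x - G x\<bar>) (at x)"
    by (intro tendsto_intros) (use G in \<open>simp add: isCont_def\<close>)
  then have "((\<lambda>y. \<bar>G y - G x\<bar>) \<longlongrightarrow> 0) (at x)" by simp
  then have "((\<lambda>y. U y - U x) \<longlongrightarrow> 0) (at x)"
  proof (rule Lim_null_comparison[rotated])
    have "norm (U y - U x) \<le> \<bar>G y - G x\<bar>" for y
      using dominated[of x y] dominated[of y x] by (cases "x \<le> y") auto
    then show "\<forall>\<^sub>F y in at x. norm (U y - U x) \<le> \<bar>G y - G x\<bar>" by simp
  qed
  then show ?thesis unfolding isCont_def by (rule LIM_zero_cancel)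
qed

lemma U_measurable: "U \<in> borel_measurable borel"
proof -
  have "mono (\<lambda>x. U x + G x)"
  proof (rule monoI)
    fix x y :: real assume "x \<le> y"
    then show "U x + G x \<le> U y + G y" using dominated[of x y] by linarith
  qed
  then have "(\<lambda>x. (U x + G x) - G x) \<in> borel_measurable borel"
    by (intro borel_measurable_diff borel_measurable_mono mono_G)
  then show ?thesis by simp
qed

lemma mixed_measurable: "(\<lambda>x. of_bool (0 < U x \<and> U x < 1) :: real) \<in> borel_measurable borel"
proof -
  have "(\<lambda>x. indicator {0<..<1} (U x) :: real) \<in> borel_measurable borel"
    by (rule measurable_compose[OF U_measurable]) simp
  moreover have "(\<lambda>x. indicator {0<..<1} (U x) :: real) = (\<lambda>x. of_bool (0 < U x \<and> U x < 1))"
    by (auto simp: indicator_def)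
  ultimately show ?thesis by (simp only:)
qed

lemma AE_isCont_U: "AE x in leb_on_ivl L. x \<in> {0<..<L} \<and> isCont U x"
proof -
  have "AE x in leb_on_ivl L. x \<notin> {x. \<not> isCont G x}"
    by (intro AE_leb_on_ivl_countable mono_ctble_discont mono_G)
  with AE_space show ?thesis by eventually_elim (auto simp: space_restrict_space isCont_U)
qed

text \<open>
  Values within about \<open>\<delta>\<close> of \<open>0\<close> or \<open>1\<close> are sent to \<open>0\<close> or \<open>1\<close>, at the price of a Lipschitz constant
  \<open>1 + 2 \<delta>\<close>, which tends to \<open>1\<close> with \<open>\<delta>\<close>.
\<close>

definition clamp :: "real \<Rightarrow> real \<Rightarrow> real" where
  "clamp \<delta> t = max 0 (min 1 ((1 + 2 * \<delta>) * t - \<delta>))"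

lemma clamp_range: "0 \<le> clamp \<delta> t" "clamp \<delta> t \<le> 1"
  by (auto simp: clamp_def)

lemma clamp_lipschitz:
  assumes "0 \<le> \<delta>"
  shows "\<bar>clamp \<delta> s - clamp \<delta> t\<bar> \<le> (1 + 2 * \<delta>) * \<bar>s - t\<bar>"
proof -
  have "\<bar>clamp \<delta> s - clamp \<delta> t\<bar> \<le> \<bar>((1 + 2 * \<delta>) * s - \<delta>) - ((1 + 2 * \<delta>) * t - \<delta>)\<bar>"
    unfolding clamp_def by linarith
  also have "\<dots> = \<bar>(1 + 2 * \<delta>) * (s - t)\<bar>" by (simp add: algebra_simps)
  finally show ?thesis using assms by (simp add: abs_mult)
qed

lemma clamp_near:
  assumes "0 \<le> \<delta>" "0 \<le> t" "t \<le> 1"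
  shows "\<bar>clamp \<delta> t - t\<bar> \<le> \<delta>"
proof -
  have "0 \<le> \<delta> * t" "\<delta> * t \<le> \<delta>" using assms by (simp_all add: mult_left_le)
  then have "\<bar>((1 + 2 * \<delta>) * t - \<delta>) - t\<bar> \<le> \<delta>" by (simp add: algebra_simps abs_le_iff)
  then show ?thesis using assms unfolding clamp_def by linarith
qed

lemma clamp_mixed:
  assumes "0 < \<delta>" "\<delta> \<le> 1" "0 < clamp \<delta> t" "clamp \<delta> t < 1"
  shows "\<delta> / 3 \<le> t" "t \<le> 1 - \<delta> / 3"
proof -
  have 1: "\<delta> < (1 + 2 * \<delta>) * t" "(1 + 2 * \<delta>) * t < 1 + \<delta>"
    using assms(3,4) unfolding clamp_def by linarith+
  have "(1 + 2 * \<delta>) * (\<delta> / 3) \<le> 3 * (\<delta> / 3)" using assms by (intro mult_right_mono) auto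
  then have 2: "(1 + 2 * \<delta>) * (\<delta> / 3) \<le> \<delta>" by simp
  then have "(1 + 2 * \<delta>) * (\<delta> / 3) < (1 + 2 * \<delta>) * t" using 1 by linarith
  then show "\<delta> / 3 \<le> t" using assms by (subst (asm) mult_less_cancel_left_pos) auto
  have "(1 + 2 * \<delta>) * t < (1 + 2 * \<delta>) * (1 - \<delta> / 3)" using 1 2 by (simp add: algebra_simps)
  then show "t \<le> 1 - \<delta> / 3" using assms by (subst (asm) mult_less_cancel_left_pos) auto
qed

text \<open>
  All rows of a block of \<open>B\<close> rows use the value of the profile at the start of the block, so that
  heights change, and rounding errors occur, only between blocks.
\<close>

definition sample_point :: "nat \<Rightarrow> nat \<Rightarrow> nat \<Rightarrow> real" where
  "sample_point B n r = real (B * (r div B)) / real n"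

definition base_height :: "nat \<Rightarrow> nat \<Rightarrow> real \<Rightarrow> nat \<Rightarrow> nat" where
  "base_height B n \<delta> r = nat \<lfloor>real n * clamp \<delta> (U (sample_point B n r))\<rfloor>"

lemma sample_point_bounds:
  assumes "B > 0" "n > 0"
  shows "0 \<le> sample_point B n r" "sample_point B n r \<le> real r / real n" "(real r - real B) / real n \<le> sample_point B n r"
    "(real (Suc r) - real B) / real n \<le> sample_point B n r"
proof -
  have "B * (r div B) \<le> r" by simp
  moreover have "Suc r \<le> B * (r div B) + B" using assms mod_less_divisor[of B r] mult_div_mod_eq[of B r] by linarith
  ultimately have "real (B * (r div B)) \<le> real r" "real (Suc r) \<le> real (B * (r div B)) + real B"
    by (auto simp del: of_nat_mult)
  then show "0 \<le> sample_point B n r" "sample_point B n r \<le> real r / real n" "(real r - real B) / real n \<le> sample_point B n r"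
    "(real (Suc r) - real B) / real n \<le> sample_point B n r"
    unfolding sample_point_def using assms by (auto intro!: divide_right_mono simp del: of_nat_mult)
qed

lemma mono_sample_point: "mono (sample_point B n)"
  unfolding sample_point_def by (intro monoI divide_right_mono) (auto intro!: mult_left_mono div_le_mono simp del: of_nat_mult)

lemma base_height_bounds:
  shows "base_height B n \<delta> r \<le> n" "real (base_height B n \<delta> r) \<le> real n * clamp \<delta> (U (sample_point B n r))"
    "real n * clamp \<delta> (U (sample_point B n r)) < real (base_height B n \<delta> r) + 1"
proof -
  let ?y = "real n * clamp \<delta> (U (sample_point B n r))"
  have y: "0 \<le> ?y" "?y \<le> real n" using clamp_range by (auto intro: mult_left_le)
  then show 1: "real (base_height B n \<delta> r) \<le> ?y" "?y < real (base_height B n \<delta> r) + 1"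
    unfolding base_height_def by linarith+
  show "base_height B n \<delta> r \<le> n" using 1(1) y(2) by linarith
qed

lemma base_height_change:
  assumes "0 \<le> \<delta>"
  shows "\<bar>real (base_height B n \<delta> (Suc r)) - real (base_height B n \<delta> r)\<bar>
     \<le> real n * (1 + 2 * \<delta>) * \<bar>U (sample_point B n (Suc r)) - U (sample_point B n r)\<bar> + of_bool (Suc r div B \<noteq> r div B)"
proof (cases "Suc r div B = r div B")
  case True
  then show ?thesis using assms by (simp add: base_height_def sample_point_def)
next
  case False
  let ?c = "\<lambda>r. clamp \<delta> (U (sample_point B n r))"
  have "\<bar>real (base_height B n \<delta> (Suc r)) - real (base_height B n \<delta> r)\<bar> \<le> \<bar>real n * ?c (Suc r) - real n * ?c r\<bar> + 1"
    using base_height_bounds(2,3)[where B=B and n=n and \<delta>=\<delta> and r=r]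
      base_height_bounds(2,3)[where B=B and n=n and \<delta>=\<delta> and r="Suc r"] by linarith
  also have "\<bar>real n * ?c (Suc r) - real n * ?c r\<bar> = real n * \<bar>?c (Suc r) - ?c r\<bar>"
    by (simp add: abs_mult right_diff_distrib[symmetric])
  also have "\<dots> \<le> real n * ((1 + 2 * \<delta>) * \<bar>U (sample_point B n (Suc r)) - U (sample_point B n r)\<bar>)"
    using clamp_lipschitz[OF assms] by (intro mult_left_mono) auto
  finally show ?thesis using False by (simp add: mult.assoc)
qed

lemma base_height_variation:
  assumes "0 \<le> \<delta>" "B > 0"
  shows "(\<Sum>r<Q. \<bar>real (base_height B n \<delta> (Suc r)) - real (base_height B n \<delta> r)\<bar>) \<le> real n * (1 + 2 * \<delta>) * V + real Q / real B"
proof -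
  have "(\<Sum>r<Q. \<bar>real (base_height B n \<delta> (Suc r)) - real (base_height B n \<delta> r)\<bar>)
      \<le> (\<Sum>r<Q. real n * (1 + 2 * \<delta>) * \<bar>U (sample_point B n (Suc r)) - U (sample_point B n r)\<bar> + of_bool (Suc r div B \<noteq> r div B))"
    by (intro sum_mono base_height_change assms)
  also have "\<dots> = real n * (1 + 2 * \<delta>) * (\<Sum>r<Q. \<bar>U (sample_point B n (Suc r)) - U (sample_point B n r)\<bar>)
      + (\<Sum>r<Q. of_bool (Suc r div B \<noteq> r div B))"
    by (simp add: sum.distrib sum_distrib_left)
  also have "\<dots> \<le> real n * (1 + 2 * \<delta>) * V + real Q / real B"
    using assms by (intro add_mono mult_left_mono variation mono_sample_point block_boundaries) auto
  finally show ?thesis .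
qed

lemma base_height_changes:
  assumes "B > 0"
  shows "(\<Sum>r<Q. of_bool (base_height B n \<delta> (Suc r) \<noteq> base_height B n \<delta> r) :: real) \<le> real Q / real B"
proof -
  have "(\<Sum>r<Q. of_bool (base_height B n \<delta> (Suc r) \<noteq> base_height B n \<delta> r) :: real) \<le> (\<Sum>r<Q. of_bool (Suc r div B \<noteq> r div B))"
    by (rule sum_mono) (auto simp: base_height_def sample_point_def)
  also have "\<dots> \<le> real Q / real B" by (rule block_boundaries[OF assms])
  finally show ?thesis .
qed

text \<open>
  Each of the \<open>B\<close> unit shifts contributes a telescoping sum, bounded by \<open>\<Lambda>\<close>.
\<close>

lemma dominating_increments:
  assumes n: "n > 0"
  shows "(\<Sum>r<Q. G (real (Suc r) / real n) - G ((real (Suc r) - real B) / real n)) \<le> real B * \<Lambda>"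
proof (induction B)
  case (Suc B)
  have "(\<Sum>r<Q. G ((real (Suc r) - real B) / real n) - G ((real (Suc r) - real (Suc B)) / real n))
     = (\<Sum>r<Q. G ((real (Suc r) - real B) / real n) - G ((real r - real B) / real n))"
    by simp
  also have "\<dots> = G ((real Q - real B) / real n) - G ((real 0 - real B) / real n)"
    by (rule sum_lessThan_telescope)
  also have "\<dots> \<le> \<Lambda>" using G_range by (smt (verit))
  finally have "(\<Sum>r<Q. G ((real (Suc r) - real B) / real n) - G ((real (Suc r) - real (Suc B)) / real n)) \<le> \<Lambda>" .
  then show ?case using Suc by (simp add: sum_subtractf algebra_simps)
qed simp

text \<open>
  A mixed row either lies over points where \<open>0 < U < 1\<close>, or \<open>U\<close> takes one of the values \<open>0\<close> and \<open>1\<close> on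
  it. In the second case \<open>U\<close> varies by at least \<open>\<delta> / 3\<close> since the start of the block, because the
  clamped sample is neither \<open>0\<close> nor \<open>1\<close>; so \<open>G\<close> grows by at least as much over at most \<open>B\<close> rows, which
  can only happen \<open>3 B \<Lambda> / \<delta>\<close> times.
\<close>

lemma base_height_mixed:
  assumes n: "n > 0" and B: "B > 0" and \<delta>: "0 < \<delta>" "\<delta> \<le> 1" and Q: "real Q \<le> real n * L"
  shows "(\<Sum>r<Q. of_bool (0 < base_height B n \<delta> r \<and> base_height B n \<delta> r < n)) \<le> real n * mixed_length + 1 + 3 * real B * \<Lambda> / \<delta>"
proof -
  define good where "good = (\<lambda>r. r < Q \<and> (\<forall>x. real r / real n < x \<longrightarrow> x \<le> real (Suc r) / real n \<longrightarrow> x < L \<longrightarrow> 0 < U x \<and> U x < 1))"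
  have split: "of_bool (0 < base_height B n \<delta> r \<and> base_height B n \<delta> r < n) \<le> of_bool (good r)
      + 3 / \<delta> * (G (real (Suc r) / real n) - G ((real (Suc r) - real B) / real n))" if r: "r < Q" for r
  proof (cases "(0 < base_height B n \<delta> r \<and> base_height B n \<delta> r < n) \<and> \<not> good r")
    case False
    have "G ((real (Suc r) - real B) / real n) \<le> G (real (Suc r) / real n)"
      by (rule monoD[OF mono_G]) (auto intro: divide_right_mono)
    then have "0 \<le> 3 / \<delta> * (G (real (Suc r) / real n) - G ((real (Suc r) - real B) / real n))" using \<delta> by simp
    then show ?thesis using False by auto
  next
    case True
    then obtain x where x: "real r / real n < x" "x \<le> real (Suc r) / real n" "x < L" "\<not> (0 < U x \<and> U x < 1)"
      using r by (auto simp: good_def)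
    have "0 \<le> real r / real n" by simp
    then have x0: "0 \<le> x" using x(1) by linarith
    let ?s = "sample_point B n r"
    have "1 \<le> real (base_height B n \<delta> r)" "real (base_height B n \<delta> r) + 1 \<le> real n" using True by linarith+
    then have "0 < real n * clamp \<delta> (U ?s)" "real n * clamp \<delta> (U ?s) < real n"
      using base_height_bounds(2,3)[where B=B and n=n and \<delta>=\<delta> and r=r] by linarith+
    then have c: "0 < clamp \<delta> (U ?s)" "clamp \<delta> (U ?s) < 1"
      using n by (simp_all add: zero_less_mult_iff)
    have "U x = 0 \<or> U x = 1" using range[OF x0 x(3)] x(4) by auto
    then have "\<delta> / 3 \<le> \<bar>U x - U ?s\<bar>" using clamp_mixed[OF \<delta> c] by (elim disjE) linarith+
    also have "\<dots> \<le> G x - G ?s"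
      using sample_point_bounds(2)[OF B n, of r] x(1) by (intro dominated) linarith
    also have "\<dots> \<le> G (real (Suc r) / real n) - G ((real (Suc r) - real B) / real n)"
      using monoD[OF mono_G x(2)] monoD[OF mono_G sample_point_bounds(4)[OF B n, of r]] by linarith
    finally have "3 / \<delta> * (\<delta> / 3) \<le> 3 / \<delta> * (G (real (Suc r) / real n) - G ((real (Suc r) - real B) / real n))"
      using \<delta> by (intro mult_left_mono) auto
    then show ?thesis using True \<delta> by simp
  qed
  have "(\<Sum>r<Q. of_bool (0 < base_height B n \<delta> r \<and> base_height B n \<delta> r < n))
     \<le> (\<Sum>r<Q. of_bool (good r) + 3 / \<delta> * (G (real (Suc r) / real n) - G ((real (Suc r) - real B) / real n)))"
    using split by (intro sum_mono) auto
  also have "\<dots> = (\<Sum>r<Q. of_bool (good r)) + 3 / \<delta> * (\<Sum>r<Q. G (real (Suc r) / real n) - G ((real (Suc r) - real B) / real n))"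
    by (simp add: sum.distrib sum_distrib_left)
  also have "\<dots> \<le> (real n * mixed_length + 1) + 3 / \<delta> * (real B * \<Lambda>)"
  proof (intro add_mono mult_left_mono dominating_increments n)
    define b where "b = (\<lambda>i. of_bool (i > 0 \<and> good (i - 1)) :: real)"
    have le: "cell_fun (real n) b x \<le> of_bool (0 < U x \<and> U x < 1)" if x: "x \<in> {0<..<L}" for x
    proof (cases "b (nat \<lceil>real n * x\<rceil>) = 0")
      case False
      define i where "i = nat \<lceil>real n * x\<rceil>"
      have i: "i > 0" "good (i - 1)" using False by (auto simp: b_def i_def)
      have "x \<in> {(real i - 1) / real n <.. real i / real n}"
        using nat_ceiling_cell[of "real n" x i] x n i_def by auto
      then have "0 < U x \<and> U x < 1"
        using i x unfolding good_def by (auto simp: of_nat_diff)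
      then show ?thesis by (simp add: cell_fun_def b_def)
    qed (simp add: cell_fun_def)
    have "(\<Sum>r<Q. of_bool (good r)) = (\<Sum>i\<in>{1..nat \<lfloor>real n * L\<rfloor>}. b i)"
    proof -
      have "Q \<le> nat \<lfloor>real n * L\<rfloor>" using Q by (rule le_nat_floor)
      then have "(\<Sum>i\<in>{1..nat \<lfloor>real n * L\<rfloor>}. b i) = (\<Sum>i\<in>{1..Q}. b i)"
        by (intro sum.mono_neutral_right) (auto simp: b_def good_def)
      also have "\<dots> = (\<Sum>r<Q. of_bool (good r))"
        by (rule sum.reindex_bij_witness[of _ Suc "\<lambda>i. i - 1"]) (auto simp: b_def)
      finally show ?thesis by simp
    qed
    also have "\<dots> \<le> real n * primitive L (cell_fun (real n) b) L + 1"
      using integral_cell_fun[of "real n" L L b 1] n L by (auto simp: b_def abs_le_iff field_simps)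
    also have "primitive L (cell_fun (real n) b) L \<le> mixed_length"
      unfolding mixed_length_def
    proof (rule integral_mono)
      show "integrable (leb_on_ivl L) (\<lambda>x. cell_fun (real n) b x * indicator {..<L} x)"
        by (rule integrable_bounded_leb[where C=1])
          (auto intro!: leb_on_ivl_borel borel_measurable_times cell_fun_measurable simp: b_def cell_fun_def indicator_def)
      show "integrable (leb_on_ivl L) (\<lambda>x. of_bool (0 < U x \<and> U x < 1) :: real)"
        by (rule integrable_bounded_leb[where C=1, OF leb_on_ivl_borel[OF mixed_measurable]]) auto
      fix x assume "x \<in> space (leb_on_ivl L)"
      then show "cell_fun (real n) b x * indicator {..<L} x \<le> of_bool (0 < U x \<and> U x < 1)"
        using le[of x] by (simp add: space_restrict_space)
    qed
    finally show "(\<Sum>r<Q. of_bool (good r)) \<le> real n * mixed_length + 1"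
      by (simp add: mult_left_mono)
  qed (use \<delta> in auto)
  finally show ?thesis by simp
qed

text \<open>
  The heights are changed by the constant \<open>q\<close> on an interval of mixed rows, and by one more cell on an
  initial part of it. Only the ends of these two intervals produce additional jumps.
\<close>

lemma adjusted_energy:
  assumes n: "n > 0" and B: "B > 0" and \<delta>: "0 < \<delta>" "\<delta> \<le> 1"
    and Q: "Q = M div n" "real Q \<le> real n * L"
    and h: "\<And>r. h r \<le> n"
    and adj: "\<And>r. real (h r) = real (base_height B n \<delta> r) + q * indicator {r1..<r2} r + indicator {r1..<r3} r"
    and I: "\<And>r. r \<in> {r1..<r2} \<Longrightarrow> 0 < base_height B n \<delta> r \<and> base_height B n \<delta> r < n" and r3: "r3 \<le> r2"
  shows "near_sum (row_fun n h) M + far_sum (row_fun n h) n M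
    \<le> 2 * (real n * mixed_length + 2 + 3 * real B * \<Lambda> / \<delta>) + real (Suc Q) / real B + 4
      + (real n * (1 + 2 * \<delta>) * V + real Q / real B + 2 * \<bar>q\<bar> + 2)"
proof (rule add_mono)
  let ?b = "base_height B n \<delta>"
  let ?i = "indicator {r1..<r2} :: nat \<Rightarrow> real" and ?j = "indicator {r1..<r3} :: nat \<Rightarrow> real"
  have "far_sum (row_fun n h) n M \<le> (\<Sum>r<Q. \<bar>real (h (Suc r)) - real (h r)\<bar>)"
    unfolding Q(1) by (rule far_sum_row_fun_le[OF n h])
  also have "\<dots> \<le> (\<Sum>r<Q. \<bar>real (?b (Suc r)) - real (?b r)\<bar> + \<bar>q\<bar> * \<bar>?i (Suc r) - ?i r\<bar> + \<bar>?j (Suc r) - ?j r\<bar>)"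
  proof (rule sum_mono)
    fix r
    have "real (h (Suc r)) - real (h r) = (real (?b (Suc r)) - real (?b r)) + q * (?i (Suc r) - ?i r) + (?j (Suc r) - ?j r)"
      unfolding adj by (simp add: algebra_simps)
    then show "\<bar>real (h (Suc r)) - real (h r)\<bar> \<le> \<bar>real (?b (Suc r)) - real (?b r)\<bar> + \<bar>q\<bar> * \<bar>?i (Suc r) - ?i r\<bar> + \<bar>?j (Suc r) - ?j r\<bar>"
      unfolding abs_mult[symmetric] by linarith
  qed
  also have "\<dots> = (\<Sum>r<Q. \<bar>real (?b (Suc r)) - real (?b r)\<bar>) + \<bar>q\<bar> * (\<Sum>r<Q. \<bar>?i (Suc r) - ?i r\<bar>) + (\<Sum>r<Q. \<bar>?j (Suc r) - ?j r\<bar>)"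
    by (simp add: sum.distrib sum_distrib_left)
  also have "\<dots> \<le> (real n * (1 + 2 * \<delta>) * V + real Q / real B) + \<bar>q\<bar> * 2 + 2"
    using \<delta> B by (intro add_mono mult_left_mono base_height_variation indicator_interval_variation) auto
  finally show "far_sum (row_fun n h) n M \<le> real n * (1 + 2 * \<delta>) * V + real Q / real B + 2 * \<bar>q\<bar> + 2" by simp
  have "near_sum (row_fun n h) M \<le> (\<Sum>r<Suc Q. 2 * of_bool (0 < h r \<and> h r < n) + of_bool (h (Suc r) \<noteq> h r))"
    unfolding Q(1) by (rule near_sum_row_fun_le[OF n h])
  also have "\<dots> \<le> (\<Sum>r<Suc Q. 2 * of_bool (0 < ?b r \<and> ?b r < n) + (of_bool (?b (Suc r) \<noteq> ?b r) + (\<bar>?i (Suc r) - ?i r\<bar> + \<bar>?j (Suc r) - ?j r\<bar>)))"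
  proof (intro sum_mono add_mono)
    fix r
    show "2 * of_bool (0 < h r \<and> h r < n) \<le> (2 * of_bool (0 < ?b r \<and> ?b r < n) :: real)"
    proof (cases "r \<in> {r1..<r2}")
      case True
      then show ?thesis using I by simp
    next
      case False
      then have "h r = ?b r" using adj[of r] r3 by (auto simp: indicator_def)
      then show ?thesis by simp
    qed
    show "of_bool (h (Suc r) \<noteq> h r) \<le> of_bool (?b (Suc r) \<noteq> ?b r) + (\<bar>?i (Suc r) - ?i r\<bar> + \<bar>?j (Suc r) - ?j r\<bar>)"
    proof (cases "?b (Suc r) = ?b r \<and> ?i (Suc r) = ?i r \<and> ?j (Suc r) = ?j r")
      case True
      then have "real (h (Suc r)) = real (h r)" unfolding adj by simp
      then show ?thesis by simp
    next
      case False
      moreover have "indicator S (Suc r) \<noteq> (indicator S r :: real) \<Longrightarrow> \<bar>indicator S (Suc r) - indicator S r :: real\<bar> = 1" for S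
        by (cases "Suc r \<in> S"; cases "r \<in> S"; simp)
      ultimately consider "?b (Suc r) \<noteq> ?b r" | "\<bar>?i (Suc r) - ?i r\<bar> = 1" | "\<bar>?j (Suc r) - ?j r\<bar> = 1"
        by blast
      then show ?thesis by cases auto
    qed
  qed
  also have "\<dots> = 2 * (\<Sum>r<Suc Q. of_bool (0 < ?b r \<and> ?b r < n)) + ((\<Sum>r<Suc Q. of_bool (?b (Suc r) \<noteq> ?b r))
      + ((\<Sum>r<Suc Q. \<bar>?i (Suc r) - ?i r\<bar>) + (\<Sum>r<Suc Q. \<bar>?j (Suc r) - ?j r\<bar>)))"
    unfolding sum.distrib sum_distrib_left ..
  also have "\<dots> \<le> 2 * (real n * mixed_length + 2 + 3 * real B * \<Lambda> / \<delta>) + (real (Suc Q) / real B + (2 + 2))"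
  proof (intro add_mono mult_left_mono base_height_changes indicator_interval_variation B)
    show "(\<Sum>r<Suc Q. of_bool (0 < ?b r \<and> ?b r < n)) \<le> real n * mixed_length + 2 + 3 * real B * \<Lambda> / \<delta>"
      using base_height_mixed[OF n B \<delta> Q(2)] by simp
  qed simp
  finally show "near_sum (row_fun n h) M \<le> 2 * (real n * mixed_length + 2 + 3 * real B * \<Lambda> / \<delta>) + real (Suc Q) / real B + 4"
    by simp
qed

end

section \<open>Profiles with intermediate values\<close>

lemma sum_row_fun_diff:
  assumes n: "n > 0" and h: "\<And>r. h r \<le> n" and h': "\<And>r. h' r \<le> n" and eq: "h (M div n) = h' (M div n)"
  shows "(\<Sum>i\<in>{1..M}. row_fun n h i) - (\<Sum>i\<in>{1..M}. row_fun n h' i) = (\<Sum>r<M div n. real (h r) - real (h' r))"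
proof -
  let ?Q = "M div n"
  have QM: "?Q * n \<le> M" "M < ?Q * n + n"
    using div_mult_mod_eq[of M n] mod_less_divisor[OF n, of M] by linarith+
  have un: "{1..M} = {1..?Q * n} \<union> {?Q * n<..M}"
  proof (rule set_eqI)
    show "x \<in> {1..M} \<longleftrightarrow> x \<in> {1..?Q * n} \<union> {?Q * n<..M}" for x
      using QM(1) unfolding Un_iff atLeastAtMost_iff greaterThanAtMost_iff by linarith
  qed
  have split: "(\<Sum>i\<in>{1..M}. f i) = (\<Sum>i\<in>{1..?Q * n}. f i) + (\<Sum>i\<in>{?Q * n<..M}. f i)" for f :: "nat \<Rightarrow> real"
    unfolding un by (rule sum.union_disjoint) auto
  have "(\<Sum>i\<in>{?Q * n<..M}. row_fun n h i) = (\<Sum>i\<in>{?Q * n<..M}. row_fun n h' i)"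
  proof (rule sum.cong[OF refl])
    fix i assume i: "i \<in> {?Q * n<..M}"
    then have "?Q * n \<le> i - 1" "i - 1 < Suc ?Q * n" using QM by auto
    then have "(i - 1) div n = ?Q" by (intro div_nat_eqI) (simp_all add: mult.commute)
    then show "row_fun n h i = row_fun n h' i" using eq by (simp add: row_fun_def)
  qed
  then show ?thesis
    unfolding split sum_row_fun[OF h] sum_row_fun[OF h'] by (simp add: sum_subtractf)
qed

context bv_profile begin

text \<open>
  The properties of a recovery sequence for the profile, with weak convergence expressed by the
  density of ones to the left of each \<open>t\<close>.
\<close>

definition recovers :: "(nat \<Rightarrow> nat \<Rightarrow> real) \<Rightarrow> (nat \<Rightarrow> nat) \<Rightarrow> bool" where
  "recovers a k \<longleftrightarrow>
     (\<forall>n i. a n i \<in> {0, 1}) \<and>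
     (\<forall>\<^sub>F n in sequentially. (\<Sum>i\<in>{1..nsites L n}. a n i) = real (k n)) \<and>
     (\<forall>\<epsilon>>0. \<forall>\<^sub>F n in sequentially.
        helix_energy L n (a n) \<le> 2 * mixed_length + V + \<epsilon>) \<and>
     (\<forall>t. 0 \<le> t \<longrightarrow> t \<le> L \<longrightarrow>
        (\<lambda>n. density n (a n) t) \<longlonglongrightarrow> primitive L U t)"

lemma integral_tendsto_of_AE_tendsto:
  fixes f :: "nat \<Rightarrow> real \<Rightarrow> real"
  assumes f: "\<And>n. f n \<in> borel_measurable borel" "\<And>n x. \<bar>f n x\<bar> \<le> K"
    and lim: "\<And>x. x \<in> {0<..<L} \<Longrightarrow> isCont U x \<Longrightarrow> x \<notin> D \<Longrightarrow> (\<lambda>n. f n x) \<longlonglongrightarrow> U x" and D: "countable D"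
  shows "(\<lambda>n. primitive L (f n) t) \<longlonglongrightarrow> primitive L U t"
proof (rule integral_dominated_convergence[where w="\<lambda>_. K"])
  interpret finite_measure "leb_on_ivl L" by (rule finite_measure_leb_on_ivl)
  show "(\<lambda>x. U x * indicator {..<t} x) \<in> borel_measurable (leb_on_ivl L)"
    by (intro leb_on_ivl_borel borel_measurable_times U_measurable) simp
  show "(\<lambda>x. f n x * indicator {..<t} x) \<in> borel_measurable (leb_on_ivl L)" for n
    by (intro leb_on_ivl_borel borel_measurable_times f) simp
  show "integrable (leb_on_ivl L) (\<lambda>_. K)" by simp
  from AE_leb_on_ivl_countable[OF D]
  show "AE x in leb_on_ivl L. (\<lambda>n. f n x * indicator {..<t} x) \<longlonglongrightarrow> U x * indicator {..<t} x"
    using AE_isCont_U by eventually_elim (intro tendsto_mult_right lim; simp)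
  show "AE x in leb_on_ivl L. norm (f n x * indicator {..<t} x) \<le> K" for n
    using f(2)[of n] by (intro AE_I2) (auto simp: indicator_def intro: order_trans[OF abs_ge_zero])
qed

text \<open>
  The density of ones in a row is its height divided by \<open>n\<close>.
\<close>

lemma row_density:
  assumes h: "\<And>n r. h n r \<le> n"
    and lim: "\<And>x. x \<in> {0<..<L} \<Longrightarrow> isCont U x \<Longrightarrow> (\<lambda>n. real (h n (nat \<lceil>real n * x\<rceil> - 1)) / real n) \<longlonglongrightarrow> U x"
    and t: "0 \<le> t" "t \<le> L"
  shows "(\<lambda>n. density n (row_fun n (h n)) t)
    \<longlonglongrightarrow> primitive L U t"
proof -
  define g where "g = (\<lambda>n. cell_fun (real n) (\<lambda>i. real (h n (i - 1)) / real n))"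
  have "(\<lambda>n. primitive L (g n) t) \<longlonglongrightarrow> primitive L U t"
  proof (rule integral_tendsto_of_AE_tendsto[where K=1 and D="{}"])
    show "g n \<in> borel_measurable borel" for n unfolding g_def by (rule cell_fun_measurable)
    have "real (h n r) / real n \<le> 1" for n r using h[of n r] by (cases "n = 0") simp_all
    then show "\<bar>g n x\<bar> \<le> 1" for n x unfolding g_def cell_fun_def by simp
    show "(\<lambda>n. g n x) \<longlonglongrightarrow> U x" if "x \<in> {0<..<L}" "isCont U x" for x
      using lim[OF that] by (simp add: g_def cell_fun_def)
  qed simp
  moreover have "(\<lambda>n. density n (row_fun n (h n)) t
      - primitive L (g n) t) \<longlonglongrightarrow> 0"
  proof (rule Lim_null_comparison)
    show "\<forall>\<^sub>F n in sequentially. norm (density n (row_fun n (h n)) t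
      - primitive L (g n) t) \<le> 2 / real n"
      using eventually_gt_at_top[of 0]
      by eventually_elim (simp add: g_def integral_row_fun h t del: One_nat_def)
    show "(\<lambda>n. 2 / real n) \<longlonglongrightarrow> 0" by real_asymp
  qed
  ultimately show ?thesis using tendsto_add by fastforce
qed

text \<open>
  With \<open>B\<close> about \<open>n\<^sup>1\<^sup>/\<^sup>3\<close> rows per block and \<open>\<delta> = n\<^sup>-\<^sup>1\<^sup>/\<^sup>3\<close>, each of the following tends to \<open>0\<close>: the
  height \<open>B / n\<close> of a block, the rounding cost \<open>L / B\<close> of all blocks, and the cost \<open>B \<Lambda> / (n \<delta>)\<close> of the
  mixed rows outside the set where \<open>0 < U < 1\<close>.
\<close>

definition block_rows :: "nat \<Rightarrow> nat" where "block_rows n = nat \<lceil>real n powr (1/3)\<rceil>"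
definition margin :: "nat \<Rightarrow> real" where "margin n = real n powr (- 1/3)"

lemma block_rows_bounds:
  assumes "n > 0"
  shows "block_rows n > 0" "real n powr (1/3) \<le> real (block_rows n)" "real (block_rows n) \<le> real n powr (1/3) + 1"
    "0 < margin n" "margin n \<le> 1"
proof -
  have p: "real n powr (1/3) > 0" using assms by simp
  then show "block_rows n > 0" "real n powr (1/3) \<le> real (block_rows n)" "real (block_rows n) \<le> real n powr (1/3) + 1"
    unfolding block_rows_def by linarith+
  show "0 < margin n" using assms by (simp add: margin_def)
  have "real n powr (- 1/3) \<le> real n powr 0" by (rule powr_mono) (use assms in auto)
  then show "margin n \<le> 1" using assms by (simp add: margin_def)
qed

lemma base_height_tendsto:
  assumes x: "x \<in> {0<..<L}" and c: "isCont U x"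
  shows "(\<lambda>n. real (base_height (block_rows n) n (margin n) (nat \<lceil>real n * x\<rceil> - 1)) / real n) \<longlonglongrightarrow> U x"
proof -
  define s where "s = (\<lambda>n. sample_point (block_rows n) n (nat \<lceil>real n * x\<rceil> - 1))"
  have s: "\<forall>\<^sub>F n in sequentially. x - (real n powr (1/3) + 2) / real n \<le> s n \<and> s n \<le> x \<and> 0 \<le> s n \<and> s n < L"
    using eventually_gt_at_top[of 0]
  proof eventually_elim
    case (elim n)
    define r where "r = nat \<lceil>real n * x\<rceil> - 1"
    have "0 < real n * x" using elim x by simp
    then have r: "real r \<le> real n * x" "real n * x \<le> real r + 1"
      unfolding r_def by linarith+
    then have r': "real r / real n \<le> x" "x \<le> (real r + 1) / real n"
      using elim by (simp_all add: divide_le_eq le_divide_eq mult.commute)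
    note sb = sample_point_bounds[OF block_rows_bounds(1)[OF elim] elim, of r]
    have "x - (real n powr (1/3) + 2) / real n \<le> (real r + 1 - (real n powr (1/3) + 2)) / real n"
      using r'(2) by (subst diff_divide_distrib) linarith
    also have "\<dots> \<le> (real r - real (block_rows n)) / real n"
      using block_rows_bounds(3)[OF elim] by (intro divide_right_mono) auto
    finally show ?case using sb r' x unfolding s_def r_def[symmetric] by auto
  qed
  have "s \<longlonglongrightarrow> x"
  proof (rule tendsto_sandwich)
    show "\<forall>\<^sub>F n in sequentially. x - (real n powr (1/3) + 2) / real n \<le> s n" "\<forall>\<^sub>F n in sequentially. s n \<le> x"
      using s by (auto elim: eventually_mono)
    show "(\<lambda>n. x - (real n powr (1/3) + 2) / real n) \<longlonglongrightarrow> x" by real_asymp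
  qed simp
  then have Us: "(\<lambda>n. U (s n)) \<longlonglongrightarrow> U x" using c by (rule isCont_tendsto_compose[rotated])
  moreover have "(\<lambda>n. real (base_height (block_rows n) n (margin n) (nat \<lceil>real n * x\<rceil> - 1)) / real n - U (s n)) \<longlonglongrightarrow> 0"
  proof (rule Lim_null_comparison)
    show "\<forall>\<^sub>F n in sequentially. norm (real (base_height (block_rows n) n (margin n) (nat \<lceil>real n * x\<rceil> - 1)) / real n - U (s n))
       \<le> 1 / real n + real n powr (- 1/3)"
      using s eventually_gt_at_top[of 0]
    proof eventually_elim
      case (elim n)
      let ?b = "real (base_height (block_rows n) n (margin n) (nat \<lceil>real n * x\<rceil> - 1))" and ?c = "clamp (margin n) (U (s n))"
      have "0 \<le> U (s n) \<and> U (s n) \<le> 1" using elim by (intro range) auto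
      then have 1: "\<bar>?c - U (s n)\<bar> \<le> margin n"
        using block_rows_bounds(4)[OF elim(2)] by (intro clamp_near) auto
      have "?b \<le> real n * ?c" "real n * ?c \<le> ?b + 1"
        using base_height_bounds(2,3)[where B="block_rows n" and n=n and \<delta>="margin n" and r="nat \<lceil>real n * x\<rceil> - 1"] by (auto simp: s_def)
      then have "?b / real n \<le> ?c" "?c \<le> ?b / real n + 1 / real n"
        using elim(2) by (simp_all add: divide_le_eq le_divide_eq mult.commute add_divide_distrib[symmetric])
      then show ?case using 1 unfolding margin_def real_norm_def by linarith
    qed
    show "(\<lambda>n. 1 / real n + real n powr (- 1/3)) \<longlonglongrightarrow> 0" by real_asymp
  qed
  ultimately show ?thesis using tendsto_add by fastforce
qed

lemma energy_bound_tendsto: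
  assumes q: "(\<lambda>n. q n / real n) \<longlonglongrightarrow> 0" and M: "\<And>n. real (Q n) \<le> real n * L"
  shows "\<forall>\<epsilon>>0. \<forall>\<^sub>F n in sequentially.
    (2 * (real n * mixed_length + 2 + 3 * real (block_rows n) * \<Lambda> / margin n) + real (Suc (Q n)) / real (block_rows n) + 4
      + (real n * (1 + 2 * margin n) * V + real (Q n) / real (block_rows n) + 2 * \<bar>q n\<bar> + 2)) / real n
      \<le> 2 * mixed_length + V + \<epsilon>"
proof (intro allI impI)
  fix \<epsilon> :: real assume \<epsilon>: "\<epsilon> > 0"
  have \<Lambda>: "0 \<le> \<Lambda>" using G_range[of 0] by linarith
  define f where "f = (\<lambda>n::nat. 2 * mixed_length + V + \<Lambda> * (6 * (real n powr (1/3) + 1) / (real n powr (- 1/3) * real n))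
     + L * (2 / real n powr (1/3)) + 1 / (real n powr (1/3) * real n) + 10 / real n + V * (2 * real n powr (- 1/3)) + 2 * \<bar>q n / real n\<bar>)"
  have "f \<longlonglongrightarrow> 2 * mixed_length + V + \<Lambda> * 0 + L * 0 + 0 + 0 + V * 0 + 2 * \<bar>0\<bar>"
    unfolding f_def
    by (intro tendsto_add tendsto_mult tendsto_const tendsto_rabs q; real_asymp)
  then have "\<forall>\<^sub>F n in sequentially. f n < 2 * mixed_length + V + \<epsilon>"
    using \<epsilon> by (intro order_tendstoD(2)[of f "2 * mixed_length + V"]) auto
  then show "\<forall>\<^sub>F n in sequentially.
    (2 * (real n * mixed_length + 2 + 3 * real (block_rows n) * \<Lambda> / margin n) + real (Suc (Q n)) / real (block_rows n) + 4
      + (real n * (1 + 2 * margin n) * V + real (Q n) / real (block_rows n) + 2 * \<bar>q n\<bar> + 2)) / real n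
      \<le> 2 * mixed_length + V + \<epsilon>"
    using eventually_gt_at_top[of 0]
  proof eventually_elim
    case (elim n)
    note b = block_rows_bounds[OF elim(2)]
    have n0: "real n > 0" using elim by simp
    have p: "real n powr (1/3) > 0" using n0 by simp
    have 1: "3 * real (block_rows n) * \<Lambda> / margin n \<le> 3 * (real n powr (1/3) + 1) * \<Lambda> / margin n"
      using b \<Lambda> by (intro divide_right_mono mult_right_mono mult_left_mono) auto
    have 2: "real (Suc (Q n)) / real (block_rows n) \<le> (real n * L + 1) / real n powr (1/3)"
      using b M[of n] p L by (intro frac_le) auto
    have 3: "real (Q n) / real (block_rows n) \<le> (real n * L) / real n powr (1/3)"
      using b M[of n] p L by (intro frac_le) auto
    have "(2 * (real n * mixed_length + 2 + 3 * real (block_rows n) * \<Lambda> / margin n) + real (Suc (Q n)) / real (block_rows n) + 4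
      + (real n * (1 + 2 * margin n) * V + real (Q n) / real (block_rows n) + 2 * \<bar>q n\<bar> + 2)) / real n
      \<le> (2 * (real n * mixed_length + 2 + 3 * (real n powr (1/3) + 1) * \<Lambda> / margin n) + (real n * L + 1) / real n powr (1/3) + 4
      + (real n * (1 + 2 * margin n) * V + (real n * L) / real n powr (1/3) + 2 * \<bar>q n\<bar> + 2)) / real n"
      by (intro 1 2 3 order_refl divide_right_mono add_mono mult_left_mono) simp_all
    also have "\<dots> = f n"
    proof -
      have "(2 * (x * m + 2 + 3 * (p + 1) * \<Lambda> / d) + (x * L + 1) / p + 4 + (x * (1 + 2 * d) * V + (x * L) / p + 2 * y + 2)) / x
        = 2 * m + V + \<Lambda> * (6 * (p + 1) / (d * x)) + L * (2 / p) + 1 / (p * x) + 10 / x + V * (2 * d) + 2 * (y / x)"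
        if "x > 0" "p > 0" "d > 0" for x p d y m :: real
        using that by (simp add: divide_simps) (simp add: algebra_simps)
      from this[OF n0 p b(4)] show ?thesis
        unfolding f_def margin_def by (simp add: abs_divide)
    qed
    finally show ?case using elim(1) by linarith
  qed
qed

end

lemma sum_indicator_interval:
  assumes "s \<le> t" "t \<le> Q"
  shows "(\<Sum>r<Q. indicator {s..<t} r :: real) = real t - real s"
proof -
  have "(\<Sum>r<Q. indicator {s..<t} r :: real) = (\<Sum>r\<in>{s..<t}. 1)"
    by (rule sum.mono_neutral_cong_right) (use assms in auto)
  then show ?thesis using assms by (simp add: of_nat_diff)
qed

context bv_profile begin

text \<open>
  By right continuity \<open>U\<close> stays away from \<open>0\<close> and \<open>1\<close> on a strip to the right of \<open>x1\<close>, which comprises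
  a number of rows proportional to \<open>n\<close>. The number of ones of the blockwise filling misses the
  prescribed one by \<open>D = o(n\<^sup>2)\<close>. Spread over the rows of the strip, this is \<open>q = o(n)\<close> cells per row
  and at most one further cell in some of the rows; the rows of the strip stay mixed.
\<close>

lemma recovery_mixed:
  assumes x1: "0 \<le> x1" "x1 < L" "0 < U x1" "U x1 < 1"
    and k: "(\<lambda>n. real (k n) / (real n)\<^sup>2) \<longlonglongrightarrow> primitive L U L"
  shows "\<exists>a. recovers a k"
proof -
  define \<kappa> where "\<kappa> = min (U x1) (1 - U x1) / 2"
  have \<kappa>: "0 < \<kappa>" "2 * \<kappa> \<le> U x1" "2 * \<kappa> \<le> 1 - U x1" using x1 by (auto simp: \<kappa>_def)
  have "(U \<longlongrightarrow> U x1) (at_right x1)" using right_cont[of x1] by (simp add: continuous_within)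
  then have "\<forall>\<^sub>F y in at_right x1. U x1 - \<kappa> < U y \<and> U y < U x1 + \<kappa>"
    by (intro eventually_conj order_tendstoD) (use \<kappa> in auto)
  then obtain y1 where y1: "y1 > x1" "\<And>y. x1 < y \<Longrightarrow> y < y1 \<Longrightarrow> U x1 - \<kappa> < U y \<and> U y < U x1 + \<kappa>"
    unfolding eventually_at_right_field by blast
  define \<rho> where "\<rho> = (min y1 L - x1) / 2"
  have \<rho>: "0 < \<rho>" "x1 + \<rho> < y1" "x1 + 2 * \<rho> \<le> L" "x1 + \<rho> < L" using y1 x1 by (auto simp: \<rho>_def min_def field_simps)
  have strip: "\<kappa> \<le> U y \<and> U y \<le> 1 - \<kappa>" if "x1 \<le> y" "y \<le> x1 + \<rho>" for y
    using y1(2)[of y] \<kappa> that \<rho> by (cases "y = x1") auto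
  define M where "M = (\<lambda>n. nsites L n)"
  define Q where "Q = (\<lambda>n. M n div n)"
  define r1 where "r1 = (\<lambda>n. nat \<lceil>real n * (x1 + \<rho> / 3)\<rceil>)"
  define r2 where "r2 = (\<lambda>n. nat \<lfloor>real n * (x1 + 2 * \<rho> / 3)\<rfloor>)"
  define b where "b = (\<lambda>n. base_height (block_rows n) n (margin n))"
  have b_le: "b n r \<le> n" for n r unfolding b_def by (rule base_height_bounds(1))
  \<comment> \<open>the number of ones before the correction\<close>
  define S where "S = (\<lambda>n. \<Sum>i\<in>{1..M n}. row_fun n (b n) i)"
  have "S n \<in> \<int>" for n
    unfolding S_def by (intro Ints_sum) (simp add: row_fun_def)
  define D where "D = (\<lambda>n. \<lfloor>real (k n) - S n\<rfloor>)"
  have D: "real_of_int (D n) = real (k n) - S n" for n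
  proof -
    have "real (k n) - S n \<in> \<int>" using \<open>S n \<in> \<int>\<close> by simp
    then obtain z where "real (k n) - S n = real_of_int z" by (elim Ints_cases)
    then show ?thesis by (simp add: D_def)
  qed
  define q where "q = (\<lambda>n. D n div (int (r2 n) - int (r1 n)))"
  define e where "e = (\<lambda>n. nat (D n mod (int (r2 n) - int (r1 n))))"
  define r3 where "r3 = (\<lambda>n. r1 n + e n)"
  \<comment> \<open>the correction is only made where it leads to admissible heights, which is so for all large \<open>n\<close>\<close>
  define good where "good = (\<lambda>n. n > 0 \<and> r1 n < r2 n \<and> r2 n \<le> Q n \<and>
     (\<forall>r\<in>{r1 n..<r2 n}. 0 < b n r \<and> b n r < n \<and> 0 \<le> int (b n r) + q n \<and> int (b n r) + q n + 1 \<le> int n))"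
  define h where "h = (\<lambda>n r. if good n then nat (int (b n r) + (if r \<in> {r1 n..<r2 n} then q n else 0)
     + (if r \<in> {r1 n..<r3 n} then 1 else 0)) else b n r)"
  have S_lim: "(\<lambda>n. S n / (real n)\<^sup>2) \<longlonglongrightarrow> primitive L U L"
    using row_density[of b L, OF b_le] base_height_tendsto L unfolding S_def M_def b_def by (simp add: mult.commute)
  have D_lim: "(\<lambda>n. real_of_int (D n) / (real n)\<^sup>2) \<longlonglongrightarrow> 0"
    using tendsto_diff[OF k S_lim] by (simp add: D diff_divide_distrib)
  have ev_n: "\<forall>\<^sub>F n in sequentially. n > 0 \<and> 24 \<le> real n * \<rho>"
  proof (rule eventually_conj[OF eventually_gt_at_top])
    have "\<forall>\<^sub>F n in sequentially. 24 / \<rho> \<le> real n"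
      using filterlim_real_sequentially unfolding filterlim_at_top by blast
    then show "\<forall>\<^sub>F n in sequentially. 24 \<le> real n * \<rho>"
      by eventually_elim (use \<rho> in \<open>simp add: divide_le_eq\<close>)
  qed
  have r_bounds: "real (r1 n) \<ge> real n * (x1 + \<rho> / 3)" "real (r2 n) \<le> real n * (x1 + 2 * \<rho> / 3)"
    "real (r2 n) - real (r1 n) \<ge> real n * \<rho> / 4" "r2 n \<le> Q n" if n: "n > 0" "24 \<le> real n * \<rho>" for n
  proof -
    have nn: "0 \<le> real n * (x1 + \<rho> / 3)" "0 \<le> real n * (x1 + 2 * \<rho> / 3)" using x1 \<rho> by auto
    show 1: "real (r1 n) \<ge> real n * (x1 + \<rho> / 3)" unfolding r1_def by linarith
    show 2: "real (r2 n) \<le> real n * (x1 + 2 * \<rho> / 3)" unfolding r2_def using nn by linarith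
    have "real (r1 n) \<le> real n * (x1 + \<rho> / 3) + 1" unfolding r1_def using nn by linarith
    moreover have "real (r2 n) \<ge> real n * (x1 + 2 * \<rho> / 3) - 1" unfolding r2_def using nn by linarith
    ultimately show "real (r2 n) - real (r1 n) \<ge> real n * \<rho> / 4" using n by (simp add: algebra_simps)
    have "L * (real n)\<^sup>2 < real (M n) + 1" unfolding M_def by linarith
    moreover have "M n + 1 \<le> Q n * n + n"
      using div_mult_mod_eq[of "M n" n] mod_less_divisor[OF n(1), of "M n"] unfolding Q_def by linarith
    then have "real (M n) + 1 \<le> real (Q n) * real n + real n"
      by (metis of_nat_1 of_nat_add of_nat_le_iff of_nat_mult)
    ultimately have "(L * real n) * real n < (real (Q n) + 1) * real n"
      by (simp add: power2_eq_square algebra_simps)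
    then have "L * real n < real (Q n) + 1" using n by (simp add: mult_less_cancel_right)
    moreover have "real n * (x1 + 2 * \<rho>) \<le> real n * L" using \<rho> by (intro mult_left_mono) auto
    ultimately have "real n * x1 + 2 * (real n * \<rho>) < real (Q n) + 1" by (simp add: algebra_simps)
    moreover have "real (r2 n) \<le> real n * x1 + 2 * (real n * \<rho>) / 3" using 2 by (simp add: algebra_simps)
    ultimately have "real (r2 n) \<le> real (Q n)" using n(2) by linarith
    then show "r2 n \<le> Q n" by simp
  qed
  have q_le: "\<bar>real_of_int (q n) / real n\<bar> \<le> 4 / \<rho> * \<bar>real_of_int (D n) / (real n)\<^sup>2\<bar> + 1 / real n"
    if n: "n > 0" "24 \<le> real n * \<rho>" for n
  proof -
    define R where "R = int (r2 n) - int (r1 n)"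
    have R: "real_of_int R \<ge> real n * \<rho> / 4" "real n * \<rho> / 4 > 0"
      using r_bounds(3)[OF n] n \<rho> by (auto simp: R_def)
    have "q n = \<lfloor>real_of_int (D n) / real_of_int R\<rfloor>" unfolding q_def R_def by (rule floor_divide_of_int_eq[symmetric])
    then have "\<bar>real_of_int (q n)\<bar> \<le> \<bar>real_of_int (D n) / real_of_int R\<bar> + 1" by linarith
    also have "\<bar>real_of_int (D n) / real_of_int R\<bar> \<le> \<bar>real_of_int (D n)\<bar> / (real n * \<rho> / 4)"
      using R by (subst abs_divide) (intro frac_le; simp)
    finally have "\<bar>real_of_int (q n)\<bar> / real n \<le> (\<bar>real_of_int (D n)\<bar> / (real n * \<rho> / 4) + 1) / real n"
      by (intro divide_right_mono) auto
    also have "\<dots> = 4 / \<rho> * \<bar>real_of_int (D n) / (real n)\<^sup>2\<bar> + 1 / real n"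
      using n \<rho> by (simp add: field_simps power2_eq_square abs_divide)
    finally show ?thesis by (simp add: abs_divide)
  qed
  have q_lim: "(\<lambda>n. real_of_int (q n) / real n) \<longlonglongrightarrow> 0"
  proof (rule Lim_null_comparison)
    show "\<forall>\<^sub>F n in sequentially. norm (real_of_int (q n) / real n) \<le> 4 / \<rho> * \<bar>real_of_int (D n) / (real n)\<^sup>2\<bar> + 1 / real n"
      using ev_n by eventually_elim (use q_le in simp)
    have "(\<lambda>n. 4 / \<rho> * \<bar>real_of_int (D n) / (real n)\<^sup>2\<bar> + 1 / real n) \<longlonglongrightarrow> 4 / \<rho> * \<bar>0\<bar> + 0"
      by (intro tendsto_add tendsto_mult tendsto_const tendsto_rabs D_lim) real_asymp
    then show "(\<lambda>n. 4 / \<rho> * \<bar>real_of_int (D n) / (real n)\<^sup>2\<bar> + 1 / real n) \<longlonglongrightarrow> 0" by simp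
  qed
  have ev_good: "\<forall>\<^sub>F n in sequentially. good n"
  proof -
    have l: "(\<lambda>n. (real n powr (1/3) + 1) / real n) \<longlonglongrightarrow> 0" "margin \<longlonglongrightarrow> 0" "(\<lambda>n. 3 / real n) \<longlonglongrightarrow> 0"
      unfolding margin_def by real_asymp+
    have "\<forall>\<^sub>F n in sequentially. (real n powr (1/3) + 1) / real n < \<rho> / 3"
      by (rule order_tendstoD(2)[OF l(1)]) (use \<rho> in simp)
    moreover have "\<forall>\<^sub>F n in sequentially. margin n < \<kappa> / 2"
      by (rule order_tendstoD(2)[OF l(2)]) (use \<kappa> in simp)
    moreover have "\<forall>\<^sub>F n in sequentially. 3 / real n < \<kappa> / 4"
      by (rule order_tendstoD(2)[OF l(3)]) (use \<kappa> in simp)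
    moreover have "\<forall>\<^sub>F n in sequentially. \<bar>real_of_int (q n) / real n\<bar> < \<kappa> / 4"
      by (rule order_tendstoD(2)[OF tendsto_rabs_zero[OF q_lim]]) (use \<kappa> in simp)
    moreover note ev_n
    ultimately show ?thesis
    proof eventually_elim
      case (elim n)
      then have n: "n > 0" "24 \<le> real n * \<rho>" and n0: "real n > 0" by auto
      note rb = r_bounds[OF n] and Bb = block_rows_bounds[OF n(1)]
      have qn: "\<bar>real_of_int (q n)\<bar> \<le> real n * \<kappa> / 4" "3 \<le> real n * \<kappa> / 4"
        using elim n0 by (auto simp: abs_divide field_simps)
      have "real n * \<rho> / 4 > 0" using n by simp
      then have "r1 n < r2 n" using rb(3) by linarith
      moreover have "0 < b n r \<and> b n r < n \<and> 0 \<le> int (b n r) + q n \<and> int (b n r) + q n + 1 \<le> int n"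
        if r: "r \<in> {r1 n..<r2 n}" for r
      proof -
        let ?s = "sample_point (block_rows n) n r"
        note sb = sample_point_bounds[OF Bb(1) n(1), of r]
        have "real n * (x1 + \<rho> / 3) \<le> real r" "real r \<le> real n * (x1 + 2 * \<rho> / 3)" using rb r by auto
        then have "x1 + \<rho> / 3 \<le> real r / real n" "real r / real n \<le> x1 + 2 * \<rho> / 3"
          using n0 by (simp_all add: le_divide_eq divide_le_eq mult.commute)
        moreover have "real (block_rows n) / real n \<le> \<rho> / 3"
        proof -
          have "real (block_rows n) / real n \<le> (real n powr (1/3) + 1) / real n"
            using Bb(3) by (intro divide_right_mono) auto
          then show ?thesis using elim by linarith
        qed
        ultimately have "x1 \<le> ?s" "?s \<le> x1 + \<rho>" using sb(2,3) \<rho> by (auto simp: diff_divide_distrib)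
        then have U: "\<kappa> \<le> U ?s" "U ?s \<le> 1 - \<kappa>" using strip by auto
        then have "\<bar>clamp (margin n) (U ?s) - U ?s\<bar> \<le> margin n" using Bb(4) \<kappa> by (intro clamp_near) auto
        then have c: "\<kappa> / 2 \<le> clamp (margin n) (U ?s)" "clamp (margin n) (U ?s) \<le> 1 - \<kappa> / 2" using elim U by linarith+
        have "real n * (\<kappa> / 2) \<le> real n * clamp (margin n) (U ?s)" "real n * clamp (margin n) (U ?s) \<le> real n * (1 - \<kappa> / 2)"
          using mult_left_mono[OF c(1), of "real n"] mult_left_mono[OF c(2), of "real n"] by simp_all
        then have "real n * \<kappa> / 2 - 1 \<le> real (b n r)" "real (b n r) \<le> real n - real n * \<kappa> / 2"
          using base_height_bounds(2,3)[where B="block_rows n" and n=n and \<delta>="margin n" and r=r]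
          unfolding b_def by (auto simp: algebra_simps)
        then have "0 < real (b n r)" "real (b n r) < real n" "0 \<le> real (b n r) + real_of_int (q n)"
          "real (b n r) + real_of_int (q n) + 1 \<le> real n" using qn by linarith+
        then show ?thesis by linarith
      qed
      ultimately show ?case unfolding good_def using n rb(4) by blast
    qed
  qed
  have h_adj: "real (h n r) = real (b n r) + real_of_int (q n) * indicator {r1 n..<r2 n} r + indicator {r1 n..<r3 n} r"
    and h_le: "h n r \<le> n" and r3: "r3 n \<le> r2 n" if g: "good n" for n r
  proof -
    have R: "int (r2 n) - int (r1 n) > 0" using g by (auto simp: good_def)
    have "D n mod (int (r2 n) - int (r1 n)) < int (r2 n) - int (r1 n)" "0 \<le> D n mod (int (r2 n) - int (r1 n))"
      using R by auto
    then show r32: "r3 n \<le> r2 n" unfolding r3_def e_def by linarith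
    have "real (h n r) = real (b n r) + real_of_int (q n) * indicator {r1 n..<r2 n} r + indicator {r1 n..<r3 n} r \<and> h n r \<le> n"
    proof (cases "r \<in> {r1 n..<r2 n}")
      case True
      then have "0 \<le> int (b n r) + q n" "int (b n r) + q n + 1 \<le> int n" using g by (auto simp: good_def)
      then show ?thesis using g True by (auto simp: h_def)
    next
      case False
      then have "r \<notin> {r1 n..<r3 n}" using r32 by auto
      then have "h n r = b n r" unfolding h_def if_not_P[OF False] if_not_P[OF \<open>r \<notin> {r1 n..<r3 n}\<close>] by simp
      then show ?thesis using False \<open>r \<notin> {r1 n..<r3 n}\<close> b_le by simp
    qed
    then show "real (h n r) = real (b n r) + real_of_int (q n) * indicator {r1 n..<r2 n} r + indicator {r1 n..<r3 n} r"
      "h n r \<le> n" by auto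
  qed
  have h_le': "h n r \<le> n" for n r using h_le[of n r] b_le by (cases "good n") (auto simp: h_def)
  have h_lim: "(\<lambda>n. real (h n (nat \<lceil>real n * x\<rceil> - 1)) / real n) \<longlonglongrightarrow> U x" if x: "x \<in> {0<..<L}" "isCont U x" for x
  proof -
    have "(\<lambda>n. real (h n (nat \<lceil>real n * x\<rceil> - 1)) / real n - real (b n (nat \<lceil>real n * x\<rceil> - 1)) / real n) \<longlonglongrightarrow> 0"
    proof (rule Lim_null_comparison)
      show "\<forall>\<^sub>F n in sequentially. norm (real (h n (nat \<lceil>real n * x\<rceil> - 1)) / real n - real (b n (nat \<lceil>real n * x\<rceil> - 1)) / real n)
        \<le> \<bar>real_of_int (q n) / real n\<bar> + 1 / real n"
        using ev_good
      proof eventually_elim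
        case (elim n)
        define r where "r = nat \<lceil>real n * x\<rceil> - 1"
        have "\<bar>real (h n r) - real (b n r)\<bar> \<le> \<bar>real_of_int (q n)\<bar> + 1"
          unfolding h_adj[OF elim] by (auto simp: indicator_def)
        then have "\<bar>real (h n r) - real (b n r)\<bar> / real n \<le> (\<bar>real_of_int (q n)\<bar> + 1) / real n"
          by (intro divide_right_mono) auto
        then show ?case unfolding r_def[symmetric] real_norm_def
          by (simp add: abs_divide diff_divide_distrib[symmetric] add_divide_distrib)
      qed
      have "(\<lambda>n. \<bar>real_of_int (q n) / real n\<bar> + 1 / real n) \<longlonglongrightarrow> \<bar>0\<bar> + 0"
        by (intro tendsto_add tendsto_rabs q_lim) real_asymp
      then show "(\<lambda>n. \<bar>real_of_int (q n) / real n\<bar> + 1 / real n) \<longlonglongrightarrow> 0" by simp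
    qed
    from tendsto_add[OF this base_height_tendsto[OF x, folded b_def]] show ?thesis unfolding b_def by simp
  qed
  have "recovers (\<lambda>n. row_fun n (h n)) k"
    unfolding recovers_def
  proof (intro conjI allI impI)
    show "row_fun n (h n) i \<in> {0, 1}" for n i by (rule row_fun_values)
    show "(\<lambda>n. density n (row_fun n (h n)) t)
        \<longlonglongrightarrow> primitive L U t" if "0 \<le> t" "t \<le> L" for t
      by (rule row_density[OF h_le' h_lim that])
    show "\<forall>\<^sub>F n in sequentially. (\<Sum>i\<in>{1..nsites L n}. row_fun n (h n) i) = real (k n)"
      using ev_good
    proof eventually_elim
      case (elim n)
      then have g: "n > 0" "r1 n < r2 n" "r2 n \<le> Q n" by (auto simp: good_def)
      have "h n (Q n) = b n (Q n)"
        using h_adj[OF elim, of "Q n"] g r3[OF elim] by (simp add: indicator_def)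
      then have "(\<Sum>i\<in>{1..M n}. row_fun n (h n) i) - S n = (\<Sum>r<Q n. real (h n r) - real (b n r))"
        unfolding S_def Q_def by (intro sum_row_fun_diff g h_le' b_le) auto
      also have "\<dots> = real_of_int (q n) * (\<Sum>r<Q n. indicator {r1 n..<r2 n} r) + (\<Sum>r<Q n. indicator {r1 n..<r3 n} r)"
        unfolding h_adj[OF elim] by (simp add: sum.distrib sum_distrib_left)
      also have "\<dots> = real_of_int (q n) * (real (r2 n) - real (r1 n)) + real (e n)"
        using g r3[OF elim] by (simp add: sum_indicator_interval r3_def)
      also have "\<dots> = real_of_int (q n * (int (r2 n) - int (r1 n)) + D n mod (int (r2 n) - int (r1 n)))"
        using g unfolding e_def by simp
      also have "\<dots> = real_of_int (D n)" by (simp only: q_def div_mult_mod_eq)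
      finally show ?case unfolding D M_def by simp
    qed
    fix \<epsilon> :: real assume \<epsilon>: "\<epsilon> > 0"
    have QL: "real (Q n) \<le> real n * L" for n
    proof (cases "n = 0")
      case False
      have "real (Q n) * real n \<le> real (M n)" unfolding Q_def by (simp add: of_nat_mult[symmetric] del: of_nat_mult)
      also have "\<dots> \<le> L * (real n)\<^sup>2" unfolding M_def using L by simp
      finally have "real (Q n) * real n \<le> (real n * L) * real n" by (simp add: power2_eq_square mult.commute mult.left_commute)
      then show ?thesis using False by (simp add: mult_le_cancel_right)
    qed (simp add: Q_def)
    show "\<forall>\<^sub>F n in sequentially. helix_energy L n (row_fun n (h n))
        \<le> 2 * mixed_length + V + \<epsilon>"
      using ev_good energy_bound_tendsto[of "\<lambda>n. real_of_int (q n)" Q, OF q_lim QL, rule_format, OF \<epsilon>]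
    proof eventually_elim
      case (elim n)
      then have g: "n > 0" by (auto simp: good_def)
      note Bb = block_rows_bounds[OF g]
      have "near_sum (row_fun n (h n)) (nsites L n) + far_sum (row_fun n (h n)) n (nsites L n)
        \<le> 2 * (real n * mixed_length + 2 + 3 * real (block_rows n) * \<Lambda> / margin n) + real (Suc (Q n)) / real (block_rows n) + 4
      + (real n * (1 + 2 * margin n) * V + real (Q n) / real (block_rows n) + 2 * \<bar>real_of_int (q n)\<bar> + 2)"
      proof (rule adjusted_energy[OF g Bb(1,4,5) _ QL h_le' h_adj[OF elim(1), unfolded b_def] _ r3[OF elim(1)]])
        show "Q n = nsites L n div n" by (simp add: Q_def M_def)
        show "0 < base_height (block_rows n) n (margin n) r \<and> base_height (block_rows n) n (margin n) r < n" if "r \<in> {r1 n..<r2 n}" for r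
          using elim(1) that by (simp add: good_def b_def)
      qed
      then have "helix_energy L n (row_fun n (h n))
        \<le> (2 * (real n * mixed_length + 2 + 3 * real (block_rows n) * \<Lambda> / margin n) + real (Suc (Q n)) / real (block_rows n) + 4
      + (real n * (1 + 2 * margin n) * V + real (Q n) / real (block_rows n) + 2 * \<bar>real_of_int (q n)\<bar> + 2)) / real n"
        by (rule divide_right_mono) simp
      then show ?case using elim(2) by linarith
    qed
  qed
  then show ?thesis by blast
qed

end

section \<open>Profiles with values 0 and 1\<close>

lemma sum_of_bool_le:
  fixes p q z :: nat
  assumes "p \<le> z" "z \<le> q"
  shows "(\<Sum>i\<in>{p<..q}. of_bool (i \<le> z) :: real) = real z - real p"
proof -
  have "(\<Sum>i\<in>{p<..q}. of_bool (i \<le> z) :: real) = (\<Sum>i\<in>{p<..z}. 1)"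
    by (rule sum.mono_neutral_cong_right) (use assms in auto)
  then show ?thesis using assms by (simp add: of_nat_diff)
qed

lemma le_nat_ceiling_iff:
  assumes "i \<ge> 1"
  shows "i \<le> nat \<lceil>w\<rceil> \<longleftrightarrow> real i - 1 < w"
proof -
  have "i \<le> nat \<lceil>w\<rceil> \<longleftrightarrow> int i \<le> \<lceil>w\<rceil>" using assms by linarith
  then show ?thesis by (simp add: le_ceiling_iff)
qed

context bv_profile begin

text \<open>
  By right continuity the infimum of the points with a value different from \<open>U 0\<close> belongs to them.
\<close>

lemma first_jump:
  assumes U01: "\<And>x. 0 \<le> x \<Longrightarrow> x < L \<Longrightarrow> U x \<in> {0, 1}" and z: "0 \<le> z" "z < L" "U z \<noteq> U 0"
  obtains x0 \<eta> where "0 < \<eta>" "\<eta> \<le> x0" "x0 + \<eta> < L"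
    "\<And>x. 0 \<le> x \<Longrightarrow> x < x0 \<Longrightarrow> U x = U 0" "\<And>x. x0 \<le> x \<Longrightarrow> x < x0 + \<eta> \<Longrightarrow> U x = 1 - U 0"
proof -
  define S where "S = {x. 0 \<le> x \<and> x < L \<and> U x \<noteq> U 0}"
  define x0 where "x0 = Inf S"
  have S: "z \<in> S" "bdd_below S" using z by (auto simp: S_def intro: bdd_belowI[of _ 0])
  have x0: "0 \<le> x0" "x0 \<le> z" unfolding x0_def using S by (auto intro!: cInf_greatest cInf_lower simp: S_def)
  have before: "U x = U 0" if "0 \<le> x" "x < x0" for x
  proof (rule ccontr)
    assume "U x \<noteq> U 0"
    then have "x \<in> S" using that x0 z by (auto simp: S_def)
    then show False using cInf_lower[OF _ S(2)] that by (fastforce simp: x0_def)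
  qed
  have rc: "\<exists>b>x. \<forall>y. x < y \<longrightarrow> y < b \<longrightarrow> \<bar>U y - U x\<bar> < 1" for x
  proof -
    have "(U \<longlongrightarrow> U x) (at_right x)" using right_cont[of x] by (simp add: continuous_within)
    then have "\<forall>\<^sub>F y in at_right x. dist (U y) (U x) < 1" by (rule tendstoD) simp
    then show ?thesis unfolding eventually_at_right_field dist_real_def by blast
  qed
  obtain b where b: "b > x0" "\<And>y. x0 < y \<Longrightarrow> y < b \<Longrightarrow> \<bar>U y - U x0\<bar> < 1" using rc by blast
  have after: "U y = U x0" if "x0 \<le> y" "y < min b L" for y
  proof (cases "y = x0")
    case False
    then have "\<bar>U y - U x0\<bar> < 1" using b(2)[of y] that by auto
    moreover have "U y \<in> {0, 1}" "U x0 \<in> {0, 1}" using U01 x0 z that by auto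
    ultimately show ?thesis by auto
  qed simp
  have ne: "U x0 \<noteq> U 0"
  proof
    assume eq: "U x0 = U 0"
    have "min b L \<le> x0" unfolding x0_def
    proof (rule cInf_greatest)
      show "S \<noteq> {}" using S by auto
      fix y assume y: "y \<in> S"
      then have "x0 \<le> y" unfolding x0_def using S by (intro cInf_lower)
      then show "min b L \<le> y" using after[of y] y eq by (force simp: S_def)
    qed
    then show False using b x0 z by auto
  qed
  then have "x0 > 0" using x0(1) by (cases "x0 = 0") auto
  have "U x0 \<in> {0, 1}" "U 0 \<in> {0, 1}" using U01 x0 z L by auto
  with ne have x0v: "U x0 = 1 - U 0" by auto
  define c where "c = min b L"
  define \<eta> where "\<eta> = min x0 ((c - x0) / 2)"
  have "x0 < c" using b x0 z by (auto simp: c_def)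
  then have \<eta>1: "0 < \<eta>" "\<eta> \<le> x0" using \<open>x0 > 0\<close> by (simp_all add: \<eta>_def)
  have "\<eta> \<le> (c - x0) / 2" unfolding \<eta>_def by (rule min.cobounded2)
  also have "\<dots> < c - x0" using \<open>x0 < c\<close> by simp
  finally have "x0 + \<eta> < c" by simp
  then have \<eta>: "0 < \<eta>" "\<eta> \<le> x0" "x0 + \<eta> < min b L" using \<eta>1 by (simp_all only: c_def)
  show thesis
  proof (rule that[OF \<eta>(1,2) _ before])
    show "x0 + \<eta> < L" using \<eta>(3) by simp
    show "U x = 1 - U 0" if "x0 \<le> x" "x < x0 + \<eta>" for x
      using after[of x] that \<eta>(3) x0v by simp
  qed
qed

text \<open>
  Sampling \<open>U\<close> along an increasing sequence of points cannot increase its variation \<open>V\<close>, and a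
  sequence of values \<open>0\<close> and \<open>1\<close> with variation \<open>V\<close> has at most \<open>n V\<close> jumping bonds of length \<open>n\<close>. The
  sample points are the left ends \<open>y n i\<close> of the cells, except for the sites \<open>p n < i \<le> q n\<close> around
  the first jump \<open>x0\<close>: the first \<open>m n\<close> of them use \<open>x0 - \<eta>\<close> and the others \<open>x0\<close>. The choice of \<open>m n\<close>
  decides where the jump takes place and thereby adjusts the number of ones.
\<close>

lemma recovery_pure:
  assumes U01: "\<And>x. 0 \<le> x \<Longrightarrow> x < L \<Longrightarrow> U x \<in> {0, 1}" and z: "0 \<le> z" "z < L" "U z \<noteq> U 0"
    and k: "(\<lambda>n. real (k n) / (real n)\<^sup>2) \<longlonglongrightarrow> primitive L U L"
  shows "\<exists>a. recovers a k"
proof -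
  obtain x0 \<eta> where x0: "0 < \<eta>" "\<eta> \<le> x0" "x0 + \<eta> < L"
    and before: "\<And>x. 0 \<le> x \<Longrightarrow> x < x0 \<Longrightarrow> U x = U 0"
    and after: "\<And>x. x0 \<le> x \<Longrightarrow> x < x0 + \<eta> \<Longrightarrow> U x = 1 - U 0"
  proof (rule first_jump[of z])
    show "U x \<in> {0, 1}" if "0 \<le> x" "x < L" for x by (rule U01[OF that])
    show "0 \<le> z" "z < L" "U z \<noteq> U 0" by (rule z)+
  qed (rule that)
  define \<alpha> where "\<alpha> = U 0"
  have \<alpha>: "\<alpha> \<in> {0, 1}" using U01[of 0] L by (simp add: \<alpha>_def)
  define M where "M = (\<lambda>n. nsites L n)"
  define y where "y = (\<lambda>(n::nat) (i::nat). (real i - 1) / (real n)\<^sup>2)"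
  define p where "p = (\<lambda>n::nat. nat \<lceil>(real n)\<^sup>2 * (x0 - \<eta>)\<rceil>)"
  define s where "s = (\<lambda>n::nat. nat \<lceil>(real n)\<^sup>2 * x0\<rceil>)"
  define q where "q = (\<lambda>n::nat. nat \<lceil>(real n)\<^sup>2 * (x0 + \<eta>)\<rceil>)"
  have cut: "i \<le> nat \<lceil>(real n)\<^sup>2 * w\<rceil> \<longleftrightarrow> y n i < w" if "n > 0" "i \<ge> 1" for n i w
  proof -
    have "0 < (real n)\<^sup>2" using that by simp
    then show ?thesis
      unfolding le_nat_ceiling_iff[OF that(2)] y_def by (simp only: pos_divide_less_eq mult.commute)
  qed
  define S where "S = (\<lambda>n. \<Sum>i\<in>{1..M n}. of_bool (U (y n i) = 1) :: real)"
  define D where "D = (\<lambda>n. real (k n) - S n)"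
  \<comment> \<open>moving the jump to the right by one site changes the number of ones by \<open>2 \<alpha> - 1\<close>\<close>
  define m where "m = (\<lambda>n. nat \<lfloor>real (s n) - real (p n) + (2 * \<alpha> - 1) * D n\<rfloor>)"
  define \<gamma> where "\<gamma> = (\<lambda>n i. if p n < i \<and> i \<le> q n then (if i \<le> p n + m n then x0 - \<eta> else x0) else y n i)"
  define a where "a = (\<lambda>n i. of_bool (U (\<gamma> n i) = 1) :: real)"
  define good where "good = (\<lambda>n. n > 0 \<and> q n \<le> M n \<and> real (m n) = real (s n) - real (p n) + (2 * \<alpha> - 1) * D n \<and> p n + m n \<le> q n)"
  have psq: "p n \<le> s n" "s n \<le> q n" for n
  proof -
    have "(real n)\<^sup>2 * (x0 - \<eta>) \<le> (real n)\<^sup>2 * x0" "(real n)\<^sup>2 * x0 \<le> (real n)\<^sup>2 * (x0 + \<eta>)"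
      using x0 by (auto intro: mult_left_mono)
    from this[THEN ceiling_mono, THEN nat_mono] show "p n \<le> s n" "s n \<le> q n" unfolding p_def s_def q_def .
  qed
  have y_range: "0 \<le> y n i" "y n i < L" if "n > 0" "i \<in> {1..M n}" for n i
  proof -
    show "0 \<le> y n i" using that by (simp add: y_def)
    have "real i \<le> L * (real n)\<^sup>2" using that le_nat_floor_iff[of i "L * (real n)\<^sup>2"] by (simp add: M_def)
    then have "real i - 1 < L * (real n)\<^sup>2" by linarith
    then show "y n i < L" using that by (simp add: y_def divide_less_eq)
  qed
  have Uy: "of_bool (U x = 1) = U x" if "0 \<le> x" "x < L" for x using U01[OF that] by auto
  have \<gamma>_range: "0 \<le> \<gamma> n i \<and> \<gamma> n i < L" if "n > 0" "i \<in> {1..M n}" for n i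
    using y_range[OF that] x0 by (auto simp: \<gamma>_def)
  have a_eq: "a n i = U (\<gamma> n i)" if "n > 0" "i \<in> {1..M n}" for n i
    using Uy \<gamma>_range[OF that] by (simp add: a_def)
  have y_lim: "(\<lambda>n. y n (nat \<lceil>(real n)\<^sup>2 * x\<rceil>)) \<longlonglongrightarrow> x" and y_le: "\<And>n. n > 0 \<Longrightarrow> y n (nat \<lceil>(real n)\<^sup>2 * x\<rceil>) < x"
    if x: "x \<in> {0<..<L}" for x
  proof -
    have b: "x - 1 / (real n)\<^sup>2 \<le> y n (nat \<lceil>(real n)\<^sup>2 * x\<rceil>) \<and> y n (nat \<lceil>(real n)\<^sup>2 * x\<rceil>) < x" if "n > 0" for n
    proof -
      have "0 < (real n)\<^sup>2 * x" using x that by simp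
      define c where "c = real (nat \<lceil>(real n)\<^sup>2 * x\<rceil>) - 1"
      have c: "(real n)\<^sup>2 * x - 1 \<le> c" "c < (real n)\<^sup>2 * x"
        unfolding c_def using \<open>0 < (real n)\<^sup>2 * x\<close> by linarith+
      have "((real n)\<^sup>2 * x - 1) / (real n)\<^sup>2 \<le> c / (real n)\<^sup>2" using c by (intro divide_right_mono) auto
      moreover have "c / (real n)\<^sup>2 < ((real n)\<^sup>2 * x) / (real n)\<^sup>2" using c that by (intro divide_strict_right_mono) auto
      moreover have "y n (nat \<lceil>(real n)\<^sup>2 * x\<rceil>) = c / (real n)\<^sup>2" by (simp add: y_def c_def)
      ultimately show ?thesis using that by (simp add: diff_divide_distrib)
    qed
    show "n > 0 \<Longrightarrow> y n (nat \<lceil>(real n)\<^sup>2 * x\<rceil>) < x" for n using b by blast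
    show "(\<lambda>n. y n (nat \<lceil>(real n)\<^sup>2 * x\<rceil>)) \<longlonglongrightarrow> x"
    proof (rule tendsto_sandwich)
      show "\<forall>\<^sub>F n in sequentially. x - 1 / (real n)\<^sup>2 \<le> y n (nat \<lceil>(real n)\<^sup>2 * x\<rceil>)"
        "\<forall>\<^sub>F n in sequentially. y n (nat \<lceil>(real n)\<^sup>2 * x\<rceil>) \<le> x"
        using eventually_gt_at_top[of 0] by (eventually_elim, use b in \<open>auto intro: less_imp_le\<close>)+
      show "(\<lambda>n. x - 1 / (real n)\<^sup>2) \<longlonglongrightarrow> x" by real_asymp
    qed simp
  qed
  have density: "(\<lambda>n. density n (f n) t) \<longlonglongrightarrow> primitive L U t"
    if f: "\<And>n i. f n i \<in> {0, 1}" and lim: "\<And>x. x \<in> {0<..<L} \<Longrightarrow> x \<noteq> x0 \<Longrightarrow>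
        \<forall>\<^sub>F n in sequentially. f n (nat \<lceil>(real n)\<^sup>2 * x\<rceil>) = U (y n (nat \<lceil>(real n)\<^sup>2 * x\<rceil>))"
      and t: "0 \<le> t" "t \<le> L" for f :: "nat \<Rightarrow> nat \<Rightarrow> real" and t
  proof -
    have f1: "\<bar>f n i\<bar> \<le> 1" for n i using f[of n i] by auto
    have "(\<lambda>n. primitive L (cell_fun ((real n)\<^sup>2) (f n)) t) \<longlonglongrightarrow> primitive L U t"
    proof (rule integral_tendsto_of_AE_tendsto[where K=1 and D="{x0}"])
      show "(\<lambda>n. cell_fun ((real n)\<^sup>2) (f n) x) \<longlonglongrightarrow> U x" if x: "x \<in> {0<..<L}" "isCont U x" "x \<notin> {x0}" for x
      proof -
        have "(\<lambda>n. U (y n (nat \<lceil>(real n)\<^sup>2 * x\<rceil>))) \<longlonglongrightarrow> U x"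
          by (rule isCont_tendsto_compose[OF x(2) y_lim[OF x(1)]])
        moreover have "\<forall>\<^sub>F n in sequentially. U (y n (nat \<lceil>(real n)\<^sup>2 * x\<rceil>)) = cell_fun ((real n)\<^sup>2) (f n) x"
          using lim[OF x(1)] x(3) by (auto simp: cell_fun_def elim: eventually_mono)
        ultimately show ?thesis by (rule Lim_transform_eventually)
      qed
    qed (use f1 in \<open>auto simp: cell_fun_def intro: cell_fun_measurable[unfolded cell_fun_def]\<close>)
    from tendsto_diff[OF this primitive_minus_density[of f, OF f1 t]] show ?thesis by simp
  qed
  have S_lim: "(\<lambda>n. S n / (real n)\<^sup>2) \<longlonglongrightarrow> primitive L U L"
  proof -
    have "(\<lambda>n. (\<Sum>i\<in>{1..nat \<lfloor>(real n)\<^sup>2 * L\<rfloor>}. of_bool (U (y n i) = 1)) / (real n)\<^sup>2) \<longlonglongrightarrow> primitive L U L"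
    proof (rule density)
      fix x assume x: "x \<in> {0<..<L}"
      have "\<forall>\<^sub>F n in sequentially. 0 < y n (nat \<lceil>(real n)\<^sup>2 * x\<rceil>)"
        by (rule order_tendstoD(1)[OF y_lim[OF x]]) (use x in simp)
      then show "\<forall>\<^sub>F n in sequentially. of_bool (U (y n (nat \<lceil>(real n)\<^sup>2 * x\<rceil>)) = 1) = U (y n (nat \<lceil>(real n)\<^sup>2 * x\<rceil>))"
        using eventually_gt_at_top[of 0]
      proof eventually_elim
        case (elim n)
        then show ?case using y_le[OF x elim(2)] x by (intro Uy) auto
      qed
    qed (use L in auto)
    then show ?thesis unfolding S_def M_def by (simp add: mult.commute)
  qed
  have D_lim: "(\<lambda>n. D n / (real n)\<^sup>2) \<longlonglongrightarrow> 0"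
    using tendsto_diff[OF k S_lim] by (simp add: D_def diff_divide_distrib)
  have D_small: "\<forall>\<^sub>F n in sequentially. n > 0 \<and> \<bar>D n\<bar> + 2 \<le> c * (real n)\<^sup>2" if "c > 0" for c
  proof -
    have "(\<lambda>n. \<bar>D n / (real n)\<^sup>2\<bar> + 2 / (real n)\<^sup>2) \<longlonglongrightarrow> 0 + 0"
      by (intro tendsto_add tendsto_rabs_zero D_lim) real_asymp
    then have "\<forall>\<^sub>F n in sequentially. \<bar>D n / (real n)\<^sup>2\<bar> + 2 / (real n)\<^sup>2 < c"
      using that by (intro order_tendstoD(2)[where y=0]) auto
    then show ?thesis using eventually_gt_at_top[of 0]
      by eventually_elim (simp add: field_simps)
  qed
  have sD: "\<bar>(2 * \<alpha> - 1) * D n\<bar> = \<bar>D n\<bar>" for n using \<alpha> by auto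
  have D_int: "(2 * \<alpha> - 1) * D n \<in> \<int>" for n
    using \<alpha> unfolding D_def S_def by (auto intro!: Ints_mult Ints_diff Ints_sum)
  have "L - x0 - \<eta> > 0" using x0 by simp
  from D_small[OF x0(1)] D_small[OF this] have ev_good: "\<forall>\<^sub>F n in sequentially. good n"
  proof eventually_elim
    case (elim n)
    then have n: "n > 0" by simp
    let ?N = "(real n)\<^sup>2"
    have N: "0 \<le> ?N * (x0 - \<eta>)" "0 \<le> ?N * x0" "0 \<le> ?N * (x0 + \<eta>)" using x0 by auto
    have b: "real (p n) < ?N * (x0 - \<eta>) + 1" "?N * x0 \<le> real (s n)" "real (s n) < ?N * x0 + 1"
      "?N * (x0 + \<eta>) \<le> real (q n)" "real (q n) < ?N * (x0 + \<eta>) + 1"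
      unfolding p_def s_def q_def using N by linarith+
    have "?N * (x0 + \<eta>) + 2 \<le> L * ?N" using elim by (simp add: algebra_simps) linarith
    moreover have "L * ?N < real (M n) + 1" unfolding M_def by linarith
    ultimately have "q n \<le> M n" using b by linarith
    let ?w = "real (s n) - real (p n) + (2 * \<alpha> - 1) * D n"
    have "\<bar>D n\<bar> + 2 \<le> ?N * \<eta>" using elim by (simp add: mult.commute)
    then have w: "0 \<le> ?w" "real (p n) + ?w \<le> real (q n)"
      using sD[of n] b by (auto simp: algebra_simps abs_le_iff)
    have "?w \<in> \<int>" using D_int by (intro Ints_add Ints_diff) auto
    then obtain i where "?w = real_of_int i" by (elim Ints_cases)
    then have "real (m n) = ?w" using w unfolding m_def by simp
    then show ?case using n \<open>q n \<le> M n\<close> w unfolding good_def by linarith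
  qed
  have near_V: "near_sum (a n) (M n) \<le> V" if g: "good n" for n
  proof -
    have n: "n > 0" using g by (simp add: good_def)
    have mono_y: "y n i \<le> y n j" if "i \<le> j" for i j
      using that by (auto simp: y_def intro: divide_right_mono)
    have mono_\<gamma>: "\<gamma> n i \<le> \<gamma> n j" if ij: "1 \<le> i" "i \<le> j" for i j
    proof -
      have "1 \<le> j" using ij by simp
      then have pi: "i \<le> p n \<Longrightarrow> y n i < x0 - \<eta>" and qj: "\<not> j \<le> q n \<Longrightarrow> x0 + \<eta> \<le> y n j"
        using cut[OF n, of i "x0 - \<eta>"] cut[OF n, of j "x0 + \<eta>"] ij by (simp_all add: p_def q_def)
      note yy = mono_y[OF ij(2)]
      consider "i \<le> p n" | "p n < i" "j \<le> q n" | "p n < i" "i \<le> q n" "\<not> j \<le> q n" | "\<not> i \<le> q n" by linarith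
      then show ?thesis
      proof cases
        case 1
        then have "\<gamma> n i = y n i" by (simp add: \<gamma>_def)
        moreover have "\<gamma> n j \<in> {y n j, x0 - \<eta>, x0}" by (simp add: \<gamma>_def)
        ultimately show ?thesis using pi[OF 1] yy x0(1) by auto
      next
        case 2
        then show ?thesis using ij(2) x0(1) by (simp add: \<gamma>_def)
      next
        case 3
        then have "\<gamma> n j = y n j" "\<gamma> n i \<in> {x0 - \<eta>, x0}" by (simp_all add: \<gamma>_def)
        then show ?thesis using qj[OF 3(3)] x0(1) by auto
      next
        case 4
        then show ?thesis using ij(2) yy by (simp add: \<gamma>_def)
      qed
    qed
    have "mono (\<lambda>j. \<gamma> n (Suc j))" by (intro monoI mono_\<gamma>) auto
    then have "(\<Sum>j<M n - 1. \<bar>U (\<gamma> n (Suc (Suc j))) - U (\<gamma> n (Suc j))\<bar>) \<le> V" by (rule variation)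
    moreover have "near_sum (a n) (M n) = (\<Sum>j<M n - 1. \<bar>U (\<gamma> n (Suc (Suc j))) - U (\<gamma> n (Suc j))\<bar>)"
      unfolding near_sum_def
      by (rule sum.reindex_bij_witness[of _ Suc "\<lambda>i. i - 1"]) (auto simp: a_eq[OF n])
    ultimately show ?thesis by simp
  qed
  have "recovers a k"
    unfolding recovers_def
  proof (intro conjI allI impI)
    show "a n i \<in> {0, 1}" for n i by (simp add: a_def)
    show "(\<lambda>n. density n (a n) t) \<longlonglongrightarrow> primitive L U t"
      if t: "0 \<le> t" "t \<le> L" for t
    proof (rule density[OF _ _ t])
      show "a n i \<in> {0, 1}" for n i by (simp add: a_def)
      fix x assume x: "x \<in> {0<..<L}" "x \<noteq> x0"
      have Upos: "\<forall>\<^sub>F n in sequentially. 0 < y n (nat \<lceil>(real n)\<^sup>2 * x\<rceil>)"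
        by (rule order_tendstoD(1)[OF y_lim[OF x(1)]]) (use x in simp)
      have side: "\<forall>\<^sub>F n in sequentially. x0 < x \<longrightarrow> x0 < y n (nat \<lceil>(real n)\<^sup>2 * x\<rceil>)"
      proof (cases "x0 < x")
        case True
        then show ?thesis using order_tendstoD(1)[OF y_lim[OF x(1)], of x0] by simp
      qed simp
      have "\<bar>x - x0\<bar> > 0" using x by simp
      from D_small[OF this] ev_good Upos side
      show "\<forall>\<^sub>F n in sequentially. a n (nat \<lceil>(real n)\<^sup>2 * x\<rceil>) = U (y n (nat \<lceil>(real n)\<^sup>2 * x\<rceil>))"
      proof eventually_elim
        case (elim n)
        let ?N = "(real n)\<^sup>2"
        define i where "i = nat \<lceil>?N * x\<rceil>"
        have n: "n > 0" using elim by simp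
        have Nx: "0 < ?N * x" using x n by simp
        have i: "?N * x \<le> real i" "real i < ?N * x + 1" "i \<ge> 1" unfolding i_def using Nx by linarith+
        have y: "0 < y n i" "y n i < x" using elim(3) y_le[OF x(1) n] by (auto simp: i_def)
        show ?case unfolding i_def[symmetric]
        proof (cases "p n < i \<and> i \<le> q n")
          case False
          then show "a n i = U (y n i)" using Uy[of "y n i"] y x(1) by (auto simp: a_def \<gamma>_def)
        next
          case True
          have "\<not> y n i < x0 - \<eta>" "y n i < x0 + \<eta>"
            using True cut[OF n i(3), of "x0 - \<eta>"] cut[OF n i(3), of "x0 + \<eta>"] by (auto simp: p_def q_def)
          have mn: "real (p n) + real (m n) = real (s n) + (2 * \<alpha> - 1) * D n" using elim(2) by (simp add: good_def)
          have "0 \<le> ?N * x0" using x0 by simp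
          then have s: "?N * x0 \<le> real (s n)" "real (s n) < ?N * x0 + 1" unfolding s_def by linarith+
          have D: "\<bar>D n\<bar> + 2 \<le> \<bar>x - x0\<bar> * ?N" using elim(1) by simp
          show "a n i = U (y n i)"
          proof (cases "x < x0")
            case True
            then have "\<bar>D n\<bar> + 2 \<le> ?N * x0 - ?N * x" using D by (simp add: algebra_simps)
            then have "real i \<le> real (p n) + real (m n)" using mn s i sD[of n] by linarith
            then have "i \<le> p n + m n" by linarith
            then have "\<gamma> n i = x0 - \<eta>" using \<open>p n < i \<and> i \<le> q n\<close> by (simp add: \<gamma>_def)
            moreover have "U (x0 - \<eta>) = U 0" "U (y n i) = U 0"
              using x0 y True by (intro before; simp)+
            ultimately show ?thesis using \<alpha> by (auto simp: a_def \<alpha>_def)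
          next
            case False
            then have xx: "x0 < x" using x by simp
            then have "\<bar>D n\<bar> + 2 \<le> ?N * x - ?N * x0" using D by (simp add: algebra_simps)
            then have "real (p n) + real (m n) < real i" using mn s i sD[of n] by linarith
            then have "\<not> i \<le> p n + m n" by linarith
            then have "\<gamma> n i = x0" using \<open>p n < i \<and> i \<le> q n\<close> by (simp add: \<gamma>_def)
            moreover have "x0 < y n i" using elim(4) xx by (simp add: i_def)
            then have "U x0 = 1 - U 0" "U (y n i) = 1 - U 0"
              using x0 \<open>y n i < x0 + \<eta>\<close> by (intro after; simp)+
            ultimately show ?thesis using \<alpha> by (auto simp: a_def \<alpha>_def)
          qed
        qed
      qed
    qed
    show "\<forall>\<^sub>F n in sequentially. (\<Sum>i\<in>{1..nsites L n}. a n i) = real (k n)"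
      using ev_good
    proof eventually_elim
      case (elim n)
      then have n: "n > 0" and qM: "q n \<le> M n" and mn: "real (m n) = real (s n) - real (p n) + (2 * \<alpha> - 1) * D n"
        and mq: "p n + m n \<le> q n" by (auto simp: good_def)
      have "(\<Sum>i\<in>{1..M n}. a n i) - S n = (\<Sum>i\<in>{1..M n}. a n i - of_bool (U (y n i) = 1))"
        by (simp add: S_def sum_subtractf)
      also have "\<dots> = (\<Sum>i\<in>{p n<..q n}. (2 * \<alpha> - 1) * (of_bool (i \<le> p n + m n) - of_bool (i \<le> s n)))"
      proof (rule sum.mono_neutral_cong_right)
        show "{p n<..q n} \<subseteq> {1..M n}" using qM by auto
        show "\<forall>i\<in>{1..M n} - {p n<..q n}. a n i - of_bool (U (y n i) = 1) = 0"
          by (auto simp: a_def \<gamma>_def)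
        fix i assume i: "i \<in> {p n<..q n}"
        then have i1: "i \<ge> 1" "i \<in> {1..M n}" using qM by auto
        have yi: "\<not> y n i < x0 - \<eta>" "y n i < x0 + \<eta>" "i \<le> s n \<longleftrightarrow> y n i < x0"
          using i cut[OF n i1(1), of "x0 - \<eta>"] cut[OF n i1(1), of "x0 + \<eta>"] cut[OF n i1(1), of x0]
          unfolding p_def q_def s_def greaterThanAtMost_iff by linarith+
        have "U (y n i) = (1 - \<alpha>) + (2 * \<alpha> - 1) * of_bool (i \<le> s n)"
        proof (cases "i \<le> s n")
          case True
          have "U (y n i) = U 0" by (rule before) (use y_range[OF n i1(2)] yi True in auto)
          then show ?thesis using True by (simp add: \<alpha>_def)
        next
          case False
          have "U (y n i) = 1 - U 0" by (rule after) (use yi False in auto)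
          then show ?thesis using False by (simp add: \<alpha>_def)
        qed
        moreover have "U (\<gamma> n i) = (1 - \<alpha>) + (2 * \<alpha> - 1) * of_bool (i \<le> p n + m n)"
        proof -
          have "U (x0 - \<eta>) = U 0" by (rule before) (use x0 in auto)
          moreover have "U x0 = 1 - U 0" by (rule after) (use x0 in auto)
          ultimately show ?thesis using i by (simp add: \<gamma>_def \<alpha>_def)
        qed
        moreover have "a n i = U (\<gamma> n i)" "of_bool (U (y n i) = 1) = U (y n i)"
          using a_eq[OF n i1(2)] Uy y_range[OF n i1(2)] by auto
        ultimately show "a n i - of_bool (U (y n i) = 1) = (2 * \<alpha> - 1) * (of_bool (i \<le> p n + m n) - of_bool (i \<le> s n))"
          by (simp only:) (simp add: algebra_simps)
      qed simp
      also have "\<dots> = (2 * \<alpha> - 1) * ((\<Sum>i\<in>{p n<..q n}. of_bool (i \<le> p n + m n)) - (\<Sum>i\<in>{p n<..q n}. of_bool (i \<le> s n)))"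
        by (simp only: sum_distrib_left[symmetric] sum_subtractf)
      also have "\<dots> = (2 * \<alpha> - 1) * (real (p n + m n) - real (s n))"
        using psq[of n] mq by (subst (1 2) sum_of_bool_le) auto
      also have "real (p n + m n) - real (s n) = (2 * \<alpha> - 1) * D n" using mn by simp
      also have "(2 * \<alpha> - 1) * ((2 * \<alpha> - 1) * D n) = D n" using \<alpha> by auto
      finally show ?case by (simp add: D_def M_def)
    qed
    fix \<epsilon> :: real assume \<epsilon>: "\<epsilon> > 0"
    have mx: "0 \<le> mixed_length" unfolding mixed_length_def by (rule integral_nonneg_AE) simp
    have "(\<lambda>n. V / real n) \<longlonglongrightarrow> 0" by (rule tendsto_divide_0[OF tendsto_const filterlim_at_top_imp_at_infinity[OF filterlim_real_sequentially]])
    then have "\<forall>\<^sub>F n in sequentially. V / real n < \<epsilon>" using \<epsilon> by (rule order_tendstoD)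
    then show "\<forall>\<^sub>F n in sequentially. helix_energy L n (a n) \<le> 2 * mixed_length + V + \<epsilon>"
      using ev_good
    proof eventually_elim
      case (elim n)
      then have n: "real n > 0" by (auto simp: good_def)
      have nV: "near_sum (a n) (M n) \<le> V" by (rule near_V[OF elim(2)])
      have "near_sum (a n) (M n) + far_sum (a n) n (M n) \<le> V + real n * V"
        using nV far_sum_le_near_sum[of "a n" n "M n"] mult_left_mono[OF nV, of "real n"] by linarith
      then have "(near_sum (a n) (M n) + far_sum (a n) n (M n)) / real n \<le> (V + real n * V) / real n"
        using n by (intro divide_right_mono) auto
      also have "\<dots> = V / real n + V" using n by (simp add: add_divide_distrib)
      finally show ?case using elim(1) mx by (simp add: M_def)
    qed
  qed
  then show ?thesis by blast
qed

end

section \<open>The Gamma-limit\<close>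

lemma recovery_sequence:
  fixes L \<sigma> :: real and k :: "nat \<Rightarrow> nat"
  assumes L: "L > 0" and \<sigma>: "0 < \<sigma>" "\<sigma> < 1"
    and k: "(\<lambda>n. real (k n) / (L * (real n)\<^sup>2)) \<longlonglongrightarrow> \<sigma>"
    and bv: "u \<in> BV L" and um: "u \<in> borel_measurable (leb_on_ivl L)"
    and u01: "AE x in leb_on_ivl L. 0 \<le> u x \<and> u x \<le> 1"
    and uint: "(\<integral>x. u x \<partial>leb_on_ivl L) = L * \<sigma>"
  obtains a m V where "0 \<le> m" "0 \<le> V"
    "emeasure lebesgue {x \<in> {0<..<L}. 0 < u x \<and> u x < 1} = ennreal m"
    "total_variation (borel_ivl L) (distr_deriv L u) {0<..<L} = ennreal V"
    "\<And>n i. a n i \<in> {0, 1}"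
    "\<forall>\<^sub>F n in sequentially. (\<Sum>i\<in>{1..nsites L n}. a n i) = real (k n)"
    "\<And>\<epsilon>. \<epsilon> > 0 \<Longrightarrow> \<forall>\<^sub>F n in sequentially.
        helix_energy L n (a n) \<le> 2 * m + V + \<epsilon>"
    "\<And>t. 0 \<le> t \<Longrightarrow> t \<le> L \<Longrightarrow>
        (\<lambda>n. density n (a n) t) \<longlonglongrightarrow> primitive L u t"
proof -
  let ?\<Omega> = "leb_on_ivl L"
  interpret finite_measure ?\<Omega> by (rule finite_measure_leb_on_ivl)
  have ub: "AE x in ?\<Omega>. \<bar>u x\<bar> \<le> 1" using u01 by eventually_elim auto
  obtain \<mu> \<nu> c where mu: "finite_measure \<mu>" "sets \<mu> = sets (borel_ivl L)"
    and nu: "finite_measure \<nu>" "sets \<nu> = sets (borel_ivl L)"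
    and D: "\<And>A. A \<in> sets (borel_ivl L) \<Longrightarrow> distr_deriv L u A = measure \<mu> A - measure \<nu> A"
    and rep: "AE x in ?\<Omega>. u x = c + measure \<mu> ({0<..<L} \<inter> {..x}) - measure \<nu> ({0<..<L} \<inter> {..x})"
    by (rule BV_representative[OF L bv um ub]) (rule that)
  define U where "U = (\<lambda>x. c + measure \<mu> ({0<..<L} \<inter> {..x}) - measure \<nu> ({0<..<L} \<inter> {..x}))"
  define G where "G = (\<lambda>x. measure \<mu> ({0<..<L} \<inter> {..x}) + measure \<nu> ({0<..<L} \<inter> {..x}))"
  define TV where "TV = total_variation (borel_ivl L) (distr_deriv L u) {0<..<L}"
  have ui: "integrable ?\<Omega> u" by (rule integrable_bounded_leb[OF um ub])
  have TV_le: "TV \<le> ennreal (measure \<mu> {0<..<L} + measure \<nu> {0<..<L})"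
    unfolding TV_def by (rule total_variation_le(2)[OF mu nu um ui rep])
  define V where "V = enn2real TV"
  have TV: "TV = ennreal V"
    unfolding V_def using le_less_trans[OF TV_le ennreal_less_top] by (rule ennreal_enn2real[symmetric])
  have uU: "AE x in ?\<Omega>. u x = U x" using rep by (simp add: U_def)
  note cmu = cumulative_facts[OF mu] and cnu = cumulative_facts[OF nu]
  have rc: "continuous (at_right x) U" for x
    unfolding U_def by (intro continuous_diff continuous_add continuous_const cumulative_right_continuous mu nu)
  \<comment> \<open>a bound that holds almost everywhere holds everywhere, by right continuity\<close>
  have rng: "0 \<le> U x \<and> U x \<le> 1" if x: "0 \<le> x" "x < L" for x
  proof -
    have ae: "AE y in ?\<Omega>. 0 \<le> U y \<and> U y \<le> 1" using uU u01 by eventually_elim simp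
    have dense: "\<exists>y. x < y \<and> y < b \<and> 0 \<le> U y \<and> U y \<le> 1" if b: "x < b" for b
    proof (rule ccontr)
      assume no: "\<not> ?thesis"
      have "AE y in ?\<Omega>. y \<notin> {x<..<min b L}" using ae by eventually_elim (use no in auto)
      then have "emeasure ?\<Omega> {x<..<min b L} = 0"
        using x by (intro AE_iff_measurable[THEN iffD1, of _ _ "\<lambda>y. y \<notin> {x<..<min b L}"])
          (auto simp: sets_restrict_space space_restrict_space image_iff intro!: bexI[of _ "{x<..<min b L}"])
      moreover have "emeasure ?\<Omega> {x<..<min b L} = ennreal (min b L - x)"
        using x b by (subst emeasure_restrict_space) auto
      ultimately show False using x b by (simp add: ennreal_eq_0_iff min_def split: if_splits)
    qed
    have lim: "(U \<longlongrightarrow> U x) (at_right x)" using rc[of x] by (simp add: continuous_within)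
    show ?thesis
    proof (rule ccontr)
      assume "\<not> ?thesis"
      then consider "U x < 0" | "1 < U x" by linarith
      then have "\<forall>\<^sub>F y in at_right x. \<not> (0 \<le> U y \<and> U y \<le> 1)"
      proof cases
        case 1
        from order_tendstoD(2)[OF lim this] show ?thesis by (rule eventually_mono) simp
      next
        case 2
        from order_tendstoD(1)[OF lim this] show ?thesis by (rule eventually_mono) simp
      qed
      then obtain b where "x < b" "\<And>y. x < y \<Longrightarrow> y < b \<Longrightarrow> \<not> (0 \<le> U y \<and> U y \<le> 1)"
        unfolding eventually_at_right_field by blast
      then show False using dense by blast
    qed
  qed
  interpret bv_profile L V "measure \<mu> {0<..<L} + measure \<nu> {0<..<L}" U G
  proof
    show "0 < L" by fact
    show "continuous (at_right x) U" for x by (rule rc)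
    show "0 \<le> U x \<and> U x \<le> 1" if "0 \<le> x" "x < L" for x by (rule rng[OF that])
    show "0 \<le> G x" for x using cmu(3)[of x] cnu(3)[of x] by (simp add: G_def)
    show "G x \<le> measure \<mu> {0<..<L} + measure \<nu> {0<..<L}" for x using cmu(4)[of x] cnu(4)[of x] by (simp add: G_def)
    show "\<bar>U y - U x\<bar> \<le> G y - G x" if "x \<le> y" for x y
      using monoD[OF cmu(1) that] monoD[OF cnu(1) that] by (simp add: U_def G_def abs_le_iff)
    show "(\<Sum>j<J. \<bar>U (x (Suc j)) - U (x j)\<bar>) \<le> V" if "mono x" for x :: "nat \<Rightarrow> real" and J
    proof -
      have s: "{0<..<L} \<inter> {..t} \<in> sets (borel_ivl L)" for t by (rule borel_sets_borel_ivl) auto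
      have "U (x (Suc j)) - U (x j) = distr_deriv L u ({0<..<L} \<inter> {..x (Suc j)}) - distr_deriv L u ({0<..<L} \<inter> {..x j})" for j
        unfolding U_def D[OF s] by simp
      then have "ennreal (\<Sum>j<J. \<bar>U (x (Suc j)) - U (x j)\<bar>) \<le> ennreal V"
        using partition_variation_le[OF mu nu D that, of J] unfolding TV_def[symmetric] TV by simp
      then show ?thesis by (simp add: V_def)
    qed
  qed
  have int_eq: "(\<integral>x. u x * indicator {..<t} x \<partial>?\<Omega>) = (\<integral>x. U x * indicator {..<t} x \<partial>?\<Omega>)" for t
  proof (rule integral_cong_AE)
    show "AE x in ?\<Omega>. u x * indicator {..<t} x = U x * indicator {..<t} x" using uU by eventually_elim simp
    show "(\<lambda>x. u x * indicator {..<t} x) \<in> borel_measurable ?\<Omega>"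
      by (intro borel_measurable_times um indicator_leb_measurable) simp
    show "(\<lambda>x. U x * indicator {..<t} x) \<in> borel_measurable ?\<Omega>"
      by (intro borel_measurable_times leb_on_ivl_borel U_measurable indicator_leb_measurable) simp
  qed
  have tot: "(\<integral>x. U x * indicator {..<L} x \<partial>?\<Omega>) = L * \<sigma>"
    unfolding int_eq[symmetric] uint[symmetric]
    by (rule Bochner_Integration.integral_cong) (auto simp: space_restrict_space)
  have k': "(\<lambda>n. real (k n) / (real n)\<^sup>2) \<longlonglongrightarrow> (\<integral>x. U x * indicator {..<L} x \<partial>?\<Omega>)"
    using tendsto_mult_left[OF k, of L] L unfolding tot by simp
  have "\<exists>a. recovers a k"
  proof (cases "\<exists>x. 0 \<le> x \<and> x < L \<and> 0 < U x \<and> U x < 1")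
    case True
    then show ?thesis using recovery_mixed[OF _ _ _ _ k'] by blast
  next
    case False
    have U01: "U x \<in> {0, 1}" if "0 \<le> x" "x < L" for x
      using rng[OF that] False that by force
    have "\<exists>z. 0 \<le> z \<and> z < L \<and> U z \<noteq> U 0"
    proof (rule ccontr)
      assume no: "\<not> ?thesis"
      have "(\<integral>x. U x * indicator {..<L} x \<partial>?\<Omega>) = (\<integral>x. U 0 \<partial>?\<Omega>)"
      proof (rule Bochner_Integration.integral_cong[OF refl])
        fix x assume "x \<in> space ?\<Omega>"
        then have x: "0 \<le> x" "x < L" by (auto simp: space_restrict_space)
        then have "U x = U 0" using no by blast
        then show "U x * indicator {..<L} x = U 0" using x by simp
      qed
      also have "\<dots> = L * U 0"
        using L by (simp add: space_restrict_space measure_restrict_space)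
      finally have "L * \<sigma> = L * U 0" using tot by simp
      then show False using L \<sigma> U01[of 0] by auto
    qed
    then show ?thesis using recovery_pure[OF U01 _ _ _ k'] by blast
  qed
  then obtain a where a: "recovers a k" by blast
  have m: "emeasure lebesgue {x \<in> {0<..<L}. 0 < u x \<and> u x < 1} = ennreal mixed_length"
    unfolding mixed_length_def by (rule emeasure_mixed_eq[OF um U_measurable uU])
  show thesis
  proof (rule that[OF _ V_nonneg m])
    show "0 \<le> mixed_length" unfolding mixed_length_def by (rule integral_nonneg_AE) simp
    show "total_variation (borel_ivl L) (distr_deriv L u) {0<..<L} = ennreal V" using TV by (simp add: TV_def)
    show "a n i \<in> {0, 1}" for n i using a unfolding recovers_def by blast
    show "\<forall>\<^sub>F n in sequentially. (\<Sum>i\<in>{1..nsites L n}. a n i) = real (k n)" using a unfolding recovers_def by blast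
    show "\<forall>\<^sub>F n in sequentially.
        helix_energy L n (a n) \<le> 2 * mixed_length + V + \<epsilon>" if "\<epsilon> > 0" for \<epsilon>
      using a that unfolding recovers_def by blast
    show "(\<lambda>n. density n (a n) t) \<longlonglongrightarrow> (\<integral>x. u x * indicator {..<t} x \<partial>?\<Omega>)"
      if "0 \<le> t" "t \<le> L" for t
      using a that unfolding recovers_def int_eq by blast
  qed
qed

lemma cell_fun_Linf:
  assumes "\<And>i. \<bar>a i\<bar> \<le> K"
  shows "cell_fun N a \<in> Linf L"
  unfolding Linf_def using assms
  by (auto intro!: leb_on_ivl_borel cell_fun_measurable exI[of _ K] AE_I2 simp: cell_fun_def)

lemma weak_star_of_primitives:
  assumes L: "L > 0" and un: "\<And>n. un n \<in> Linf L" and u: "u \<in> Linf L"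
    and b: "\<And>n. AE x in leb_on_ivl L. \<bar>un n x\<bar> \<le> 1"
    and prim: "\<And>t. 0 \<le> t \<Longrightarrow> t \<le> L \<Longrightarrow>
      (\<lambda>n. primitive L (un n) t) \<longlonglongrightarrow> primitive L u t"
  shows "weak_star_conv L un u"
  unfolding weak_star_conv_def
proof (intro conjI allI impI un u)
  fix g :: "real \<Rightarrow> real" assume g: "integrable (leb_on_ivl L) g"
  obtain C where um: "u \<in> borel_measurable (leb_on_ivl L)" and C: "AE x in leb_on_ivl L. \<bar>u x\<bar> \<le> C"
    using u by (auto simp: Linf_def)
  have unm: "un n \<in> borel_measurable (leb_on_ivl L)" for n using un[of n] by (simp add: Linf_def)
  have int: "integrable (leb_on_ivl L) (\<lambda>x. un n x * f x)" "integrable (leb_on_ivl L) (\<lambda>x. u x * f x)"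
    if "integrable (leb_on_ivl L) f" for f n
    using integrable_bounded_mult[OF unm b that] integrable_bounded_mult[OF um C that] by auto
  have "(\<lambda>n. \<integral>x. (un n x - u x) * g x \<partial>leb_on_ivl L) \<longlonglongrightarrow> 0"
  proof (rule weak_limit_of_primitives[OF _ _ L _ g])
    show "(\<lambda>x. un n x - u x) \<in> borel_measurable (leb_on_ivl L)" for n using unm um by simp
    show "AE x in leb_on_ivl L. \<bar>un n x - u x\<bar> \<le> 1 + C" for n
      using b[of n] C by eventually_elim linarith
    fix t :: real assume t: "0 \<le> t" "t \<le> L"
    have i: "integrable (leb_on_ivl L) (indicator {..<t} :: real \<Rightarrow> real)" by (rule integrable_indicator_leb) simp
    show "(\<lambda>n. \<integral>x. (un n x - u x) * indicator {..<t} x \<partial>leb_on_ivl L) \<longlonglongrightarrow> 0"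
      using tendsto_diff[OF prim[OF t] tendsto_const[of "primitive L u t"]] int[OF i]
      by (simp add: left_diff_distrib)
  qed
  then have "(\<lambda>n. (\<integral>x. un n x * g x \<partial>leb_on_ivl L) - (\<integral>x. u x * g x \<partial>leb_on_ivl L)) \<longlonglongrightarrow> 0"
    using int[OF g] by (simp add: left_diff_distrib)
  then show "(\<lambda>n. \<integral>x. un n x * g x \<partial>leb_on_ivl L) \<longlonglongrightarrow> (\<integral>x. u x * g x \<partial>leb_on_ivl L)"
    by (rule LIM_zero_cancel)
qed

theorem theorem5:
  fixes L \<sigma> :: real and k :: "nat \<Rightarrow> nat"
  assumes "L > 0" and "0 < \<sigma>" and "\<sigma> < 1"
    and "\<And>n. n \<ge> 1 \<Longrightarrow> real (k n) \<le> L * (real n)\<^sup>2"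
    and "(\<lambda>n. real (k n) / (L * (real n)\<^sup>2)) \<longlonglongrightarrow> \<sigma>"
  shows "Gamma_conv L (\<lambda>n. F_discrete L (k n) n) (F_limit L \<sigma>)"
  unfolding Gamma_conv_def
proof (intro conjI ballI allI impI)
  note L = assms(1) and k = assms(5)
  have k2: "(\<lambda>n. real (k n) / (real n)\<^sup>2) \<longlonglongrightarrow> L * \<sigma>"
    using tendsto_mult_left[OF k, of L] L by simp
  fix u assume u: "u \<in> Linf L"
  then obtain K where um: "u \<in> borel_measurable (leb_on_ivl L)" and ub: "AE x in leb_on_ivl L. \<bar>u x\<bar> \<le> K"
    by (auto simp: Linf_def)
  {
    fix un assume ws: "weak_star_conv L un u"
    show "F_limit L \<sigma> u \<le> liminf (\<lambda>n. F_discrete L (k n) n (un n))"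
    proof (rule dense_ge)
      \<comment> \<open>pass to a subsequence along which the energies stay below \<open>C\<close>\<close>
      fix C' assume C': "liminf (\<lambda>n. F_discrete L (k n) n (un n)) < C'"
      show "F_limit L \<sigma> u \<le> C'"
      proof (cases C')
        case (real C)
        have "\<exists>\<^sub>F n in sequentially. F_discrete L (k n) n (un n) < C'"
        proof (rule ccontr)
          assume "\<not> ?thesis"
          then have "\<forall>\<^sub>F n in sequentially. C' \<le> F_discrete L (k n) n (un n)"
            by (simp add: not_frequently not_less)
          then have "C' \<le> liminf (\<lambda>n. F_discrete L (k n) n (un n))" by (rule Liminf_bounded)
          then show False using C' by simp
        qed
        then have "\<exists>\<^sub>F n in sequentially. n \<ge> 2 \<and> F_discrete L (k n) n (un n) < C'"
          by (rule frequently_rev_mp) (rule eventually_mono[OF eventually_ge_at_top[of 2]], simp)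
        then obtain r :: "nat \<Rightarrow> nat" where r: "strict_mono r" "\<And>j. r j \<ge> 2 \<and> F_discrete L (k (r j)) (r j) (un (r j)) < C'"
          using infinite_enumerate[of "{n. n \<ge> 2 \<and> F_discrete L (k n) n (un n) < C'}"]
          by (auto simp: frequently_cofinite[symmetric] cofinite_eq_sequentially)
        define R where "R = (\<lambda>j a. (\<forall>i. a i \<in> {0, 1::real}) \<and> (\<Sum>i\<in>{1..nsites L (r j)}. a i) = real (k (r j)) \<and>
           helix_energy L (r j) a \<le> C \<and>
           (AE x in leb_on_ivl L. un (r j) x = cell_fun ((real (r j))\<^sup>2) a x))"
        have "\<exists>a. R j a" for j
        proof -
          let ?n = "r j"
          have n: "?n \<ge> 2" "?n \<ge> 1" using r(2)[of j] by auto
          from r(2)[of j] obtain v where v: "v \<in> admissible L ?n (k ?n)" "AE x in leb_on_ivl L. un ?n x = v x"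
            "ennreal (lattice_energy L ?n v) < C'"
            unfolding F_discrete_def INF_less_iff by auto
          obtain a where a: "v = cell_fun ((real ?n)\<^sup>2) a" "\<And>i. a i \<in> {0, 1}"
            "\<And>i. i \<in> sites L ?n \<Longrightarrow> site_value ?n v i = a i" "(\<Sum>i\<in>{1..nsites L ?n}. a i) = real (k ?n)"
            using admissible_cell_fun[OF n(2) v(1)] by metis
          have "lattice_energy L ?n v < C" using v(3) real by (simp add: ennreal_less_iff lattice_energy_nonneg)
          then have "R j a" using a v(2) lattice_energy_eq[OF n(1) a(3) a(2)] by (simp add: R_def)
          then show ?thesis by blast
        qed
        then obtain a where "\<And>j. R j (a j)" by metis
        then have a: "\<And>j i. a j i \<in> {0, 1::real}" "\<And>j. (\<Sum>i\<in>{1..nsites L (r j)}. a j i) = real (k (r j))"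
          "\<And>j. helix_energy L (r j) (a j) \<le> C"
          "\<And>j. AE x in leb_on_ivl L. un (r j) x = cell_fun ((real (r j))\<^sup>2) (a j) x"
          unfolding R_def by blast+
        have weak: "(\<lambda>j. primitive L (cell_fun ((real (r j))\<^sup>2) (a j)) t)
          \<longlonglongrightarrow> primitive L u t" for t
        proof -
          have i: "integrable (leb_on_ivl L) (indicator {..<t} :: real \<Rightarrow> real)" by (rule integrable_indicator_leb) simp
          have "(\<lambda>n. primitive L (un n) t) \<longlonglongrightarrow> primitive L u t"
            using ws i unfolding weak_star_conv_def by blast
          then have "(\<lambda>j. primitive L (un (r j)) t) \<longlonglongrightarrow> primitive L u t"
            using LIMSEQ_subseq_LIMSEQ[OF _ r(1)] by (force simp: comp_def)
          moreover have "primitive L (un (r j)) t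
             = primitive L (cell_fun ((real (r j))\<^sup>2) (a j)) t" for j
          proof (rule integral_cong_AE)
            show "(\<lambda>x. un (r j) x * indicator {..<t} x) \<in> borel_measurable (leb_on_ivl L)"
              using ws by (intro borel_measurable_times indicator_leb_measurable) (auto simp: weak_star_conv_def Linf_def)
            show "(\<lambda>x. cell_fun ((real (r j))\<^sup>2) (a j) x * indicator {..<t} x) \<in> borel_measurable (leb_on_ivl L)"
              by (intro leb_on_ivl_borel borel_measurable_times cell_fun_measurable) simp
            show "AE x in leb_on_ivl L. un (r j) x * indicator {..<t} x = cell_fun ((real (r j))\<^sup>2) (a j) x * indicator {..<t} x"
              using a(4)[of j] by eventually_elim simp
          qed
          ultimately show ?thesis by simp
        qed
        have r2: "r j \<ge> 2" for j using r(2)[of j] by simp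
        note lb = energy_lower_bound[OF L r2 filterlim_subseq[OF r(1)] a(1) a(3) um ub weak]
        have "(\<integral>x. u x \<partial>leb_on_ivl L) = L * \<sigma>"
        proof -
          have a01: "\<bar>a j i\<bar> \<le> 1" for j i using a(1)[of j i] by auto
          have "(\<lambda>j. primitive L (cell_fun ((real (r j))\<^sup>2) (a j)) L - real (k (r j)) / (real (r j))\<^sup>2) \<longlonglongrightarrow> 0"
          proof (rule Lim_null_comparison)
            show "\<forall>\<^sub>F j in sequentially. norm (primitive L (cell_fun ((real (r j))\<^sup>2) (a j)) L - real (k (r j)) / (real (r j))\<^sup>2)
              \<le> 1 / (real (r j))\<^sup>2"
            proof (intro always_eventually allI)
              fix j
              have "(real (r j))\<^sup>2 > 0" using r2[of j] by simp
              then show "norm (primitive L (cell_fun ((real (r j))\<^sup>2) (a j)) L - real (k (r j)) / (real (r j))\<^sup>2)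
                \<le> 1 / (real (r j))\<^sup>2"
                using integral_cell_fun[of "(real (r j))\<^sup>2" L L "a j" 1] L a01 a(2)[of j] by (simp add: mult.commute)
            qed
            have "(\<lambda>n. 1 / (real n)\<^sup>2) \<longlonglongrightarrow> 0" by real_asymp
            from LIMSEQ_subseq_LIMSEQ[OF this r(1)] show "(\<lambda>j. 1 / (real (r j))\<^sup>2) \<longlonglongrightarrow> 0" by (simp add: comp_def)
          qed
          from tendsto_diff[OF weak[of L] this] LIMSEQ_subseq_LIMSEQ[OF k2 r(1)]
          have "primitive L u L = L * \<sigma>"
            by (auto simp: comp_def dest: LIMSEQ_unique)
          moreover have "primitive L u L = (\<integral>x. u x \<partial>leb_on_ivl L)"
            by (rule Bochner_Integration.integral_cong) (auto simp: space_restrict_space)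
          ultimately show ?thesis by simp
        qed
        then show ?thesis using lb real by (simp add: F_limit_def)
      qed simp
    qed
  }
  show "\<exists>un. weak_star_conv L un u \<and> limsup (\<lambda>n. F_discrete L (k n) n (un n)) \<le> F_limit L \<sigma> u"
  proof (cases "F_limit L \<sigma> u = \<infinity>")
    case True
    moreover have "weak_star_conv L (\<lambda>_. u) u" using u by (simp add: weak_star_conv_def)
    ultimately show ?thesis by (metis infinity_ennreal_def top_greatest)
  next
    case False
    then have fin: "u \<in> BV L" "AE x in leb_on_ivl L. 0 \<le> u x \<and> u x \<le> 1" "(\<integral>x. u x \<partial>leb_on_ivl L) = L * \<sigma>"
      by (auto simp: F_limit_def split: if_splits)
    obtain a m V where mV: "0 \<le> m" "0 \<le> V"
      and m: "emeasure lebesgue {x \<in> {0<..<L}. 0 < u x \<and> u x < 1} = ennreal m"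
      and V: "total_variation (borel_ivl L) (distr_deriv L u) {0<..<L} = ennreal V"
      and a: "\<And>n i. a n i \<in> {0, 1}"
      and ak: "\<forall>\<^sub>F n in sequentially. (\<Sum>i\<in>{1..nsites L n}. a n i) = real (k n)"
      and ae: "\<And>\<epsilon>. \<epsilon> > 0 \<Longrightarrow> \<forall>\<^sub>F n in sequentially.
        helix_energy L n (a n) \<le> 2 * m + V + \<epsilon>"
      and ad: "\<And>t. 0 \<le> t \<Longrightarrow> t \<le> L \<Longrightarrow>
        (\<lambda>n. density n (a n) t) \<longlonglongrightarrow> primitive L u t"
      by (rule recovery_sequence[OF L assms(2,3) k fin(1) um fin(2,3)]) (rule that)
    define a' where "a' = (\<lambda>n i. if i \<in> {1..nsites L n} then a n i else 0)"
    define un where "un = (\<lambda>n. cell_fun ((real n)\<^sup>2) (a' n))"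
    have a': "a' n i \<in> {0, 1}" "\<bar>a' n i\<bar> \<le> 1" for n i using a[of n i] by (auto simp: a'_def)
    have "weak_star_conv L un u"
    proof (rule weak_star_of_primitives[OF L _ u])
      show "un n \<in> Linf L" for n unfolding un_def by (rule cell_fun_Linf) (rule a')
      show "AE x in leb_on_ivl L. \<bar>un n x\<bar> \<le> 1" for n using a' by (intro AE_I2) (simp add: un_def cell_fun_def)
      fix t :: real assume t: "0 \<le> t" "t \<le> L"
      have eq: "density n (a' n) t = density n (a n) t" for n
      proof -
        have "(real n)\<^sup>2 * t \<le> L * (real n)\<^sup>2" using t by (simp add: mult.commute mult_right_mono)
        then have "nat \<lfloor>(real n)\<^sup>2 * t\<rfloor> \<le> nsites L n" by (intro nat_mono floor_mono)
        then show ?thesis by (intro arg_cong2[where f="(/)"] sum.cong) (auto simp: a'_def)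
      qed
      have "(\<lambda>n. primitive L (un n) t - density n (a n) t) \<longlonglongrightarrow> 0"
        unfolding un_def eq[symmetric] by (rule primitive_minus_density[OF a'(2) t])
      from tendsto_add[OF this ad[OF t]]
      show "(\<lambda>n. primitive L (un n) t) \<longlonglongrightarrow> primitive L u t" by simp
    qed
    moreover have "limsup (\<lambda>n. F_discrete L (k n) n (un n)) \<le> F_limit L \<sigma> u"
    proof (rule ennreal_le_epsilon)
      fix \<epsilon> :: real assume \<epsilon>: "0 < \<epsilon>"
      have F: "F_limit L \<sigma> u + ennreal \<epsilon> = ennreal (2 * m + V + \<epsilon>)"
        using fin m V mV \<epsilon> by (simp add: F_limit_def ennreal_mult ennreal_plus)
      show "limsup (\<lambda>n. F_discrete L (k n) n (un n)) \<le> F_limit L \<sigma> u + ennreal \<epsilon>"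
        unfolding F
      proof (rule Limsup_bounded)
        show "\<forall>\<^sub>F n in sequentially. F_discrete L (k n) n (un n) \<le> ennreal (2 * m + V + \<epsilon>)"
          using ak ae[OF \<epsilon>] eventually_ge_at_top[of 2]
        proof eventually_elim
          case (elim n)
          have sum': "(\<Sum>i\<in>{1..nsites L n}. a' n i) = real (k n)" using elim(1) by (simp add: a'_def)
          have n1: "n \<ge> 1" using elim by simp
          have a'0: "a' n i = 0" if "i \<notin> {1..nsites L n}" for i unfolding a'_def using that by (rule if_not_P)
          have v: "un n \<in> admissible L n (k n)" unfolding un_def by (rule cell_fun_admissible(1)[OF n1 a'(1) a'0 sum'])
          have "lattice_energy L n (un n) = helix_energy L n (a n)"
          proof (rule lattice_energy_eq[OF elim(3)])
            show "site_value n (un n) i = a n i" if "i \<in> sites L n" for i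
              unfolding un_def using cell_fun_admissible(2)[OF n1 a'(1) a'0 sum', of i] that by (simp add: sites_eq a'_def)
          qed (rule a)
          then have "ennreal (lattice_energy L n (un n)) \<le> ennreal (2 * m + V + \<epsilon>)" using elim(2) by (simp add: ennreal_leI)
          moreover have "F_discrete L (k n) n (un n) \<le> ennreal (lattice_energy L n (un n))"
            unfolding F_discrete_def by (rule INF_lower) (use v in simp)
          ultimately show ?case by (rule order_trans[rotated])
        qed
      qed
    qed
    ultimately show ?thesis by blast
  qed
qed

end
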